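(* FLaMECaST is NP-hard on group-equally-spaced circular instances with one intermediate layer and cost parameter $\alpha\ge\log_n\!\left(m-1+\cos\left(\frac{\pi}{m}\right)\right)$, where $n$ is the number of sources and $m$ the number of groups of the instance.
   Context: FLaMECaST: an instance $I=(S,T,C,\alpha)$ consists of a finite set $S$ of sources and a finite set $T$ of sinks, each with a fixed position in $\mathbb{R}^2$, capacities $C=(c_0,\dots,c_{\lambda+1})$ with integers $c_0\ge\dots\ge c_{\lambda+1}\ge 1$ ($\lambda$ = number of intermediate layers), and a parameter $\alpha\in[0,1]$. A topology is a rooted forest (edges directed from child to parent) of height at most $\lambda+1$ whose leaves are exactly $S$ and whose roots lie in $T$ (other vertices are Steiner vertices); the layer of a vertex is its distance to its root; the load $\ell(v)$ of a vertex is the number of sources in its subtree and the load of edge $uv$ ($u$ child) is $\ell(u)$; it is valid if $\ell(v)\le c_i$ for every vertex $v$ in layer $i$. An embedding maps sources and sinks to their positions and Steiner vertices to arbitrary points; edge cost is $\|\mathrm{pos}(u)-\mathrm{pos}(v)\|\cdot\ell(uv)^\alpha$, and the goal is a valid layout (topology plus embedding) of minimum total cost. A circular instance has all sources on a circle and all sinks at its center; it is group-equally-spaced if the sources are partitioned into groups, sources of one group share a position, and the group positions are evenly distributed on the circle. *)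

theory Defs
  imports "HOL-Analysis.Analysis" "HOL-Computational_Algebra.Polynomial"
begin

section \<open>Polynomial time and NP-hardness\<close>

text \<open>Deterministic multi-tape Turing machines with two-way infinite tapes. States and tape symbols
  are initial segments of the natural numbers; state 0 is the start state and state 1 the halting
  state. Symbol 0 is the blank; the bits False and True are the symbols 1 and 2. A transition
  yields, for every tape, the symbol to write and the head movement.\<close>

record tm =
  tm_tapes :: nat
  tm_states :: nat
  tm_symbols :: nat
  tm_trans :: "nat \<Rightarrow> nat list \<Rightarrow> nat \<times> (nat \<times> int) list"

definition wf_tm :: "tm \<Rightarrow> bool" where
  "wf_tm M \<longleftrightarrow> tm_tapes M \<ge> 1 \<and> tm_states M \<ge> 2 \<and> tm_symbols M \<ge> 3 \<and>
     (\<forall>q syms. q < tm_states M \<and> length syms = tm_tapes M \<and> (\<forall>a\<in>set syms. a < tm_symbols M) \<longrightarrow>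
        (case tm_trans M q syms of (q', acts) \<Rightarrow>
           q' < tm_states M \<and> length acts = tm_tapes M \<and>
           (\<forall>(b, d)\<in>set acts. b < tm_symbols M \<and> d \<in> {-1, 0, 1})))"

type_synonym tm_config = "nat \<times> ((int \<Rightarrow> nat) \<times> int) list"

definition tape_of :: "bool list \<Rightarrow> int \<Rightarrow> nat" where
  "tape_of x i = (if 0 \<le> i \<and> i < int (length x) then (if x ! nat i then 2 else 1) else 0)"

definition tm_init :: "tm \<Rightarrow> bool list \<Rightarrow> tm_config" where
  "tm_init M x = (0, (tape_of x, 0) # replicate (tm_tapes M - 1) (tape_of [], 0))"

definition tm_step :: "tm \<Rightarrow> tm_config \<Rightarrow> tm_config" where
  "tm_step M c = (case c of (q, ts) \<Rightarrow>
     if q = 1 then c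
     else case tm_trans M q (map (\<lambda>(t, h). t h) ts) of (q', acts) \<Rightarrow>
       (q', map2 (\<lambda>(t, h) (b, d). (t(h := b), h + d)) ts acts))"

text \<open>The input is written on the first tape, the output is read off the last one.\<close>

definition tm_computes_in :: "tm \<Rightarrow> bool list \<Rightarrow> bool list \<Rightarrow> nat \<Rightarrow> bool" where
  "tm_computes_in M x y t \<longleftrightarrow>
     (case (tm_step M ^^ t) (tm_init M x) of (q, ts) \<Rightarrow> q = 1 \<and> fst (last ts) = tape_of y)"

definition polytime :: "(bool list \<Rightarrow> bool list) \<Rightarrow> bool" where
  "polytime f \<longleftrightarrow> (\<exists>M (p :: nat poly). wf_tm M \<and>
     (\<forall>x. \<exists>t \<le> poly p (length x). tm_computes_in M x (f x) t))"

definition class_P :: "bool list set set" where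
  "class_P = {L. polytime (\<lambda>x. [x \<in> L])}"

text \<open>Self-delimiting code of a bit string, used to form pairs by concatenation.\<close>

definition enc_bits :: "bool list \<Rightarrow> bool list" where
  "enc_bits x = concat (map (\<lambda>b. [True, b]) x) @ [False]"

definition class_NP :: "bool list set set" where
  "class_NP = {L. \<exists>R \<in> class_P. \<exists>p :: nat poly.
     \<forall>x. x \<in> L \<longleftrightarrow> (\<exists>w. length w \<le> poly p (length x) \<and> enc_bits x @ w \<in> R)}"

text \<open>NP-hardness of the decision problem \<open>Q\<close> on the inputs in \<open>D\<close>, where \<open>enc\<close> encodes inputs as
  bit strings. Every value of the reduction has to be the code of an input in \<open>D\<close>, so that
  recognising \<open>D\<close> is not part of the problem.\<close>

definition NP_hard_on :: "('a \<Rightarrow> bool list) \<Rightarrow> 'a set \<Rightarrow> ('a \<Rightarrow> bool) \<Rightarrow> bool" where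
  "NP_hard_on enc D Q \<longleftrightarrow>
     (\<forall>L \<in> class_NP. \<exists>f. polytime f \<and> (\<forall>x. \<exists>i \<in> D. f x = enc i \<and> (x \<in> L \<longleftrightarrow> Q i)))"


section \<open>FLaMECaST\<close>

record ('s, 't) flamecast =
  sources :: "'s set"
  sinks :: "'t set"
  source_pos :: "'s \<Rightarrow> real ^ 2"
  sink_pos :: "'t \<Rightarrow> real ^ 2"
  capacities :: "nat list"
  alpha :: real

text \<open>The capacities are \<open>c\<^sub>0, \<dots>, c\<^bsub>\<lambda>+1\<^esub>\<close>, where \<open>\<lambda>\<close> is the number of intermediate layers.\<close>

definition num_layers :: "('s, 't) flamecast \<Rightarrow> nat" where
  "num_layers I = length (capacities I) - 2"

definition flamecast_instance :: "('s, 't) flamecast \<Rightarrow> bool" where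
  "flamecast_instance I \<longleftrightarrow> finite (sources I) \<and> finite (sinks I) \<and>
     length (capacities I) \<ge> 2 \<and> sorted_wrt (\<ge>) (capacities I) \<and>
     (\<forall>c \<in> set (capacities I). c \<ge> 1) \<and> 0 \<le> alpha I \<and> alpha I \<le> 1"

datatype ('s, 't) vertex = Source 's | Sink 't | Steiner nat

type_synonym ('s, 't) edges = "(('s, 't) vertex \<times> ('s, 't) vertex) set"

text \<open>Edges are pairs (child, parent).\<close>

definition rooted_forest :: "'v set \<Rightarrow> ('v \<times> 'v) set \<Rightarrow> bool" where
  "rooted_forest V E \<longleftrightarrow> finite V \<and> E \<subseteq> V \<times> V \<and> single_valued E \<and> acyclic E"

definition roots :: "'v set \<Rightarrow> ('v \<times> 'v) set \<Rightarrow> 'v set" where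
  "roots V E = {v \<in> V. \<nexists>p. (v, p) \<in> E}"

definition leaves :: "'v set \<Rightarrow> ('v \<times> 'v) set \<Rightarrow> 'v set" where
  "leaves V E = {v \<in> V. \<nexists>u. (u, v) \<in> E}"

definition layer :: "'v set \<Rightarrow> ('v \<times> 'v) set \<Rightarrow> 'v \<Rightarrow> nat" where
  "layer V E v = (THE i. \<exists>r \<in> roots V E. (v, r) \<in> E ^^ i)"

definition load :: "('s, 't) flamecast \<Rightarrow> ('s, 't) edges \<Rightarrow> ('s, 't) vertex \<Rightarrow> nat" where
  "load I E v = card {s \<in> sources I. (Source s, v) \<in> E\<^sup>*}"

definition topology :: "('s, 't) flamecast \<Rightarrow> ('s, 't) vertex set \<Rightarrow> ('s, 't) edges \<Rightarrow> bool" where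
  "topology I V E \<longleftrightarrow> rooted_forest V E \<and>
     (\<forall>v \<in> V. layer V E v \<le> num_layers I + 1) \<and>
     leaves V E = Source ` sources I \<and>
     roots V E \<subseteq> Sink ` sinks I \<and>
     V - leaves V E - roots V E \<subseteq> range Steiner"

definition valid_topology :: "('s, 't) flamecast \<Rightarrow> ('s, 't) vertex set \<Rightarrow> ('s, 't) edges \<Rightarrow> bool" where
  "valid_topology I V E \<longleftrightarrow> topology I V E \<and>
     (\<forall>v \<in> V. load I E v \<le> capacities I ! layer V E v)"

definition embedding :: "('s, 't) flamecast \<Rightarrow> (('s, 't) vertex \<Rightarrow> real ^ 2) \<Rightarrow> bool" where
  "embedding I pos \<longleftrightarrow> (\<forall>s \<in> sources I. pos (Source s) = source_pos I s) \<and>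
     (\<forall>t \<in> sinks I. pos (Sink t) = sink_pos I t)"

definition layout_cost ::
    "('s, 't) flamecast \<Rightarrow> ('s, 't) edges \<Rightarrow> (('s, 't) vertex \<Rightarrow> real ^ 2) \<Rightarrow> real" where
  "layout_cost I E pos =
     (\<Sum>(u, v) \<in> E. norm (pos u - pos v) * real (load I E u) powr alpha I)"

text \<open>The decision version: is there a valid layout of cost at most \<open>K\<close>?\<close>

definition has_layout_of_cost :: "('s, 't) flamecast \<Rightarrow> real \<Rightarrow> bool" where
  "has_layout_of_cost I K \<longleftrightarrow>
     (\<exists>V E pos. valid_topology I V E \<and> embedding I pos \<and> layout_cost I E pos \<le> K)"

definition polar :: "real \<Rightarrow> real \<Rightarrow> real ^ 2" where
  "polar r \<theta> = vector [r * cos \<theta>, r * sin \<theta>]"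

definition circular :: "('s, 't) flamecast \<Rightarrow> real ^ 2 \<Rightarrow> real \<Rightarrow> bool" where
  "circular I z r \<longleftrightarrow> r > 0 \<and> (\<forall>s \<in> sources I. dist z (source_pos I s) = r) \<and>
     (\<forall>t \<in> sinks I. sink_pos I t = z)"

text \<open>The groups are the fibres of \<open>g\<close>; numbered along the circle, consecutive group positions differ
  by the angle \<open>2\<pi>/m\<close>.\<close>

definition group_equally_spaced_circular :: "('s, 't) flamecast \<Rightarrow> nat \<Rightarrow> bool" where
  "group_equally_spaced_circular I m \<longleftrightarrow>
     (\<exists>z r \<theta> g. circular I z r \<and> g ` sources I = {..<m} \<and>
        (\<forall>s \<in> sources I. source_pos I s = z + polar r (\<theta> + 2 * pi * real (g s) / real m)))"


section \<open>Finite descriptions of instances\<close>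

text \<open>Equally spaced points on a circle do not have rational Cartesian coordinates in general.
  Points are therefore described in polar coordinates: \<open>(r, a)\<close> is the point with radius \<open>r\<close> and
  angle \<open>a\<pi>\<close>. A description lists the positions of all sources and of all sinks, the capacities
  and \<open>\<alpha>\<close>; the sources and the sinks are identified by their indices in these lists.\<close>

type_synonym flamecast_description = "(rat \<times> rat) list \<times> (rat \<times> rat) list \<times> nat list \<times> rat"

definition point_of :: "rat \<times> rat \<Rightarrow> real ^ 2" where
  "point_of p = polar (real_of_rat (fst p)) (real_of_rat (snd p) * pi)"

fun described_instance :: "flamecast_description \<Rightarrow> (nat, nat) flamecast" where
  "described_instance (ss, ts, cs, a) =
     \<lparr>sources = {..<length ss}, sinks = {..<length ts},
      source_pos = (\<lambda>i. point_of (ss ! i)), sink_pos = (\<lambda>i. point_of (ts ! i)),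
      capacities = cs, alpha = real_of_rat a\<rparr>"

fun binary :: "nat \<Rightarrow> bool list" where
  "binary n = (if n = 0 then [] else odd n # binary (n div 2))"

declare binary.simps [simp del]

definition enc_nat :: "nat \<Rightarrow> bool list" where
  "enc_nat n = enc_bits (binary n)"

definition enc_int :: "int \<Rightarrow> bool list" where
  "enc_int k = (k < 0) # enc_nat (nat \<bar>k\<bar>)"

definition enc_rat :: "rat \<Rightarrow> bool list" where
  "enc_rat x = enc_int (fst (quotient_of x)) @ enc_int (snd (quotient_of x))"

definition enc_point :: "rat \<times> rat \<Rightarrow> bool list" where
  "enc_point p = enc_rat (fst p) @ enc_rat (snd p)"

definition enc_list :: "('a \<Rightarrow> bool list) \<Rightarrow> 'a list \<Rightarrow> bool list" where
  "enc_list e xs = concat (map (\<lambda>x. True # e x) xs) @ [False]"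

fun enc_input :: "flamecast_description \<times> rat \<Rightarrow> bool list" where
  "enc_input ((ss, ts, cs, a), K) =
     enc_list enc_point ss @ enc_list enc_point ts @ enc_list enc_nat cs @ enc_rat a @ enc_rat K"

text \<open>The encoding is injective.\<close>

definition prefix_code :: "('a \<Rightarrow> bool list) \<Rightarrow> bool" where
  "prefix_code e \<longleftrightarrow> (\<forall>x y u v. e x @ u = e y @ v \<longrightarrow> x = y \<and> u = v)"

lemma prefix_codeD: "prefix_code e \<Longrightarrow> e x @ u = e y @ v \<Longrightarrow> x = y \<and> u = v"
  unfolding prefix_code_def by blast

lemma prefix_code_bits: "prefix_code enc_bits"
proof -
  have "x = y \<and> u = v" if "enc_bits x @ u = enc_bits y @ v" for x y u v
    using that
  proof (induction x arbitrary: y)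
    case Nil
    then show ?case by (cases y) (auto simp: enc_bits_def)
  next
    case (Cons a x)
    then show ?case by (cases y) (auto simp: enc_bits_def)
  qed
  then show ?thesis unfolding prefix_code_def by blast
qed

lemma binary_inj: "binary m = binary n \<Longrightarrow> m = n"
proof (induction m arbitrary: n rule: less_induct)
  case (less m)
  show ?case
  proof (cases "m = 0 \<or> n = 0")
    case True
    with less.prems show ?thesis
      by (metis binary.simps list.distinct(1))
  next
    case False
    then have "odd m = odd n" "binary (m div 2) = binary (n div 2)"
      using less.prems by (auto simp: binary.simps[of m] binary.simps[of n])
    moreover have "m div 2 < m" using False by simp
    ultimately have "m div 2 = n div 2" "m mod 2 = n mod 2"
      using less.IH by (blast, metis odd_iff_mod_2_eq_one parity_cases)
    then show ?thesis by (metis div_mult_mod_eq)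
  qed
qed

lemma prefix_code_nat: "prefix_code enc_nat"
  unfolding prefix_code_def enc_nat_def
  using prefix_codeD[OF prefix_code_bits] binary_inj by blast

lemma prefix_code_int: "prefix_code enc_int"
proof -
  have "x = y \<and> u = v" if "enc_int x @ u = enc_int y @ v" for x y u v
  proof -
    from that have s: "(x < 0) = (y < 0)" and "enc_nat (nat \<bar>x\<bar>) @ u = enc_nat (nat \<bar>y\<bar>) @ v"
      by (auto simp: enc_int_def)
    from prefix_codeD[OF prefix_code_nat this(2)] s show ?thesis by auto
  qed
  then show ?thesis unfolding prefix_code_def by blast
qed

lemma prefix_code_rat: "prefix_code enc_rat"
proof -
  have "x = y \<and> u = v" if "enc_rat x @ u = enc_rat y @ v" for x y u v
  proof -
    from that have *: "enc_int (fst (quotient_of x)) @ (enc_int (snd (quotient_of x)) @ u) =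
        enc_int (fst (quotient_of y)) @ (enc_int (snd (quotient_of y)) @ v)"
      by (simp add: enc_rat_def)
    note 1 = prefix_codeD[OF prefix_code_int *]
    note 2 = prefix_codeD[OF prefix_code_int conjunct2[OF 1]]
    from 1 2 show ?thesis by (metis prod_eq_iff quotient_of_inject)
  qed
  then show ?thesis unfolding prefix_code_def by blast
qed

lemma prefix_code_point: "prefix_code enc_point"
proof -
  have "x = y \<and> u = v" if "enc_point x @ u = enc_point y @ v" for x y u v
  proof -
    from that have *: "enc_rat (fst x) @ (enc_rat (snd x) @ u) =
        enc_rat (fst y) @ (enc_rat (snd y) @ v)"
      by (simp add: enc_point_def)
    note 1 = prefix_codeD[OF prefix_code_rat *]
    note 2 = prefix_codeD[OF prefix_code_rat conjunct2[OF 1]]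
    from 1 2 show ?thesis by (metis prod_eq_iff)
  qed
  then show ?thesis unfolding prefix_code_def by blast
qed

lemma prefix_code_list:
  assumes "prefix_code e"
  shows "prefix_code (enc_list e)"
proof -
  have "x = y \<and> u = v" if "enc_list e x @ u = enc_list e y @ v" for x y u v
    using that
  proof (induction x arbitrary: y)
    case Nil
    then show ?case by (cases y) (auto simp: enc_list_def)
  next
    case (Cons a x)
    show ?case
    proof (cases y)
      case Nil
      with Cons.prems show ?thesis by (simp add: enc_list_def)
    next
      case [simp]: (Cons b y')
      have "e a @ (enc_list e x @ u) = e b @ (enc_list e y' @ v)"
        using Cons.prems by (simp add: enc_list_def)
      from prefix_codeD[OF assms this] Cons.IH[of y'] show ?thesis by simp
    qed
  qed
  then show ?thesis unfolding prefix_code_def by blast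
qed

lemma inj_enc_input: "inj enc_input"
proof (rule injI)
  fix x y :: "flamecast_description \<times> rat"
  assume eq: "enc_input x = enc_input y"
  obtain ss ts cs a K where x: "x = ((ss, ts, cs, a), K)" by (metis prod.exhaust)
  obtain ss' ts' cs' a' K' where y: "y = ((ss', ts', cs', a'), K')" by (metis prod.exhaust)
  note pts = prefix_codeD[OF prefix_code_list[OF prefix_code_point]]
  note 1 = pts[OF eq[unfolded x y enc_input.simps]]
  note 2 = pts[OF conjunct2[OF 1]]
  note 3 = prefix_codeD[OF prefix_code_list[OF prefix_code_nat] conjunct2[OF 2]]
  note 4 = prefix_codeD[OF prefix_code_rat conjunct2[OF 3]]
  have "enc_rat K @ [] = enc_rat K' @ []" using 4 by simp
  from prefix_codeD[OF prefix_code_rat this] 1 2 3 4 show "x = y" by (simp add: x y)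
qed

end

theory Submission
  imports Defs
begin

text \<open>Every language in NP is reduced directly. An accepting computation of the verifier is a tableau, read as a
  tiling of a torus; a tiling is an exact cover by 5-tuples; an exact cover is a packing of numbers \<open>x\<close> of polynomial
  size into bins, and replacing \<open>x\<close> by \<open>(M + x)\<^sup>2 = M\<^sup>2 + 2 M x + x\<^sup>2\<close> for a large \<open>M\<close> makes all sizes perfect squares.

  An item of size \<open>b\<^sup>2\<close> becomes a group of \<open>b\<^sup>2\<close> sources and a bin becomes a sink. With \<open>\<alpha> = 1 / 2\<close> a group that is collected
  at its position and sent to the centre of the unit circle costs \<open>b\<close>, hence the cost bound, the sum of all \<open>b\<close>, is an
  integer. If each source is charged \<open>1 / b\<close>, then every Steiner vertex costs at least the charge of its sources, with
  equality only if it carries exactly one whole group: distinct groups have distance at least \<open>2 / m\<close>, while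
  \<open>b > m\<close>. So the layouts within the cost bound are the packings.

  The reduction only sums over bounded ranges, compares, adds and multiplies numbers of polynomial size, which a
  Turing machine with unary counters does in polynomial time.\<close>

section \<open>Counter programs\<close>

text \<open>Sources are listed one by one, so group sizes count in unary and the chain of reductions
  has to end in a packing of polynomially bounded numbers. This is why tuples of fixed length 5 are
  used: an item weight then has only 12 digits, to a base polynomial in the number of elements.
  Squares are used because \<open>n\<close> collected sources cost \<open>sqrt n\<close>; for
  arbitrary sizes the threshold would be a sum of square roots. In \<open>(M + x)^2\<close> the term
  \<open>M^2\<close> fixes the number of items per bin, the linear term carries \<open>x\<close>,
  and \<open>x^2\<close> vanishes in the slack. As the weights together fill all bins exactly, upper
  bounds on the bins turn into equalities. A torus has no boundary, so every border has exactly two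
  sides and all cells look alike to the cover; blank margins and a last row without a transition
  make its seams harmless. The condition on \<alpha> comes for free: each group has more than
  \<open>m^2\<close> sources, so the bound is at most \<open>log_n m\<close>, which is at most 1/2.
  The number of groups is rounded up to a power of two to keep the angles reduced fractions; small
  groups pad the difference.\<close>

text \<open>\<open>WhlIn c\<close> repeats \<open>c\<close> while the input head is on the input word, and \<open>AddBit r\<close> increments register \<open>r\<close> if the
  input head reads \<open>True\<close>. A state consists of the position of the input head, the registers and the output.
  The control state is the stack of commands that remain to be executed; only finitely many stacks,
  \<open>conts c []\<close>, are reachable from a program \<open>c\<close>, so that they can serve as the states of a Turing machine.\<close>

datatype com = Inc nat | Dec nat | Whl nat com | Sq com com | Rt | Lt | WhlIn com | AddBit nat | Emit bool

type_synonym state = "int \<times> (nat \<Rightarrow> nat) \<times> bool list"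

fun cstep :: "bool list \<Rightarrow> com list \<times> state \<Rightarrow> com list \<times> state" where
  "cstep x ([], s) = ([], s)"
| "cstep x (Inc r # k, (p, v, y)) = (k, (p, v(r := Suc (v r)), y))"
| "cstep x (Dec r # k, (p, v, y)) = (k, (p, v(r := v r - 1), y))"
| "cstep x (Whl r c # k, (p, v, y)) = (if v r = 0 then k else c # Whl r c # k, (p, v, y))"
| "cstep x (Sq a b # k, (p, v, y)) = (a # b # k, (p, v, y))"
| "cstep x (Rt # k, (p, v, y)) = (k, (p + 1, v, y))"
| "cstep x (Lt # k, (p, v, y)) = (k, (p - 1, v, y))"
| "cstep x (WhlIn c # k, (p, v, y)) = (if tape_of x p = 0 then k else c # WhlIn c # k, (p, v, y))"
| "cstep x (AddBit r # k, (p, v, y)) =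
     (k, (p, if tape_of x p = 2 then v(r := Suc (v r)) else v, y))"
| "cstep x (Emit b # k, (p, v, y)) = (k, (p, v, y @ [b]))"

text \<open>The stack \<open>k\<close> left behind by \<open>c\<close> is not listed, hence the
  \<open>insert\<close> in \<open>conts_closed\<close>. A loop stays on the stack below its own
  body, so running the body leads back to a listed stack and the set is finite.\<close>

fun conts :: "com \<Rightarrow> com list \<Rightarrow> com list set" where
  "conts (Sq a b) k = insert (Sq a b # k) (conts a (b # k) \<union> conts b k)"
| "conts (Whl r c) k = insert (Whl r c # k) (conts c (Whl r c # k))"
| "conts (WhlIn c) k = insert (WhlIn c # k) (conts c (WhlIn c # k))"
| "conts c k = {c # k}"

fun regs_below :: "nat \<Rightarrow> com \<Rightarrow> bool" where
  "regs_below K (Inc r) \<longleftrightarrow> r < K"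
| "regs_below K (Dec r) \<longleftrightarrow> r < K"
| "regs_below K (Whl r c) \<longleftrightarrow> r < K \<and> regs_below K c"
| "regs_below K (Sq a b) \<longleftrightarrow> regs_below K a \<and> regs_below K b"
| "regs_below K (WhlIn c) \<longleftrightarrow> regs_below K c"
| "regs_below K (AddBit r) \<longleftrightarrow> r < K"
| "regs_below K _ \<longleftrightarrow> True"

lemma regs_below_mono: "regs_below K c \<Longrightarrow> K \<le> L \<Longrightarrow> regs_below L c"
  by (induction c) auto

lemma ex_regs_below: "\<exists>K. regs_below K c"
proof (induction c)
  case (Sq a b)
  then obtain K L where "regs_below K a" "regs_below L b" by blast
  then have "regs_below (max K L) (Sq a b)" by (auto intro: regs_below_mono)
  then show ?case by blast
next
  case (Whl r c)
  then obtain K where "regs_below K c" by blast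
  then have "regs_below (max K (Suc r)) (Whl r c)" by (auto intro: regs_below_mono)
  then show ?case by blast
qed (auto intro: exI[of _ "Suc _"])

lemma finite_conts: "finite (conts c k)"
  by (induction c arbitrary: k) auto

lemma conts_self: "c # k \<in> conts c k"
  by (cases c) auto

lemma conts_regs_below:
  "ks \<in> conts c k \<Longrightarrow> regs_below K c \<Longrightarrow> list_all (regs_below K) k \<Longrightarrow> list_all (regs_below K) ks"
proof (induction c arbitrary: k)
  case (Sq a b)
  then show ?case by (fastforce)
next
  case (Whl r c)
  then show ?case by (fastforce)
next
  case (WhlIn c)
  then show ?case by (fastforce)
qed auto

definition keep :: "nat list \<Rightarrow> (nat \<times> int) list" where
  "keep a = map (\<lambda>b. (b, 0)) a"

text \<open>Tape 0 is the input, tape \<open>Suc r\<close> is register \<open>r\<close>, the last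
  tape is the output; \<open>a\<close> holds the symbols under the heads. Reading 1 on a register
  tape means reading the mark, that is, the value zero; \<open>Dec\<close> then does not move, in
  agreement with truncated subtraction.\<close>

fun control :: "nat list \<Rightarrow> com list \<Rightarrow> com list \<times> (nat \<times> int) list" where
  "control a [] = ([], keep a)"
| "control a (Inc r # k) = (k, (keep a)[Suc r := (a ! Suc r, 1)])"
| "control a (Dec r # k) =
     (k, if a ! Suc r = 1 then keep a else (keep a)[Suc r := (a ! Suc r, - 1)])"
| "control a (Whl r c # k) = (if a ! Suc r = 1 then k else c # Whl r c # k, keep a)"
| "control a (Sq c d # k) = (c # d # k, keep a)"
| "control a (Rt # k) = (k, (keep a)[0 := (a ! 0, 1)])"
| "control a (Lt # k) = (k, (keep a)[0 := (a ! 0, - 1)])"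
| "control a (WhlIn c # k) = (if a ! 0 = 0 then k else c # WhlIn c # k, keep a)"
| "control a (AddBit r # k) =
     (k, if a ! 0 = 2 then (keep a)[Suc r := (a ! Suc r, 1)] else keep a)"
| "control a (Emit b # k) = (k, (keep a)[length a - 1 := (if b then 2 else 1, 1)])"

lemma conts_closed:
  "ks \<in> conts c k \<Longrightarrow> fst (control a ks) \<in> insert k (conts c k)"
proof (induction c arbitrary: k)
  case (Sq c d)
  from Sq.prems consider "ks = Sq c d # k" | "ks \<in> conts c (d # k)" | "ks \<in> conts d k" by auto
  then show ?case
  proof cases
    case 2
    then show ?thesis using Sq.IH(1)[of "d # k"] conts_self[of d k] by auto
  qed (use Sq.IH(2)[of k] conts_self[of c] in auto)
next
  case (Whl r c)
  from Whl.prems consider "ks = Whl r c # k" | "ks \<in> conts c (Whl r c # k)" by auto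
  then show ?case
    by cases (use Whl.IH[of "Whl r c # k"] conts_self[of c] in auto)
next
  case (WhlIn c)
  from WhlIn.prems consider "ks = WhlIn c # k" | "ks \<in> conts c (WhlIn c # k)" by auto
  then show ?case
    by cases (use WhlIn.IH[of "WhlIn c # k"] conts_self[of c] in auto)
qed auto

text \<open>A register is a tape whose cell 0 carries a mark; the value is the position of the head.\<close>

definition mark :: "int \<Rightarrow> nat" where
  "mark i = (if i = 0 then 1 else 0)"

fun tapes :: "nat \<Rightarrow> bool list \<Rightarrow> state \<Rightarrow> ((int \<Rightarrow> nat) \<times> int) list" where
  "tapes K x (p, v, y) =
     (tape_of x, p) # map (\<lambda>r. (mark, int (v r))) [0..<K] @ [(tape_of y, int (length y))]"

abbreviation tape_reads :: "((int \<Rightarrow> nat) \<times> int) list \<Rightarrow> nat list" where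
  "tape_reads ts \<equiv> map (\<lambda>(t, h). t h) ts"

abbreviation tape_acts ::
    "((int \<Rightarrow> nat) \<times> int) list \<Rightarrow> (nat \<times> int) list \<Rightarrow> ((int \<Rightarrow> nat) \<times> int) list" where
  "tape_acts \<equiv> map2 (\<lambda>(t, h) (b, d). (t(h := b), h + d))"

lemma tape_acts_keep: "tape_acts ts (keep (tape_reads ts)) = ts"
  by (induction ts) (auto simp: keep_def)

lemma tape_acts_update:
  "i < length ts \<Longrightarrow> tape_acts ts ((keep (tape_reads ts))[i := (b, d)]) =
     ts[i := ((fst (ts ! i))(snd (ts ! i) := b), snd (ts ! i) + d)]" for ts i b d
proof (rule nth_equalityI)
  fix j assume i: "i < length ts" and "j < length (tape_acts ts ((keep (tape_reads ts))[i := (b, d)]))"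
  then have j: "j < length ts" by (simp add: keep_def)
  obtain t h where t: "ts ! j = (t, h)" by (metis surj_pair)
  show "tape_acts ts ((keep (tape_reads ts))[i := (b, d)]) ! j =
     ts[i := ((fst (ts ! i))(snd (ts ! i) := b), snd (ts ! i) + d)] ! j"
    using i j t by (cases "i = j") (simp_all add: keep_def)
qed (simp add: keep_def)

lemma length_tapes: "length (tapes K x s) = Suc (Suc K)"
  by (cases s) auto

lemma tapes_nth_reg: "r < K \<Longrightarrow> tapes K x (p, v, y) ! Suc r = (mark, int (v r))"
  by (auto simp: nth_append)

lemma tapes_nth_out: "tapes K x (p, v, y) ! Suc K = (tape_of y, int (length y))"
  by (auto simp: nth_append)

lemma tapes_upd_reg:
  "r < K \<Longrightarrow> (tapes K x (p, v, y))[Suc r := (mark, int n)] = tapes K x (p, v(r := n), y)"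
  by (auto intro!: nth_equalityI simp: nth_append nth_list_update)

lemma tape_of_snoc: "(tape_of y)(int (length y) := if b then 2 else 1) = tape_of (y @ [b])"
  by (rule ext) (auto simp: tape_of_def nth_append)

lemma tapes_upd_out:
  "(tapes K x (p, v, y))[Suc K := (tape_of (y @ [b]), int (length y) + 1)] = tapes K x (p, v, y @ [b])"
  by (simp add: list_update_append)

lemma mark_nat [simp]: "mark (int n) = (if n = 0 then 1 else 0)"
  by (simp add: mark_def)

lemma control_correct:
  fixes ks K x s
  defines "a \<equiv> tape_reads (tapes K x s)"
  assumes "list_all (regs_below K) ks"
  shows "fst (control a ks) = fst (cstep x (ks, s))"
    and "tape_acts (tapes K x s) (snd (control a ks)) = tapes K x (snd (cstep x (ks, s)))"
proof -
  obtain p v y where s: "s = (p, v, y)" by (metis prod_cases3)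
  have a0: "a ! 0 = tape_of x p" by (simp add: a_def s)
  have ar: "a ! Suc r = mark (int (v r))" if "r < K" for r
    using that tapes_nth_reg[OF that] length_tapes unfolding a_def s
    by (simp add: nth_append)
  have la: "length a = Suc (Suc K)" by (simp add: a_def length_tapes)
  have kp: "tape_acts (tapes K x s) (keep a) = tapes K x s"
    unfolding a_def by (rule tape_acts_keep)
  have up: "tape_acts (tapes K x s) ((keep a)[i := (b, d)]) =
     (tapes K x s)[i := ((fst (tapes K x s ! i))(snd (tapes K x s ! i) := b), snd (tapes K x s ! i) + d)]"
    if "i < Suc (Suc K)" for i b d
    unfolding a_def by (rule tape_acts_update) (use that in \<open>simp add: length_tapes\<close>)
  have reg: "tape_acts (tapes K x s) ((keep a)[Suc r := (a ! Suc r, d)]) = tapes K x (p, v(r := n), y)"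
    if "r < K" "int n = int (v r) + d" for r d n
    unfolding up[OF that(1)[THEN less_SucI, THEN Suc_mono]] ar[OF that(1)]
    by (simp only: s tapes_nth_reg[OF that(1)] fst_conv snd_conv fun_upd_triv
        tapes_upd_reg[OF that(1)] that(2)[symmetric])
  have inp: "tape_acts (tapes K x s) ((keep a)[0 := (a ! 0, d)]) = tapes K x (p + d, v, y)" for d
    using up[of 0] by (simp add: s a0)
  have out: "tape_acts (tapes K x s) ((keep a)[length a - 1 := (if b then 2 else 1, 1)])
      = tapes K x (p, v, y @ [b])" for b
    using up[of "Suc K"] unfolding la
    by (simp add: s tapes_nth_out tapes_upd_out tape_of_snoc del: tapes.simps fun_upd_apply)
  show "fst (control a ks) = fst (cstep x (ks, s))"
    using assms(2) by (cases "(x, ks, s)" rule: cstep.cases) (auto simp: ar a0 s)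
  show "tape_acts (tapes K x s) (snd (control a ks)) = tapes K x (snd (cstep x (ks, s)))"
    using assms(2)
  proof (cases ks)
    case (Cons c k)
    show ?thesis
    proof (cases c)
      case (Dec r)
      then show ?thesis using assms(2) reg[of r "v r - 1" "-1"] kp ar[of r] Cons
        by (auto simp: s of_nat_diff fun_upd_idem simp del: tapes.simps)
    next
      case (Inc r)
      then show ?thesis using assms(2) reg[of r "Suc (v r)" 1] Cons
        by (auto simp: s simp del: tapes.simps)
    next
      case (AddBit r)
      then show ?thesis using assms(2) reg[of r "Suc (v r)" 1] kp a0 Cons
        by (auto simp: s simp del: tapes.simps)
    next
      case (Emit b)
      then show ?thesis using out[of b] Cons by (simp add: s del: tapes.simps)
    qed (use Cons kp inp[of 1] inp[of "-1"] in \<open>auto simp: s simp del: tapes.simps\<close>)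
  qed (use kp in \<open>auto simp: s simp del: tapes.simps\<close>)
qed

lemma control_acts:
  assumes "length a = Suc (Suc K)" "\<forall>b\<in>set a. b < 3"
  shows "length (snd (control a ks)) = length a"
    and "\<forall>(b, d)\<in>set (snd (control a ks)). b < 3 \<and> d \<in> {- 1, 0, 1}"
proof -
  have k: "\<forall>(b, d)\<in>set (keep a). b < 3 \<and> d \<in> {- 1, 0, 1}"
    using assms by (auto simp: keep_def)
  have u: "\<forall>(b, d)\<in>set ((keep a)[i := (b', d')]). b < 3 \<and> d \<in> {- 1, 0, 1}"
    if "b' < 3" "d' \<in> {- 1, 0, 1}" for i b' d'
    using k that set_update_subset_insert[of "keep a" i "(b', d')"] by fast
  have u': "\<forall>(b, d)\<in>set ((keep a)[i := (a ! i, d')]). b < 3 \<and> d \<in> {- 1, 0, 1}"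
    if "d' \<in> {- 1, 0, 1}" for i d'
  proof (cases "i < length a")
    case True
    then show ?thesis using assms that by (intro u) auto
  next
    case False
    then have "(keep a)[i := (a ! i, d')] = keep a" by (simp add: keep_def list_update_beyond)
    then show ?thesis using k by simp
  qed
  show "length (snd (control a ks)) = length a"
    by (cases "(a, ks)" rule: control.cases) (auto simp: keep_def)
  show "\<forall>(b, d)\<in>set (snd (control a ks)). b < 3 \<and> d \<in> {- 1, 0, 1}"
  proof (cases ks)
    case Nil
    then show ?thesis using k by simp
  next
    case (Cons c k')
    have e: "\<forall>(b, d)\<in>set ((keep a)[i := (if b' then 2 else 1, 1)]). b < 3 \<and> d \<in> {- 1, 0, 1}" for i b'
      by (rule u) auto
    show ?thesis unfolding Cons
      by (cases c; simp only: control.simps snd_conv;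
          (rule k | rule e | (rule u'; simp) | (split if_split; intro conjI impI; (rule k | (rule u'; simp))+)))
  qed
qed


section \<open>Translation of counter programs into Turing machines\<close>

lemma polytime_if_program:
  fixes p :: "nat poly"
  assumes prog: "\<And>x. \<exists>t \<le> poly p (length x). \<exists>i v. (cstep x ^^ t) ([c], (0, \<lambda>_. 0, [])) = ([], (i, v, f x))"
  shows "polytime f"
proof -
  obtain K where K: "regs_below K c" using ex_regs_below by blast
  define S where "S = insert [] (conts c [])"
  have finS: "finite S" by (simp add: S_def finite_conts)
  obtain h where h: "bij_betw h {0..<card S} S" using ex_bij_betw_nat_finite[OF finS] by blast
  \<comment> \<open>State 1 halts and therefore must be the empty stack; state 0 is reserved for a
    preparatory step, so proper stacks are numbered from 2 on.\<close>
  define cd where "cd ks = (if ks = [] then 1 else 2 + the_inv_into {0..<card S} h ks)" for ks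
  have hcd: "h (cd ks - 2) = ks" "2 \<le> cd ks" "cd ks < card S + 2" if "ks \<in> S" "ks \<noteq> []" for ks
  proof -
    have "the_inv_into {0..<card S} h ks \<in> {0..<card S}"
      using h that by (metis bij_betw_def bij_betw_the_inv_into bij_betwE)
    then show "cd ks < card S + 2" "2 \<le> cd ks" using that by (auto simp: cd_def)
    show "h (cd ks - 2) = ks"
      using h that by (simp add: cd_def f_the_inv_into_f_bij_betw)
  qed
  have cd_less: "cd ks < card S + 2" if "ks \<in> S" for ks
  proof (cases "ks = []")
    case True
    then show ?thesis by (simp add: cd_def)
  qed (use hcd that in auto)
  have closed: "fst (control a ks) \<in> S" if "ks \<in> S" for ks a
    using that conts_closed[of ks c "[]" a] by (auto simp: S_def)
  have regs: "list_all (regs_below K) ks" if "ks \<in> S" for ks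
    using that conts_regs_below[of ks c "[]" K] K by (auto simp: S_def)
  define M where "M = \<lparr>tm_tapes = K + 2, tm_states = card S + 2, tm_symbols = 3,
    tm_trans = (\<lambda>q a. if q = 0 then (cd [c], (a ! 0, 0) # replicate K (1, 0) @ [(a ! Suc K, 0)])
      else if q = 1 then (1, keep a)
      else case control a (h (q - 2)) of (ks, acts) \<Rightarrow> (cd ks, acts))\<rparr>"
  have cS: "[c] \<in> S" using conts_self[of c "[]"] by (simp add: S_def)
  have wf: "wf_tm M"
    unfolding wf_tm_def
  proof (intro conjI allI impI)
    fix q a assume *: "q < tm_states M \<and> length a = tm_tapes M \<and> (\<forall>b\<in>set a. b < tm_symbols M)"
    then have q: "q < card S + 2" and la: "length a = Suc (Suc K)" and a3: "\<forall>b\<in>set a. b < 3"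
      by (simp_all add: M_def)
    show "case tm_trans M q a of (q', acts) \<Rightarrow> q' < tm_states M \<and> length acts = tm_tapes M \<and>
           (\<forall>(b, d)\<in>set acts. b < tm_symbols M \<and> d \<in> {-1, 0, 1})"
    proof -
      consider "q = 0" | "q = 1" | "q \<ge> 2" by linarith
      then show ?thesis
      proof cases
        case 1
        have "a ! 0 < 3" "a ! Suc K < 3" using la a3 by auto
        then show ?thesis using 1 cd_less[OF cS] by (auto simp: M_def)
      next
        case 2
        then show ?thesis using la a3 by (auto simp: M_def keep_def)
      next
        case 3
        have "h (q - 2) \<in> S" using q 3 by (intro bij_betwE[OF h, rule_format]) auto
        then have "fst (control a (h (q - 2))) \<in> S" by (rule closed)
        then show ?thesis using 3 cd_less control_acts[OF la a3, of "h (q - 2)"] la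
          by (auto simp: M_def split: prod.splits)
      qed
    qed
  qed (auto simp: M_def)
  define cfg where "cfg x = (\<lambda>(ks, s). (cd ks, tapes K x s))" for x
  have step: "tm_step M (cfg x (ks, s)) = cfg x (cstep x (ks, s)) \<and> fst (cstep x (ks, s)) \<in> S" if "ks \<in> S" for x ks s
  proof (cases "ks = []")
    case True
    then show ?thesis by (simp add: cfg_def tm_step_def cd_def S_def)
  next
    case False
    let ?a = "tape_reads (tapes K x s)"
    obtain ks' acts where ca: "control ?a ks = (ks', acts)" by (metis surj_pair)
    obtain ks2 s2 where cs: "cstep x (ks, s) = (ks2, s2)" by (metis surj_pair)
    have e: "ks' = ks2" "tape_acts (tapes K x s) acts = tapes K x s2"
      using control_correct[OF regs[OF that], of x s] ca cs by simp_all
    have "ks' \<in> S" using closed[OF that, of ?a] ca by simp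
    moreover have "tm_step M (cfg x (ks, s)) = (cd ks', tape_acts (tapes K x s) acts)"
      using hcd[OF that False] ca by (simp add: cfg_def tm_step_def M_def)
    ultimately show ?thesis using e cs by (simp add: cfg_def)
  qed
  have steps: "(tm_step M ^^ t) (cfg x ([c], s)) = cfg x ((cstep x ^^ t) ([c], s)) \<and> fst ((cstep x ^^ t) ([c], s)) \<in> S" for t x s
  proof (induction t)
    case 0
    then show ?case using cS by simp
  next
    case (Suc t)
    obtain ks s' where e: "(cstep x ^^ t) ([c], s) = (ks, s')" by (metis surj_pair)
    then have "ks \<in> S" using Suc by simp
    from step[OF this, of x s'] Suc e show ?case by simp
  qed
  have rd0: "map (\<lambda>(t, h). t h) (replicate (Suc K) (tape_of [], 0 :: int)) = replicate (Suc K) 0"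
    by (simp add: tape_of_def)
  \<comment> \<open>The step out of state 0 writes the marks into cell 0 of the register tapes. It
    is the additional step in the time bound \<open>p + 1\<close>.\<close>
  have init: "tm_step M (tm_init M x) = cfg x ([c], (0, \<lambda>_. 0, []))" for x
  proof -
    have e: "replicate (Suc K) (tape_of [], 0 :: int) = replicate K (tape_of [], 0) @ [(tape_of [], 0)]"
      by (simp add: replicate_append_same)
    have m: "(tape_of [])(0 := Suc 0) = mark" by (auto simp: tape_of_def mark_def)
    have m0: "(tape_of [])(0 := 0) = tape_of []" by (auto simp: tape_of_def)
    have z: "tape_acts (replicate K (tape_of [], 0)) (replicate K (Suc 0, 0)) = replicate K (mark, 0)"
      by (induction K) (simp_all only: replicate_Suc replicate_0 zip_Cons_Cons list.map zip_Nil m case_prod_conv add_0)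
    have r: "map (\<lambda>(t, h). t h) (replicate K (tape_of [], 0 :: int)) = replicate K 0"
      by (simp add: tape_of_def)
    have mr: "map (\<lambda>r. (mark, int 0)) [0..<K] = replicate K (mark, 0)"
      by (simp add: map_replicate_const)
    have "tm_init M x = (0, (tape_of x, 0) # replicate K (tape_of [], 0) @ [(tape_of [], 0)])"
      using e by (simp add: tm_init_def M_def)
    moreover have "tape_of [] 0 = 0" by (simp add: tape_of_def)
    ultimately show ?thesis
      using z by (simp add: tm_step_def M_def cfg_def mr[simplified] m0 nth_append r)
  qed
  show ?thesis
    unfolding polytime_def
  proof (intro exI[of _ M] exI[of _ "p + 1"] conjI allI wf)
    fix x
    obtain t i v where t: "t \<le> poly p (length x)" "(cstep x ^^ t) ([c], (0, \<lambda>_. 0, [])) = ([], (i, v, f x))"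
      using prog by blast
    have "(tm_step M ^^ Suc t) (tm_init M x) = cfg x ([], (i, v, f x))"
      unfolding funpow_Suc_right o_def init using steps t(2) by simp
    then have "tm_computes_in M x (f x) (Suc t)"
      by (simp add: tm_computes_in_def cfg_def cd_def)
    moreover have "Suc t \<le> poly (p + 1) (length x)" using t(1) by simp
    ultimately show "\<exists>t\<le>poly (p + 1) (length x). tm_computes_in M x (f x) t" by blast
  qed
qed

section \<open>Execution with time bounds\<close>

definition runs :: "bool list \<Rightarrow> com \<Rightarrow> state \<Rightarrow> nat \<Rightarrow> state \<Rightarrow> bool" where
  "runs x c s T s' \<longleftrightarrow> (\<exists>t\<le>T. \<forall>k. (cstep x ^^ t) (c # k, s) = (k, s'))"

lemma runs_mono: "runs x c s T s' \<Longrightarrow> T \<le> T' \<Longrightarrow> runs x c s T' s'"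
  unfolding runs_def by (meson le_trans)

lemma runs_single: "(\<And>k. cstep x (c # k, s) = (k, s')) \<Longrightarrow> 1 \<le> T \<Longrightarrow> runs x c s T s'"
  unfolding runs_def by (intro exI[of _ 1]) simp

lemma runs_Inc: "v' = v(r := Suc (v r)) \<Longrightarrow> 1 \<le> T \<Longrightarrow> runs x (Inc r) (p, v, y) T (p, v', y)"
  by (rule runs_single) auto

lemma runs_Dec: "v' = v(r := v r - 1) \<Longrightarrow> 1 \<le> T \<Longrightarrow> runs x (Dec r) (p, v, y) T (p, v', y)"
  by (rule runs_single) auto

lemma runs_Rt: "1 \<le> T \<Longrightarrow> runs x Rt (p, v, y) T (p + 1, v, y)"
  by (rule runs_single) auto

lemma runs_Emit: "1 \<le> T \<Longrightarrow> runs x (Emit b) (p, v, y) T (p, v, y @ [b])"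
  by (rule runs_single) auto

lemma runs_AddBit:
  "v' = (if tape_of x p = 2 then v(r := Suc (v r)) else v) \<Longrightarrow> 1 \<le> T \<Longrightarrow>
    runs x (AddBit r) (p, v, y) T (p, v', y)"
  by (rule runs_single) auto

text \<open>Composition works because \<open>runs\<close> quantifies over the rest \<open>k\<close>
  of the stack after fixing the number of steps: \<open>a\<close> runs on top of
  \<open>b # k\<close>, then \<open>b\<close> on top of \<open>k\<close>. The extra unit pays for
  unfolding \<open>Sq\<close>.\<close>

lemma runs_Sq:
  assumes "runs x a s T1 s1" "runs x b s1 T2 s2" "T1 + T2 + 1 \<le> T"
  shows "runs x (Sq a b) s T s2"
proof -
  obtain t1 where t1: "t1 \<le> T1" "\<And>k. (cstep x ^^ t1) (a # k, s) = (k, s1)"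
    using assms(1) by (auto simp: runs_def)
  obtain t2 where t2: "t2 \<le> T2" "\<And>k. (cstep x ^^ t2) (b # k, s1) = (k, s2)"
    using assms(2) by (auto simp: runs_def)
  have "(cstep x ^^ (t2 + (t1 + 1))) (Sq a b # k, s) = (k, s2)" for k
  proof -
    have "cstep x (Sq a b # k, s) = (a # b # k, s)" by (cases s) auto
    then show ?thesis by (simp only: funpow_add o_apply t1 t2 One_nat_def funpow.simps id_apply)
  qed
  then show ?thesis unfolding runs_def using t1(1) t2(1) assms(3)
    by (intro exI[of _ "t2 + (t1 + 1)"]) auto
qed

text \<open>Serves both kinds of loop: \<open>g\<close> is the loop command, \<open>s j\<close> the
  state before round \<open>j\<close>, and the test costs one step per round plus one at the end.
  The induction runs over the number of remaining rounds.\<close>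

lemma runs_loop:
  assumes step: "\<And>j k. j < n \<Longrightarrow> cstep x (g # k, s j) = (c # g # k, s j)"
    and body: "\<And>j. j < n \<Longrightarrow> runs x c (s j) Tb (s (Suc j))"
    and stop: "\<And>k. cstep x (g # k, s n) = (k, s n)"
    and T: "n * (Tb + 1) + 1 \<le> T"
  shows "runs x g (s 0) T (s n)"
proof -
  have "runs x g (s (n - i)) (i * (Tb + 1) + 1) (s n)" if "i \<le> n" for i
    using that
  proof (induction i)
    case 0
    show ?case by (rule runs_single) (use stop in auto)
  next
    case (Suc i)
    let ?j = "n - Suc i"
    have j: "?j < n" "Suc ?j = n - i" using Suc.prems by auto
    obtain t2 where t2: "t2 \<le> i * (Tb + 1) + 1" "\<And>k. (cstep x ^^ t2) (g # k, s (n - i)) = (k, s n)"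
      using Suc by (auto simp: runs_def)
    obtain t1 where t1: "t1 \<le> Tb" "\<And>k. (cstep x ^^ t1) (c # k, s ?j) = (k, s (n - i))"
      using body[OF j(1)] by (auto simp: runs_def j(2))
    have "(cstep x ^^ (t2 + (t1 + 1))) (g # k, s ?j) = (k, s n)" for k
      using step[OF j(1)] by (simp only: funpow_add o_apply t1 t2 One_nat_def funpow.simps id_apply)
    then show ?case unfolding runs_def using t1(1) t2(1)
      by (intro exI[of _ "t2 + (t1 + 1)"]) auto
  qed
  from this[of n] show ?thesis using T runs_mono by auto
qed

lemma runs_Whl:
  assumes "\<And>j. j < n \<Longrightarrow> v j r \<noteq> 0" "v n r = 0"
    and "\<And>j. j < n \<Longrightarrow> runs x c (p j, v j, y j) Tb (p (Suc j), v (Suc j), y (Suc j))"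
    and "n * (Tb + 1) + 1 \<le> T" "s0 = (p 0, v 0, y 0)" "sn = (p n, v n, y n)"
  shows "runs x (Whl r c) s0 T sn"
  unfolding assms(5,6)
  by (rule runs_loop[of n x _ "\<lambda>j. (p j, v j, y j)" c Tb]) (use assms in auto)

lemma runs_WhlIn:
  assumes "\<And>j. j < n \<Longrightarrow> tape_of x (p j) \<noteq> 0" "tape_of x (p n) = 0"
    and "\<And>j. j < n \<Longrightarrow> runs x c (p j, v j, y j) Tb (p (Suc j), v (Suc j), y (Suc j))"
    and "n * (Tb + 1) + 1 \<le> T" "s0 = (p 0, v 0, y 0)" "sn = (p n, v n, y n)"
  shows "runs x (WhlIn c) s0 T sn"
  unfolding assms(5,6)
  by (rule runs_loop[of n x _ "\<lambda>j. (p j, v j, y j)" c Tb]) (use assms in auto)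

lemma poly_mono_nat: "a \<le> b \<Longrightarrow> poly p a \<le> poly (p :: nat poly) b"
  by (induction p) (auto intro!: add_mono mult_mono)

section \<open>Functions computable in polynomial time\<close>

text \<open>\<open>D\<close> is the set of registers that hold the arguments. A program may use all registers from \<open>d\<close> on as scratch
  space, which is zero before and after; the result is added to a register outside \<open>D\<close>. Values and running
  times are polynomially bounded in the length of the input plus the largest argument.\<close>

definition depends_on :: "nat set \<Rightarrow> (bool list \<Rightarrow> (nat \<Rightarrow> nat) \<Rightarrow> 'a) \<Rightarrow> bool" where
  "depends_on D F \<longleftrightarrow> (\<forall>x v v'. (\<forall>i\<in>D. v i = v' i) \<longrightarrow> F x v = F x v')"

definition poly_bounded :: "nat set \<Rightarrow> (bool list \<Rightarrow> (nat \<Rightarrow> nat) \<Rightarrow> nat) \<Rightarrow> nat poly \<Rightarrow> bool" where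
  "poly_bounded D F p \<longleftrightarrow> (\<forall>x v B. (\<forall>i\<in>D. v i \<le> B) \<longrightarrow> F x v \<le> poly p (length x + B))"

definition adds :: "nat set \<Rightarrow> (bool list \<Rightarrow> (nat \<Rightarrow> nat) \<Rightarrow> nat) \<Rightarrow> nat \<Rightarrow> nat \<Rightarrow> com \<Rightarrow> nat poly \<Rightarrow> bool" where
  "adds D F d r c p \<longleftrightarrow> (\<forall>x v y B. (\<forall>i\<ge>d. v i = 0) \<longrightarrow> (\<forall>i\<in>D. v i \<le> B) \<longrightarrow>
     runs x c (0, v, y) (poly p (length x + B)) (0, v(r := v r + F x v), y))"

text \<open>The scratch boundary \<open>d\<close> and the target \<open>r\<close> are arbitrary
  because an enclosing program decides which registers are free. The bound on the values belongs to
  the notion since values serve as numbers of loop rounds, and \<open>depends_on\<close> allows the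
  other registers to change between evaluations.\<close>

definition numf :: "nat set \<Rightarrow> (bool list \<Rightarrow> (nat \<Rightarrow> nat) \<Rightarrow> nat) \<Rightarrow> bool" where
  "numf D F \<longleftrightarrow> depends_on D F \<and> (\<exists>p. poly_bounded D F p) \<and>
     (\<forall>d r. D \<subseteq> {..<d} \<longrightarrow> r < d \<longrightarrow> r \<notin> D \<longrightarrow> (\<exists>c p. adds D F d r c p))"

definition emits :: "nat set \<Rightarrow> (bool list \<Rightarrow> (nat \<Rightarrow> nat) \<Rightarrow> bool list) \<Rightarrow> nat \<Rightarrow> com \<Rightarrow> nat poly \<Rightarrow> bool" where
  "emits D W d c p \<longleftrightarrow> (\<forall>x v y B. (\<forall>i\<ge>d. v i = 0) \<longrightarrow> (\<forall>i\<in>D. v i \<le> B) \<longrightarrow>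
     runs x c (0, v, y) (poly p (length x + B)) (0, v, y @ W x v))"

definition wordf :: "nat set \<Rightarrow> (bool list \<Rightarrow> (nat \<Rightarrow> nat) \<Rightarrow> bool list) \<Rightarrow> bool" where
  "wordf D W \<longleftrightarrow> depends_on D W \<and> (\<forall>d. D \<subseteq> {..<d} \<longrightarrow> (\<exists>c p. emits D W d c p))"

lemma numf_depends: "numf D F \<Longrightarrow> (\<And>i. i \<in> D \<Longrightarrow> v i = v' i) \<Longrightarrow> F x v = F x v'"
  unfolding numf_def depends_on_def by blast

lemma numf_adds: "numf D F \<Longrightarrow> D \<subseteq> {..<d} \<Longrightarrow> r < d \<Longrightarrow> r \<notin> D \<Longrightarrow> \<exists>c p. adds D F d r c p"
  unfolding numf_def by blast

lemma numf_weaken: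
  assumes "numf D F" "D \<subseteq> D'"
  shows "numf D' F"
proof -
  have "adds D F d r c p \<Longrightarrow> adds D' F d r c p" for d r c p
    using assms(2) unfolding adds_def by blast
  moreover have "poly_bounded D F p \<Longrightarrow> poly_bounded D' F p" for p
    using assms(2) unfolding poly_bounded_def by blast
  moreover have "depends_on D' F"
    using assms unfolding depends_on_def numf_def by blast
  ultimately show ?thesis using assms unfolding numf_def by (meson dual_order.trans subsetD)
qed

lemma numf_const: "numf D (\<lambda>x v. a)"
proof -
  have "\<exists>c p. adds D (\<lambda>x v. a) d r c p" if "r < d" for d r
  proof (induction a)
    case 0
    have "adds D (\<lambda>x v. 0) d r (Dec d) [:1:]"
      unfolding adds_def by (auto intro!: runs_Dec)
    then show ?case by blast
  next
    case (Suc a)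
    then obtain c p where c: "adds D (\<lambda>x v. a) d r c p" by blast
    have "adds D (\<lambda>x v. Suc a) d r (Sq c (Inc r)) (p + [:2:])"
      unfolding adds_def
    proof (intro allI impI)
      fix x :: "bool list" and v :: "nat \<Rightarrow> nat" and y B assume "\<forall>i\<ge>d. v i = 0" "\<forall>i\<in>D. v i \<le> B"
      with c have "runs x c (0, v, y) (poly p (length x + B)) (0, v(r := v r + a), y)"
        by (auto simp: adds_def)
      then show "runs x (Sq c (Inc r)) (0, v, y) (poly (p + [:2:]) (length x + B)) (0, v(r := v r + Suc a), y)"
        by (rule runs_Sq[OF _ runs_Inc]) auto
    qed
    then show ?case by blast
  qed
  moreover have "poly_bounded D (\<lambda>x v. a) [:a:]" by (simp add: poly_bounded_def)
  ultimately show ?thesis unfolding numf_def depends_on_def by blast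
qed

text \<open>A register can only be read by counting it down. The first loop moves it into scratch
  register \<open>d\<close> while adding to \<open>r\<close>, the second one moves it back; with 6
  and 4 steps per unit this gives \<open>10 * v i + 3\<close>.\<close>

lemma numf_var:
  assumes "i \<in> D"
  shows "numf D (\<lambda>x v. v i)"
proof -
  have "poly_bounded D (\<lambda>x v. v i) [:0, 1:]"
    using assms by (auto simp: poly_bounded_def intro: trans_le_add2)
  moreover have "\<exists>c p. adds D (\<lambda>x v. v i) d r c p" if D: "D \<subseteq> {..<d}" and r: "r < d" "r \<notin> D" for d r
  proof -
    have i: "i < d" "i \<noteq> r" "i \<noteq> d" "r \<noteq> d" using D r assms by auto
    let ?c1 = "Whl i (Sq (Dec i) (Sq (Inc d) (Inc r)))"
    let ?c2 = "Whl d (Sq (Dec d) (Inc i))"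
    have "adds D (\<lambda>x v. v i) d r (Sq ?c1 ?c2) [:3, 10:]"
      unfolding adds_def
    proof (intro allI impI)
      fix x :: "bool list" and v :: "nat \<Rightarrow> nat" and y B assume v: "\<forall>i\<ge>d. v i = 0" "\<forall>i\<in>D. v i \<le> B"
      let ?v1 = "\<lambda>j. v(i := v i - j, d := j, r := v r + j)"
      let ?v2 = "\<lambda>j. v(i := j, d := v i - j, r := v r + v i)"
      have "runs x ?c1 (0, v, y) (v i * 6 + 1) (0, ?v1 (v i), y)"
        by (rule runs_Whl[where n = "v i" and p = "\<lambda>_. 0" and v = ?v1 and y = "\<lambda>_. y" and Tb = 5])
          (use i v in \<open>auto intro!: runs_Sq[OF runs_Dec[OF refl order_refl] runs_Sq[OF runs_Inc[OF refl order_refl] runs_Inc]]\<close>)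
      moreover have "runs x ?c2 (0, ?v1 (v i), y) (v i * 4 + 1) (0, ?v2 (v i), y)"
        by (rule runs_Whl[where n = "v i" and p = "\<lambda>_. 0" and v = ?v2 and y = "\<lambda>_. y" and Tb = 3])
          (use i v in \<open>auto intro!: runs_Sq[OF runs_Dec[OF refl order_refl] runs_Inc]\<close>)
      moreover have "?v2 (v i) = v(r := v r + v i)" using v i by auto
      moreover have "v i \<le> B" using v assms by blast
      ultimately show "runs x (Sq ?c1 ?c2) (0, v, y) (poly [:3, 10:] (length x + B)) (0, v(r := v r + v i), y)"
        by (auto elim!: runs_Sq)
    qed
    then show ?thesis by blast
  qed
  ultimately show ?thesis using assms unfolding numf_def depends_on_def by blast
qed

lemma numf_add:
  assumes F: "numf D F" and G: "numf D G"
  shows "numf D (\<lambda>x v. F x v + G x v)"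
proof -
  obtain p q where "poly_bounded D F p" "poly_bounded D G q" using F G by (auto simp: numf_def)
  then have "poly_bounded D (\<lambda>x v. F x v + G x v) (p + q)"
    by (auto simp: poly_bounded_def intro!: add_mono)
  moreover have "\<exists>c p. adds D (\<lambda>x v. F x v + G x v) d r c p" if D: "D \<subseteq> {..<d}" and r: "r < d" "r \<notin> D" for d r
  proof -
    obtain c p where c: "adds D F d r c p" using numf_adds[OF F D r] by blast
    obtain c' p' where c': "adds D G d r c' p'" using numf_adds[OF G D r] by blast
    have "adds D (\<lambda>x v. F x v + G x v) d r (Sq c c') (p + p' + [:1:])"
      unfolding adds_def
    proof (intro allI impI)
      fix x :: "bool list" and v :: "nat \<Rightarrow> nat" and y B assume v: "\<forall>i\<ge>d. v i = 0" "\<forall>i\<in>D. v i \<le> B"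
      let ?v = "v(r := v r + F x v)"
      have "runs x c (0, v, y) (poly p (length x + B)) (0, ?v, y)"
        using v c by (auto simp: adds_def)
      moreover have "runs x c' (0, ?v, y) (poly p' (length x + B)) (0, ?v(r := ?v r + G x ?v), y)"
        using v r by (intro c'[unfolded adds_def, rule_format]) auto
      moreover have "G x ?v = G x v" using r by (intro numf_depends[OF G]) auto
      ultimately show "runs x (Sq c c') (0, v, y) (poly (p + p' + [:1:]) (length x + B))
          (0, v(r := v r + (F x v + G x v)), y)"
        by (auto elim!: runs_Sq simp: add.assoc)
    qed
    then show ?thesis by blast
  qed
  moreover have "depends_on D (\<lambda>x v. F x v + G x v)"
    unfolding depends_on_def using numf_depends[OF F] numf_depends[OF G] by (metis (no_types, lifting))
  ultimately show ?thesis unfolding numf_def by blast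
qed

text \<open>Repeated addition: \<open>F\<close> is computed into \<open>d\<close>, and the program
  for \<open>G\<close>, whose scratch space starts one register higher, is run once for every unit
  of \<open>d\<close>.\<close>

lemma numf_mult:
  assumes F: "numf D F" and G: "numf D G"
  shows "numf D (\<lambda>x v. F x v * G x v)"
proof -
  obtain p q where p: "poly_bounded D F p" and q: "poly_bounded D G q" using F G by (auto simp: numf_def)
  then have "poly_bounded D (\<lambda>x v. F x v * G x v) (p * q)"
    by (auto simp: poly_bounded_def intro!: mult_mono)
  moreover have "\<exists>c p. adds D (\<lambda>x v. F x v * G x v) d r c p" if D: "D \<subseteq> {..<d}" and r: "r < d" "r \<notin> D" for d r
  proof -
    have D': "D \<subseteq> {..<Suc d}" "d \<notin> D" using D by auto
    obtain c1 p1 where c1: "adds D F (Suc d) d c1 p1"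
      using F D' unfolding numf_def by (meson lessI)
    obtain c2 p2 where c2: "adds D G (Suc d) r c2 p2"
      using G D' r unfolding numf_def by (meson less_SucI)
    let ?w = "Whl d (Sq (Dec d) c2)"
    let ?p = "p1 + p * (p2 + [:3:]) + [:2:]"
    have "adds D (\<lambda>x v. F x v * G x v) d r (Sq c1 ?w) ?p"
      unfolding adds_def
    proof (intro allI impI)
      fix x :: "bool list" and v :: "nat \<Rightarrow> nat" and y B assume v: "\<forall>i\<ge>d. v i = 0" "\<forall>i\<in>D. v i \<le> B"
      let ?n = "length x + B"
      let ?v = "\<lambda>j. v(d := F x v - j, r := v r + j * G x v)"
      have "runs x c1 (0, v, y) (poly p1 ?n) (0, v(d := v d + F x v), y)"
        using v by (intro c1[unfolded adds_def, rule_format]) auto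
      then have a: "runs x c1 (0, v, y) (poly p1 ?n) (0, ?v 0, y)"
        using v r fun_upd_triv[of "v(d := F x v)" r] by simp
      have b: "runs x ?w (0, ?v 0, y) (F x v * (poly p2 ?n + 2 + 1) + 1) (0, ?v (F x v), y)"
      proof (rule runs_Whl[where n = "F x v" and p = "\<lambda>_. 0" and v = ?v and y = "\<lambda>_. y" and Tb = "poly p2 ?n + 2"])
        fix j assume j: "j < F x v"
        let ?u = "v(d := F x v - Suc j, r := v r + j * G x v)"
        have "runs x (Dec d) (0, ?v j, y) 1 (0, ?u, y)"
          by (rule runs_Dec) (use r in auto)
        moreover have "runs x c2 (0, ?u, y) (poly p2 ?n) (0, ?u(r := ?u r + G x ?u), y)"
          using v r D' by (intro c2[unfolded adds_def, rule_format]) auto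
        moreover have "G x ?u = G x v" using r D' by (intro numf_depends[OF G]) auto
        moreover have "?u(r := ?u r + G x v) = ?v (Suc j)" using r by auto
        ultimately show "runs x (Sq (Dec d) c2) (0, ?v j, y) (poly p2 ?n + 2) (0, ?v (Suc j), y)"
          by (auto elim!: runs_Sq)
      qed (use r in auto)
      have "F x v \<le> poly p ?n" using p v by (auto simp: poly_bounded_def)
      then have le: "F x v * (poly p2 ?n + 2 + 1) \<le> poly p ?n * (poly p2 ?n + 3)" by (intro mult_mono) auto
      have "?v (F x v) = v(r := v r + F x v * G x v)" using v by auto
      with a b le show "runs x (Sq c1 ?w) (0, v, y) (poly ?p ?n) (0, v(r := v r + F x v * G x v), y)"
        by (auto elim!: runs_Sq)
    qed
    then show ?thesis by blast
  qed
  moreover have "depends_on D (\<lambda>x v. F x v * G x v)"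
    unfolding depends_on_def using numf_depends[OF F] numf_depends[OF G] by (metis (no_types, lifting))
  ultimately show ?thesis unfolding numf_def by blast
qed

lemma numf_minus:
  assumes F: "numf D F" and G: "numf D G"
  shows "numf D (\<lambda>x v. F x v - G x v)"
proof -
  obtain p q where p: "poly_bounded D F p" and q: "poly_bounded D G q" using F G by (auto simp: numf_def)
  then have "poly_bounded D (\<lambda>x v. F x v - G x v) p"
    by (auto simp: poly_bounded_def intro: order_trans[OF diff_le_self])
  moreover have "\<exists>c p. adds D (\<lambda>x v. F x v - G x v) d r c p" if D: "D \<subseteq> {..<d}" and r: "r < d" "r \<notin> D" for d r
  proof -
    have D': "D \<subseteq> {..<Suc (Suc d)}" "d \<notin> D" "Suc d \<notin> D" using D by auto
    obtain c1 p1 where c1: "adds D F (Suc (Suc d)) d c1 p1"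
      using F D' unfolding numf_def by (meson lessI less_SucI)
    obtain c2 p2 where c2: "adds D G (Suc (Suc d)) (Suc d) c2 p2"
      using G D' r unfolding numf_def by (meson lessI)
    let ?w1 = "Whl (Suc d) (Sq (Dec (Suc d)) (Dec d))"
    let ?w2 = "Whl d (Sq (Dec d) (Inc r))"
    let ?p = "p1 + p2 + q * [:4:] + p * [:4:] + [:5:]"
    have "adds D (\<lambda>x v. F x v - G x v) d r (Sq c1 (Sq c2 (Sq ?w1 ?w2))) ?p"
      unfolding adds_def
    proof (intro allI impI)
      fix x :: "bool list" and v :: "nat \<Rightarrow> nat" and y B assume v: "\<forall>i\<ge>d. v i = 0" "\<forall>i\<in>D. v i \<le> B"
      let ?n = "length x + B"
      let ?u = "v(d := F x v)"
      let ?v = "\<lambda>j. v(d := F x v - j, Suc d := G x v - j)"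
      let ?v' = "\<lambda>j. v(d := F x v - G x v - j, r := v r + j)"
      have "runs x c1 (0, v, y) (poly p1 ?n) (0, v(d := v d + F x v), y)"
        using v by (intro c1[unfolded adds_def, rule_format]) auto
      then have a: "runs x c1 (0, v, y) (poly p1 ?n) (0, ?u, y)" using v by simp
      have "runs x c2 (0, ?u, y) (poly p2 ?n) (0, ?u(Suc d := ?u (Suc d) + G x ?u), y)"
        using v r D' by (intro c2[unfolded adds_def, rule_format]) auto
      moreover have "G x ?u = G x v" using r D' by (intro numf_depends[OF G]) auto
      ultimately have b: "runs x c2 (0, ?u, y) (poly p2 ?n) (0, ?v 0, y)" using v by simp
      have c: "runs x ?w1 (0, ?v 0, y) (G x v * 4 + 1) (0, ?v (G x v), y)"
        by (rule runs_Whl[where n = "G x v" and p = "\<lambda>_. 0" and v = ?v and y = "\<lambda>_. y" and Tb = 3])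
          (auto intro!: runs_Sq[OF runs_Dec[OF refl order_refl] runs_Dec])
      have e: "?v (G x v) = ?v' 0" using v r by auto
      have d: "runs x ?w2 (0, ?v' 0, y) ((F x v - G x v) * 4 + 1) (0, ?v' (F x v - G x v), y)"
        by (rule runs_Whl[where n = "F x v - G x v" and p = "\<lambda>_. 0" and v = ?v' and y = "\<lambda>_. y" and Tb = 3])
          (use r in \<open>auto intro!: runs_Sq[OF runs_Dec[OF refl order_refl] runs_Inc]\<close>)
      have "F x v \<le> poly p ?n" "G x v \<le> poly q ?n" using p q v by (auto simp: poly_bounded_def)
      then have le: "poly p1 ?n + (poly p2 ?n + ((G x v * 4 + 1) + ((F x v - G x v) * 4 + 1) + 1) + 1) + 1 \<le> poly ?p ?n"
        by simp
      have f: "?v' (F x v - G x v) = v(r := v r + (F x v - G x v))" using v by auto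
      show "runs x (Sq c1 (Sq c2 (Sq ?w1 ?w2))) (0, v, y) (poly ?p ?n) (0, v(r := v r + (F x v - G x v)), y)"
        unfolding f[symmetric]
        by (rule runs_Sq[OF a runs_Sq[OF b runs_Sq[OF c[unfolded e] d order_refl] order_refl] le])
    qed
    then show ?thesis by blast
  qed
  moreover have "depends_on D (\<lambda>x v. F x v - G x v)"
    unfolding depends_on_def using numf_depends[OF F] numf_depends[OF G] by (metis (no_types, lifting))
  ultimately show ?thesis unfolding numf_def by blast
qed


text \<open>The summation index is kept in \<open>d\<close>, a register that becomes an argument of
  \<open>G\<close>. Its value is bounded only by that of \<open>F\<close>, so bounds for
  \<open>G\<close> are evaluated at the argument bound \<open>B + poly p (length x + B)\<close>;
  this is the composition with \<open>p + [:0, 1:]\<close>. By \<open>dep\<close> the summands do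
  not notice the changing registers.\<close>

lemma numf_sum:
  assumes F: "numf D F" and G: "\<And>e. e \<notin> D \<Longrightarrow> numf (insert e D) (\<lambda>x v. G x v (v e))"
    and dep: "\<And>x v v' j. (\<And>i. i \<in> D \<Longrightarrow> v i = v' i) \<Longrightarrow> G x v j = G x v' j"
    and fin: "finite D"
  shows "numf D (\<lambda>x v. \<Sum>j<F x v. G x v j)"
proof -
  obtain p where p: "poly_bounded D F p" using F by (auto simp: numf_def)
  have gb: "\<exists>q. \<forall>x (v :: nat \<Rightarrow> nat) B j. (\<forall>i\<in>D. v i \<le> B) \<longrightarrow> j < F x v \<longrightarrow> G x v j \<le> poly q (length x + B)"
  proof -
    obtain e where e: "e \<notin> D" using fin by (metis ex_new_if_finite infinite_UNIV_nat)
    obtain q where q: "poly_bounded (insert e D) (\<lambda>x v. G x v (v e)) q"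
      using G[OF e] by (auto simp: numf_def)
    have "G x v j \<le> poly (pcompose q (p + [:0, 1:])) (length x + B)"
      if "\<forall>i\<in>D. v i \<le> B" "j < F x v" for x and v :: "nat \<Rightarrow> nat" and B j
    proof -
      have "F x v \<le> poly p (length x + B)" using p that by (auto simp: poly_bounded_def)
      then have "G x (v(e := j)) ((v(e := j)) e) \<le> poly q (length x + (B + poly p (length x + B)))"
        using that e by (intro q[unfolded poly_bounded_def, rule_format]) (auto intro: trans_le_add1)
      moreover have "G x (v(e := j)) j = G x v j" using e by (intro dep) auto
      ultimately show ?thesis by (simp add: poly_pcompose algebra_simps)
    qed
    then show ?thesis by blast
  qed
  then obtain q where q: "\<And>x (v :: nat \<Rightarrow> nat) B j. (\<forall>i\<in>D. v i \<le> B) \<Longrightarrow> j < F x v \<Longrightarrow> G x v j \<le> poly q (length x + B)"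
    by blast
  have "poly_bounded D (\<lambda>x v. \<Sum>j<F x v. G x v j) (p * q)"
    unfolding poly_bounded_def
  proof (intro allI impI)
    fix x and v :: "nat \<Rightarrow> nat" and B assume v: "\<forall>i\<in>D. v i \<le> B"
    have "(\<Sum>j<F x v. G x v j) \<le> (\<Sum>j<F x v. poly q (length x + B))"
      using q v by (intro sum_mono) auto
    also have "\<dots> = F x v * poly q (length x + B)" by simp
    also have "\<dots> \<le> poly p (length x + B) * poly q (length x + B)"
      using p v by (intro mult_mono) (auto simp: poly_bounded_def)
    finally show "(\<Sum>j<F x v. G x v j) \<le> poly (p * q) (length x + B)" by simp
  qed
  moreover have "\<exists>c p. adds D (\<lambda>x v. \<Sum>j<F x v. G x v j) d r c p"
    if D: "D \<subseteq> {..<d}" and r: "r < d" "r \<notin> D" for d r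
  proof -
    have D': "D \<subseteq> {..<Suc (Suc d)}" "d \<notin> D" "Suc d \<notin> D" using D by auto
    obtain c1 p1 where c1: "adds D F (Suc (Suc d)) (Suc d) c1 p1"
      using F D' unfolding numf_def by (meson lessI)
    have "insert d D \<subseteq> {..<Suc (Suc d)}" "r < Suc (Suc d)" "r \<notin> insert d D" using D' r by auto
    then obtain c2 p2 where c2: "adds (insert d D) (\<lambda>x v. G x v (v d)) (Suc (Suc d)) r c2 p2"
      using G[OF D'(2)] unfolding numf_def by meson
    let ?p2 = "pcompose p2 (p + [:0, 1:])"
    let ?w1 = "Whl (Suc d) (Sq (Dec (Suc d)) (Sq c2 (Inc d)))"
    let ?w2 = "Whl d (Dec d)"
    let ?p = "p1 + p * (?p2 + [:5:]) + p * [:2:] + [:4:]"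
    have "adds D (\<lambda>x v. \<Sum>j<F x v. G x v j) d r (Sq c1 (Sq ?w1 ?w2)) ?p"
      unfolding adds_def
    proof (intro allI impI)
      fix x :: "bool list" and v :: "nat \<Rightarrow> nat" and y B assume v: "\<forall>i\<ge>d. v i = 0" "\<forall>i\<in>D. v i \<le> B"
      let ?n = "length x + B"
      have Fp: "F x v \<le> poly p ?n" using p v by (auto simp: poly_bounded_def)
      let ?v = "\<lambda>j. v(d := j, Suc d := F x v - j, r := v r + (\<Sum>i<j. G x v i))"
      let ?s = "v r + (\<Sum>j<F x v. G x v j)"
      let ?v' = "\<lambda>j. v(d := F x v - j, r := ?s)"
      have "?v 0 = v(Suc d := v (Suc d) + F x v)" using v r by (intro ext) auto
      moreover have "runs x c1 (0, v, y) (poly p1 ?n) (0, v(Suc d := v (Suc d) + F x v), y)"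
        using v by (intro c1[unfolded adds_def, rule_format]) auto
      ultimately have a: "runs x c1 (0, v, y) (poly p1 ?n) (0, ?v 0, y)" by simp
      have b: "runs x ?w1 (0, ?v 0, y) (F x v * (poly ?p2 ?n + 4 + 1) + 1) (0, ?v (F x v), y)"
      proof (rule runs_Whl[where n = "F x v" and p = "\<lambda>_. 0" and v = ?v and y = "\<lambda>_. y" and Tb = "poly ?p2 ?n + 4"])
        fix j assume j: "j < F x v"
        let ?u = "v(d := j, Suc d := F x v - Suc j, r := v r + (\<Sum>i<j. G x v i))"
        have 1: "runs x (Dec (Suc d)) (0, ?v j, y) 1 (0, ?u, y)"
          by (rule runs_Dec) (use r in auto)
        have "runs x c2 (0, ?u, y) (poly p2 (length x + (B + poly p ?n))) (0, ?u(r := ?u r + G x ?u (?u d)), y)"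
          using v r D' j Fp by (intro c2[unfolded adds_def, rule_format]) (auto intro: trans_le_add1)
        moreover have "G x ?u j = G x v j" using r D' by (intro dep) auto
        moreover have "?u d = j" using r by simp
        ultimately have 2: "runs x c2 (0, ?u, y) (poly ?p2 ?n) (0, ?u(r := ?u r + G x v j), y)"
          by (simp add: poly_pcompose algebra_simps)
        have 3: "runs x (Inc d) (0, ?u(r := ?u r + G x v j), y) 1 (0, ?v (Suc j), y)"
          by (rule runs_Inc) (use r in \<open>auto intro!: ext\<close>)
        show "runs x (Sq (Dec (Suc d)) (Sq c2 (Inc d))) (0, ?v j, y) (poly ?p2 ?n + 4) (0, ?v (Suc j), y)"
          by (rule runs_Sq[OF 1 runs_Sq[OF 2 3 order_refl]]) simp
      qed (use r in auto)
      have e: "?v (F x v) = ?v' 0" using v r by auto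
      have c: "runs x ?w2 (0, ?v' 0, y) (F x v * 2 + 1) (0, ?v' (F x v), y)"
        by (rule runs_Whl[where n = "F x v" and p = "\<lambda>_. 0" and v = ?v' and y = "\<lambda>_. y" and Tb = 1])
          (use r in \<open>auto intro!: runs_Dec\<close>)
      have "F x v * (poly ?p2 ?n + 4 + 1) \<le> poly p ?n * (poly ?p2 ?n + 5)" using Fp by (intro mult_mono) auto
      then have le: "poly p1 ?n + ((F x v * (poly ?p2 ?n + 4 + 1) + 1) + (F x v * 2 + 1) + 1) + 1 \<le> poly ?p ?n"
        using Fp by simp
      have f: "?v' (F x v) = v(r := ?s)" using v by auto
      show "runs x (Sq c1 (Sq ?w1 ?w2)) (0, v, y) (poly ?p ?n) (0, v(r := ?s), y)"
        unfolding f[symmetric]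
        by (rule runs_Sq[OF a runs_Sq[OF b[unfolded e] c order_refl] le])
    qed
    then show ?thesis by blast
  qed
  moreover have "depends_on D (\<lambda>x v. \<Sum>j<F x v. G x v j)"
    unfolding depends_on_def
  proof (intro allI impI)
    fix x and v v' :: "nat \<Rightarrow> nat" assume e: "\<forall>i\<in>D. v i = v' i"
    then have "F x v = F x v'" by (intro numf_depends[OF F]) auto
    moreover have "G x v j = G x v' j" for j using e by (intro dep) auto
    ultimately show "(\<Sum>j<F x v. G x v j) = (\<Sum>j<F x v'. G x v' j)" by simp
  qed
  ultimately show ?thesis unfolding numf_def by blast
qed

lemma numf_length: "numf D (\<lambda>x v. length x)"
proof -
  have "poly_bounded D (\<lambda>x v. length x) [:0, 1:]" by (auto simp: poly_bounded_def)
  moreover have "\<exists>c p. adds D (\<lambda>x v. length x) d r c p" if D: "D \<subseteq> {..<d}" and r: "r < d" "r \<notin> D" for d r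
  proof -
    let ?w1 = "WhlIn (Sq Rt (Sq (Inc d) (Inc r)))"
    let ?w2 = "Whl d (Sq (Dec d) Lt)"
    have "adds D (\<lambda>x v. length x) d r (Sq ?w1 ?w2) [:3, 10:]"
      unfolding adds_def
    proof (intro allI impI)
      fix x :: "bool list" and v :: "nat \<Rightarrow> nat" and y B assume v: "\<forall>i\<ge>d. v i = 0" "\<forall>i\<in>D. v i \<le> B"
      let ?v1 = "\<lambda>j. v(d := j, r := v r + j)"
      let ?v2 = "\<lambda>j. v(d := length x - j, r := v r + length x)"
      have v0: "v(d := 0) = v" using v by auto
      have b: "runs x (Sq Rt (Sq (Inc d) (Inc r))) (int j, ?v1 j, y) 5 (int (Suc j), ?v1 (Suc j), y)" for j
        by (rule runs_Sq[OF runs_Rt[OF order_refl] runs_Sq[OF runs_Inc[OF refl order_refl] runs_single[OF _ order_refl] order_refl]])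
          (use r in auto)
      have "runs x ?w1 (0, v, y) (length x * 6 + 1) (int (length x), ?v1 (length x), y)"
        by (rule runs_WhlIn[where n = "length x" and p = "\<lambda>j. int j" and v = ?v1 and y = "\<lambda>_. y" and Tb = 5, OF _ _ b])
          (use r v v0 in \<open>auto simp: tape_of_def\<close>)
      moreover have d': "runs x (Sq (Dec d) Lt) (int (length x) - int j, ?v2 j, y) 3 (int (length x) - int (Suc j), ?v2 (Suc j), y)" for j
        by (rule runs_Sq[OF runs_Dec[OF refl order_refl] runs_single[OF _ order_refl]])
          (use r in \<open>simp_all add: fun_upd_twist[of r]\<close>)
      moreover have "runs x ?w2 (int (length x), ?v1 (length x), y) (length x * 4 + 1) (0, ?v2 (length x), y)"
        by (rule runs_Whl[where n = "length x" and p = "\<lambda>j. int (length x) - int j" and v = ?v2 and y = "\<lambda>_. y" and Tb = 3, OF _ _ d'])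
          (use r in auto)
      moreover have "?v2 (length x) = v(r := v r + length x)" using v by auto
      ultimately show "runs x (Sq ?w1 ?w2) (0, v, y) (poly [:3, 10:] (length x + B)) (0, v(r := v r + length x), y)"
        by (auto elim!: runs_Sq)
    qed
    then show ?thesis by blast
  qed
  ultimately show ?thesis unfolding numf_def depends_on_def by blast
qed

text \<open>The head walks \<open>F x v\<close> cells to the right and back. Beyond the end of the
  input it reads a blank and \<open>AddBit\<close> adds nothing, which is the conjunct
  \<open>F x v < length x\<close>.\<close>

lemma numf_bit:
  assumes F: "numf D F"
  shows "numf D (\<lambda>x v. of_bool (F x v < length x \<and> x ! F x v))"
proof -
  obtain p where p: "poly_bounded D F p" using F by (auto simp: numf_def)
  let ?G = "\<lambda>x v. of_bool (F x v < length x \<and> x ! F x v)"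
  have "poly_bounded D ?G [:1:]" by (auto simp: poly_bounded_def)
  moreover have "\<exists>c p. adds D ?G d r c p" if D: "D \<subseteq> {..<d}" and r: "r < d" "r \<notin> D" for d r
  proof -
    have D': "D \<subseteq> {..<Suc (Suc d)}" "d \<notin> D" using D by auto
    obtain c1 p1 where c1: "adds D F (Suc (Suc d)) d c1 p1"
      using F D' unfolding numf_def by (meson lessI less_SucI)
    let ?w1 = "Whl d (Sq (Dec d) (Sq (Inc (Suc d)) Rt))"
    let ?w2 = "Whl (Suc d) (Sq (Dec (Suc d)) Lt)"
    let ?p = "p1 + p * [:10:] + [:6:]"
    have "adds D ?G d r (Sq c1 (Sq ?w1 (Sq (AddBit r) ?w2))) ?p"
      unfolding adds_def
    proof (intro allI impI)
      fix x :: "bool list" and v :: "nat \<Rightarrow> nat" and y B assume v: "\<forall>i\<ge>d. v i = 0" "\<forall>i\<in>D. v i \<le> B"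
      let ?n = "length x + B"
      have Fp: "F x v \<le> poly p ?n" using p v by (auto simp: poly_bounded_def)
      let ?v1 = "\<lambda>j. v(d := F x v - j, Suc d := j)"
      let ?v2 = "\<lambda>j. v(Suc d := F x v - j, r := v r + ?G x v)"
      have "?v1 0 = v(d := v d + F x v)" using v by (intro ext) auto
      moreover have "runs x c1 (0, v, y) (poly p1 ?n) (0, v(d := v d + F x v), y)"
        using v by (intro c1[unfolded adds_def, rule_format]) auto
      ultimately have a: "runs x c1 (0, v, y) (poly p1 ?n) (0, ?v1 0, y)" by simp
      have b: "runs x ?w1 (0, ?v1 0, y) (F x v * 6 + 1) (int (F x v), ?v1 (F x v), y)"
        by (rule runs_Whl[where n = "F x v" and p = "\<lambda>j. int j" and v = ?v1 and y = "\<lambda>_. y" and Tb = 5])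
          (auto intro!: runs_Sq[OF runs_Dec[OF refl order_refl] runs_Sq[OF runs_Inc[OF refl order_refl] runs_single]] ext)
      have c: "runs x (AddBit r) (int (F x v), ?v1 (F x v), y) 1 (int (F x v), ?v2 0, y)"
        by (rule runs_AddBit) (use r v in \<open>auto simp: tape_of_def intro!: ext\<close>)
      have d': "runs x (Sq (Dec (Suc d)) Lt) (int (F x v) - int j, ?v2 j, y) 3 (int (F x v) - int (Suc j), ?v2 (Suc j), y)" for j
        by (rule runs_Sq[OF runs_Dec[OF refl order_refl] runs_single[OF _ order_refl]])
          (use r in \<open>simp_all add: fun_upd_twist[of r]\<close>)
      have d: "runs x ?w2 (int (F x v), ?v2 0, y) (F x v * 4 + 1) (0, ?v2 (F x v), y)"
        by (rule runs_Whl[where n = "F x v" and p = "\<lambda>j. int (F x v) - int j" and v = ?v2 and y = "\<lambda>_. y" and Tb = 3, OF _ _ d'])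
          (use r in auto)
      have le: "poly p1 ?n + ((F x v * 6 + 1) + (1 + (F x v * 4 + 1) + 1) + 1) + 1 \<le> poly ?p ?n"
        using Fp by simp
      have f: "?v2 (F x v) = v(r := v r + ?G x v)" using v by auto
      show "runs x (Sq c1 (Sq ?w1 (Sq (AddBit r) ?w2))) (0, v, y) (poly ?p ?n) (0, v(r := v r + ?G x v), y)"
        unfolding f[symmetric]
        by (rule runs_Sq[OF a runs_Sq[OF b runs_Sq[OF c d order_refl] order_refl] le])
    qed
    then show ?thesis by blast
  qed
  moreover have "depends_on D ?G"
    unfolding depends_on_def using numf_depends[OF F] by (metis (no_types, lifting))
  ultimately show ?thesis unfolding numf_def by blast
qed

lemma wordf_const: "wordf D (\<lambda>x v. w)"
proof -
  have "\<exists>c p. emits D (\<lambda>x v. w) d c p" for d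
  proof (induction w rule: rev_induct)
    case Nil
    have "emits D (\<lambda>x v. []) d (Dec d) [:1:]"
      unfolding emits_def by (auto intro!: runs_Dec)
    then show ?case by blast
  next
    case (snoc b w)
    then obtain c p where c: "emits D (\<lambda>x v. w) d c p" by blast
    have "emits D (\<lambda>x v. w @ [b]) d (Sq c (Emit b)) (p + [:2:])"
      unfolding emits_def
    proof (intro allI impI)
      fix x :: "bool list" and v :: "nat \<Rightarrow> nat" and y B assume "\<forall>i\<ge>d. v i = 0" "\<forall>i\<in>D. v i \<le> B"
      with c have "runs x c (0, v, y) (poly p (length x + B)) (0, v, y @ w)"
        by (auto simp: emits_def)
      from runs_Sq[OF this runs_Emit[OF order_refl]]
      show "runs x (Sq c (Emit b)) (0, v, y) (poly (p + [:2:]) (length x + B)) (0, v, y @ w @ [b])"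
        by auto
    qed
    then show ?case by blast
  qed
  then show ?thesis unfolding wordf_def depends_on_def by blast
qed

lemma wordf_depends: "wordf D F \<Longrightarrow> (\<And>i. i \<in> D \<Longrightarrow> v i = v' i) \<Longrightarrow> F x v = F x v'"
  unfolding wordf_def depends_on_def by blast

lemma wordf_weaken:
  assumes "wordf D W" "D \<subseteq> D'"
  shows "wordf D' W"
proof -
  have "emits D W d c p \<Longrightarrow> emits D' W d c p" for d c p
    using assms(2) unfolding emits_def by blast
  moreover have "depends_on D' W"
    using assms unfolding depends_on_def wordf_def by blast
  ultimately show ?thesis using assms unfolding wordf_def by (meson dual_order.trans)
qed

lemma wordf_append:
  assumes U: "wordf D U" and W: "wordf D W"
  shows "wordf D (\<lambda>x v. U x v @ W x v)"
  unfolding wordf_def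
proof (intro conjI allI impI)
  show "depends_on D (\<lambda>x v. U x v @ W x v)"
    unfolding depends_on_def using wordf_depends[OF U] wordf_depends[OF W] by (metis (no_types, lifting))
next
  fix d assume D: "D \<subseteq> {..<d}"
  obtain c p where c: "emits D U d c p" using U D unfolding wordf_def by meson
  obtain c' p' where c': "emits D W d c' p'" using W D unfolding wordf_def by meson
  have "emits D (\<lambda>x v. U x v @ W x v) d (Sq c c') (p + p' + [:1:])"
    unfolding emits_def
  proof (intro allI impI)
    fix x :: "bool list" and v :: "nat \<Rightarrow> nat" and y B assume v: "\<forall>i\<ge>d. v i = 0" "\<forall>i\<in>D. v i \<le> B"
    have "runs x c (0, v, y) (poly p (length x + B)) (0, v, y @ U x v)"
      using v by (intro c[unfolded emits_def, rule_format]) auto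
    moreover have "runs x c' (0, v, y @ U x v) (poly p' (length x + B)) (0, v, (y @ U x v) @ W x v)"
      using v by (intro c'[unfolded emits_def, rule_format]) auto
    ultimately show "runs x (Sq c c') (0, v, y) (poly (p + p' + [:1:]) (length x + B)) (0, v, y @ U x v @ W x v)"
      by (auto elim!: runs_Sq)
  qed
  then show "\<exists>c p. emits D (\<lambda>x v. U x v @ W x v) d c p" by blast
qed

lemma wordf_concat:
  assumes F: "numf D F" and W: "\<And>e. e \<notin> D \<Longrightarrow> wordf (insert e D) (\<lambda>x v. W x v (v e))"
    and dep: "\<And>x v v' j. (\<And>i. i \<in> D \<Longrightarrow> v i = v' i) \<Longrightarrow> W x v j = W x v' j"
  shows "wordf D (\<lambda>x v. concat (map (W x v) [0..<F x v]))"
  unfolding wordf_def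
proof (intro conjI allI impI)
  show "depends_on D (\<lambda>x v. concat (map (W x v) [0..<F x v]))"
    unfolding depends_on_def
  proof (intro allI impI)
    fix x and v v' :: "nat \<Rightarrow> nat" assume e: "\<forall>i\<in>D. v i = v' i"
    then have "F x v = F x v'" by (intro numf_depends[OF F]) auto
    moreover have "W x v = W x v'" using e by (intro ext dep) auto
    ultimately show "concat (map (W x v) [0..<F x v]) = concat (map (W x v') [0..<F x v'])" by simp
  qed
next
  fix d assume D: "D \<subseteq> {..<d}"
  obtain p where p: "poly_bounded D F p" using F by (auto simp: numf_def)
  have D': "D \<subseteq> {..<Suc (Suc d)}" "d \<notin> D" "Suc d \<notin> D" using D by auto
  obtain c1 p1 where c1: "adds D F (Suc (Suc d)) (Suc d) c1 p1"
    using F D' unfolding numf_def by (meson lessI)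
  have "insert d D \<subseteq> {..<Suc (Suc d)}" using D' by auto
  then obtain c2 p2 where c2: "emits (insert d D) (\<lambda>x v. W x v (v d)) (Suc (Suc d)) c2 p2"
    using W[OF D'(2)] unfolding wordf_def by meson
  let ?p2 = "pcompose p2 (p + [:0, 1:])"
  let ?w1 = "Whl (Suc d) (Sq (Dec (Suc d)) (Sq c2 (Inc d)))"
  let ?w2 = "Whl d (Dec d)"
  let ?p = "p1 + p * (?p2 + [:5:]) + p * [:2:] + [:4:]"
  have "emits D (\<lambda>x v. concat (map (W x v) [0..<F x v])) d (Sq c1 (Sq ?w1 ?w2)) ?p"
    unfolding emits_def
  proof (intro allI impI)
    fix x :: "bool list" and v :: "nat \<Rightarrow> nat" and y B assume v: "\<forall>i\<ge>d. v i = 0" "\<forall>i\<in>D. v i \<le> B"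
    let ?n = "length x + B"
    have Fp: "F x v \<le> poly p ?n" using p v by (auto simp: poly_bounded_def)
    let ?v = "\<lambda>j. v(d := j, Suc d := F x v - j)"
    let ?y = "\<lambda>j. y @ concat (map (W x v) [0..<j])"
    let ?v' = "\<lambda>j. v(d := F x v - j)"
    have "?v 0 = v(Suc d := v (Suc d) + F x v)" using v by (intro ext) auto
    moreover have "runs x c1 (0, v, y) (poly p1 ?n) (0, v(Suc d := v (Suc d) + F x v), y)"
      using v by (intro c1[unfolded adds_def, rule_format]) auto
    ultimately have a: "runs x c1 (0, v, y) (poly p1 ?n) (0, ?v 0, ?y 0)" by simp
    have b: "runs x ?w1 (0, ?v 0, ?y 0) (F x v * (poly ?p2 ?n + 4 + 1) + 1) (0, ?v (F x v), ?y (F x v))"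
    proof (rule runs_Whl[where n = "F x v" and p = "\<lambda>_. 0" and v = ?v and y = ?y and Tb = "poly ?p2 ?n + 4"])
      fix j assume j: "j < F x v"
      let ?u = "v(d := j, Suc d := F x v - Suc j)"
      have 1: "runs x (Dec (Suc d)) (0, ?v j, ?y j) 1 (0, ?u, ?y j)"
        by (rule runs_Dec) auto
      have "runs x c2 (0, ?u, ?y j) (poly p2 (length x + (B + poly p ?n))) (0, ?u, ?y j @ W x ?u (?u d))"
        using v D' j Fp by (intro c2[unfolded emits_def, rule_format]) (auto intro: trans_le_add1)
      moreover have "W x ?u j = W x v j" using D' by (intro dep) auto
      moreover have "?u d = j" by simp
      ultimately have 2: "runs x c2 (0, ?u, ?y j) (poly ?p2 ?n) (0, ?u, ?y (Suc j))"
        by (simp add: poly_pcompose algebra_simps)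
      have 3: "runs x (Inc d) (0, ?u, ?y (Suc j)) 1 (0, ?v (Suc j), ?y (Suc j))"
        by (rule runs_Inc) auto
      show "runs x (Sq (Dec (Suc d)) (Sq c2 (Inc d))) (0, ?v j, ?y j) (poly ?p2 ?n + 4) (0, ?v (Suc j), ?y (Suc j))"
        by (rule runs_Sq[OF 1 runs_Sq[OF 2 3 order_refl]]) simp
    qed auto
    have e: "?v (F x v) = ?v' 0" using v by auto
    have c: "runs x ?w2 (0, ?v' 0, ?y (F x v)) (F x v * 2 + 1) (0, ?v' (F x v), ?y (F x v))"
      by (rule runs_Whl[where n = "F x v" and p = "\<lambda>_. 0" and v = ?v' and y = "\<lambda>_. ?y (F x v)" and Tb = 1])
        (auto intro!: runs_Dec)
    have "F x v * (poly ?p2 ?n + 4 + 1) \<le> poly p ?n * (poly ?p2 ?n + 5)" using Fp by (intro mult_mono) auto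
    then have le: "poly p1 ?n + ((F x v * (poly ?p2 ?n + 4 + 1) + 1) + (F x v * 2 + 1) + 1) + 1 \<le> poly ?p ?n"
      using Fp by simp
    have f: "?v' (F x v) = v" using v by auto
    show "runs x (Sq c1 (Sq ?w1 ?w2)) (0, v, y) (poly ?p ?n) (0, v, ?y (F x v))"
      using runs_Sq[OF a runs_Sq[OF b[unfolded e] c order_refl] le] f by simp
  qed
  then show "\<exists>c p. emits D (\<lambda>x v. concat (map (W x v) [0..<F x v])) d c p" by blast
qed

lemma polytime_wordf:
  assumes "wordf {} (\<lambda>x v. f x)"
  shows "polytime f"
proof -
  obtain c p where c: "emits {} (\<lambda>x v. f x) 0 c p" using assms unfolding wordf_def by blast
  show ?thesis
  proof (rule polytime_if_program)
    fix x
    have "runs x c (0, \<lambda>_. 0, []) (poly p (length x + 0)) (0, \<lambda>_. 0, [] @ f x)"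
      by (rule c[unfolded emits_def, rule_format]) auto
    then show "\<exists>t\<le>poly p (length x). \<exists>i v. (cstep x ^^ t) ([c], 0, \<lambda>_. 0, []) = ([], i, v, f x)"
      unfolding runs_def by auto
  qed
qed

section \<open>Logical and arithmetical combinators\<close>

abbreviation boolf :: "nat set \<Rightarrow> (bool list \<Rightarrow> (nat \<Rightarrow> nat) \<Rightarrow> bool) \<Rightarrow> bool" where
  "boolf D P \<equiv> numf D (\<lambda>x v. of_bool (P x v))"

lemma boolf_le: "numf D F \<Longrightarrow> numf D G \<Longrightarrow> boolf D (\<lambda>x v. F x v \<le> G x v)"
proof -
  assume "numf D F" "numf D G"
  then have "numf D (\<lambda>x v. 1 - (F x v - G x v))" by (intro numf_minus numf_const)
  moreover have "(\<lambda>x v. 1 - (F x v - G x v)) = (\<lambda>x v. of_bool (F x v \<le> G x v))" by (intro ext) auto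
  ultimately show ?thesis by simp
qed

lemma boolf_less: "numf D F \<Longrightarrow> numf D G \<Longrightarrow> boolf D (\<lambda>x v. F x v < G x v)"
proof -
  assume "numf D F" "numf D G"
  then have "boolf D (\<lambda>x v. F x v + 1 \<le> G x v)" by (intro boolf_le numf_add numf_const)
  then show ?thesis by (simp add: Suc_le_eq)
qed

lemma boolf_not: "boolf D P \<Longrightarrow> boolf D (\<lambda>x v. \<not> P x v)"
proof -
  assume "boolf D P"
  then have "numf D (\<lambda>x v. 1 - of_bool (P x v))" by (intro numf_minus numf_const)
  moreover have "(\<lambda>x v. 1 - of_bool (P x v)) = (\<lambda>x v. of_bool (\<not> P x v) :: nat)" by (intro ext) auto
  ultimately show ?thesis by simp
qed

lemma boolf_conj: "boolf D P \<Longrightarrow> boolf D Q \<Longrightarrow> boolf D (\<lambda>x v. P x v \<and> Q x v)"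
  using numf_mult[of D "\<lambda>x v. of_bool (P x v)" "\<lambda>x v. of_bool (Q x v)"] by (simp add: of_bool_conj)

lemma boolf_eq: "numf D F \<Longrightarrow> numf D G \<Longrightarrow> boolf D (\<lambda>x v. F x v = G x v)"
  using boolf_conj[OF boolf_le[of D F G] boolf_le[of D G F]] by (simp add: eq_iff)

lemma numf_if:
  assumes "boolf D P" "numf D F" "numf D G"
  shows "numf D (\<lambda>x v. if P x v then F x v else G x v)"
proof -
  have "numf D (\<lambda>x v. of_bool (P x v) * F x v + of_bool (\<not> P x v) * G x v)"
    using assms by (intro numf_add numf_mult boolf_not)
  moreover have "(\<lambda>x v. of_bool (P x v) * F x v + of_bool (\<not> P x v) * G x v) =
      (\<lambda>x v. if P x v then F x v else G x v)" by (intro ext) auto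
  ultimately show ?thesis by simp
qed

text \<open>A bounded universal statement holds iff the number of counterexamples, a sum, is
  zero.\<close>

lemma boolf_all:
  assumes F: "numf D F" and P: "\<And>e. e \<notin> D \<Longrightarrow> boolf (insert e D) (\<lambda>x v. P x v (v e))"
    and dep: "\<And>x v v' j. (\<And>i. i \<in> D \<Longrightarrow> v i = v' i) \<Longrightarrow> P x v j = P x v' j"
    and fin: "finite D"
  shows "boolf D (\<lambda>x v. \<forall>j<F x v. P x v j)"
proof -
  have "numf D (\<lambda>x v. \<Sum>j<F x v. of_bool (\<not> P x v j))"
  proof (intro numf_sum F fin boolf_not P)
    fix x j and v v' :: "nat \<Rightarrow> nat" assume "\<And>i. i \<in> D \<Longrightarrow> v i = v' i"
    then have "P x v j = P x v' j" by (rule dep)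
    then show "of_bool (\<not> P x v j) = (of_bool (\<not> P x v' j) :: nat)" by simp
  qed
  then have "boolf D (\<lambda>x v. (\<Sum>j<F x v. of_bool (\<not> P x v j)) = (0 :: nat))"
    by (rule boolf_eq[OF _ numf_const])
  moreover have "((\<Sum>j<F x v. of_bool (\<not> P x v j)) = (0 :: nat)) = (\<forall>j<F x v. P x v j)" for x v
    by (simp only: sum_eq_0_iff finite_lessThan of_bool_eq_0_iff not_not Ball_def lessThan_iff)
  ultimately show ?thesis by simp
qed

text \<open>For \<open>b > 0\<close> the quotient \<open>a div b\<close> is the number of positive
  multiples of \<open>b\<close> up to \<open>a\<close>; the index may be bounded by \<open>a\<close>
  because the quotient is.\<close>

lemma numf_div:
  assumes F: "numf D F" and G: "numf D G" and fin: "finite D"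
  shows "numf D (\<lambda>x v. F x v div G x v)"
proof -
  have "numf D (\<lambda>x v. if G x v = 0 then 0 else \<Sum>j<F x v. of_bool ((j + 1) * G x v \<le> F x v))"
  proof (intro numf_if boolf_eq numf_const numf_sum F G fin boolf_le numf_mult numf_add numf_var
        numf_weaken[OF G] numf_weaken[OF F] insertI1 subset_insertI)
    fix x j and v v' :: "nat \<Rightarrow> nat" assume "\<And>i. i \<in> D \<Longrightarrow> v i = v' i"
    note eq = this
    have "F x v = F x v'" "G x v = G x v'" using eq by - (rule numf_depends[OF F], simp, rule numf_depends[OF G], simp)
    then show "of_bool ((j + 1) * G x v \<le> F x v) = (of_bool ((j + 1) * G x v' \<le> F x v') :: nat)" by simp
  qed
  moreover have "(if b = 0 then 0 else \<Sum>j<a. of_bool ((j + 1) * b \<le> a)) = a div b" for a b :: nat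
  proof (cases "b = 0")
    case False
    have "(\<Sum>j<a. of_bool ((j + 1) * b \<le> a)) = card {j. j < a \<and> (j + 1) * b \<le> a}"
      by (simp add: sum.If_cases lessThan_def of_bool_def Int_def)
    also have "{j. j < a \<and> (j + 1) * b \<le> a} = {..<a div b}"
    proof -
      have "(j + 1) * b \<le> a \<longleftrightarrow> j < a div b" for j
        using False by (metis Suc_eq_plus1 less_eq_div_iff_mult_less_eq less_eq_Suc_le neq0_conv)
      moreover have "j < a div b \<Longrightarrow> j < a" for j
        by (meson div_le_dividend less_le_trans)
      ultimately show ?thesis by auto
    qed
    finally show ?thesis using False by simp
  qed simp
  ultimately show ?thesis by simp
qed

lemma numf_mod:
  assumes F: "numf D F" and G: "numf D G" and fin: "finite D"
  shows "numf D (\<lambda>x v. F x v mod G x v)"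
  using numf_minus[OF F numf_mult[OF numf_div[OF assms] G]] by (simp add: minus_div_mult_eq_mod)

lemma boolf_dvd:
  assumes "numf D F" "numf D G" "finite D"
  shows "boolf D (\<lambda>x v. F x v dvd G x v)"
  using boolf_eq[OF numf_mod[OF assms(2,1,3)] numf_const[of D 0]] by (simp add: dvd_eq_mod_eq_0)

lemma numf_power: "numf D F \<Longrightarrow> numf D (\<lambda>x v. F x v ^ c)"
  by (induction c) (simp_all add: numf_const numf_mult)

lemma numf_poly:
  assumes "numf D F"
  shows "numf D (\<lambda>x v. poly p (F x v))"
  by (induction p) (simp_all add: numf_const numf_mult numf_add assms)

text \<open>A value below a constant \<open>R\<close> can be looked up case by case. This lets a
  function of finitely many fixed values enter a program as a table, whatever its definition; the
  rules of the verifier are used in this way.\<close>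

lemma numf_table:
  assumes "\<And>c. c < R \<Longrightarrow> numf D (H c)" "numf D G"
  shows "numf D (\<lambda>x v. if G x v < R then H (G x v) x v else 0)"
  using assms(1)
proof (induction R)
  case 0
  show ?case by (simp add: numf_const)
next
  case (Suc R)
  then have "numf D (\<lambda>x v. if G x v = R then H R x v else if G x v < R then H (G x v) x v else 0)"
    by (intro numf_if[OF boolf_eq[OF assms(2) numf_const]]) auto
  moreover have "(\<lambda>x v. if G x v = R then H R x v else if G x v < R then H (G x v) x v else 0) =
      (\<lambda>x v. if G x v < Suc R then H (G x v) x v else 0)"
    by (intro ext) auto
  ultimately show ?case by simp
qed

section \<open>Powers of two and binary notation\<close>

definition is_pow2 :: "nat \<Rightarrow> bool" where
  "is_pow2 y \<longleftrightarrow> (\<exists>k. y = 2 ^ k)"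

text \<open>The powers of two are the positive numbers without odd divisors other than 1. All
  quantifiers are bounded by \<open>y\<close>, so the test is a program. For the converse, halve
  until the number is odd, hence 1.\<close>

lemma is_pow2_iff: "is_pow2 y \<longleftrightarrow> 1 \<le> y \<and> (\<forall>d<y + 1. \<not> (d dvd y \<and> \<not> 2 dvd d \<and> \<not> d = 1))"
proof
  assume "is_pow2 y"
  then obtain k where k: "y = 2 ^ k" by (auto simp: is_pow2_def)
  have "d = 1" if "d dvd 2 ^ k" "\<not> 2 dvd d" for d :: nat
  proof -
    have "coprime d (2 ^ k)" using that(2) by (simp add: coprime_commute)
    then show ?thesis using that(1) using coprime_common_divisor[of d "2 ^ k" d] by simp
  qed
  then show "1 \<le> y \<and> (\<forall>d<y + 1. \<not> (d dvd y \<and> \<not> 2 dvd d \<and> \<not> d = 1))" using k by auto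
next
  show "1 \<le> y \<and> (\<forall>d<y + 1. \<not> (d dvd y \<and> \<not> 2 dvd d \<and> \<not> d = 1)) \<Longrightarrow> is_pow2 y"
  proof (induction y rule: less_induct)
    case (less y)
    show ?case
    proof (cases "even y")
      case True
      then obtain z where z: "y = 2 * z" by blast
      have "is_pow2 z"
        using less.prems z by (intro less.IH) (auto simp: less_Suc_eq_le)
      then show ?thesis unfolding is_pow2_def z by (metis power_Suc)
    next
      case False
      then have "y = 1" using less.prems by auto
      then show ?thesis unfolding is_pow2_def by (intro exI[of _ 0]) auto
    qed
  qed
qed

lemma boolf_is_pow2:
  assumes F: "numf D F" and fin: "finite D"
  shows "boolf D (\<lambda>x v. is_pow2 (F x v))"
  unfolding is_pow2_iff
proof (intro boolf_conj boolf_le boolf_all boolf_not boolf_dvd boolf_eq numf_const F numf_add numf_var fin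
      numf_weaken[OF F] insertI1 subset_insertI finite.insertI)
  fix x j and v v' :: "nat \<Rightarrow> nat" assume "\<And>i. i \<in> D \<Longrightarrow> v i = v' i"
  then have "F x v = F x v'" by (rule numf_depends[OF F])
  then show "(\<not> (j dvd F x v \<and> \<not> 2 dvd j \<and> \<not> j = 1)) = (\<not> (j dvd F x v' \<and> \<not> 2 dvd j \<and> \<not> j = 1))" by simp
qed

lemma filter_is_pow2:
  assumes "K > 0"
  shows "filter is_pow2 [0..<Suc K] = 1 # map ((*) 2) (filter is_pow2 [0..<Suc (K div 2)])"
proof (rule sorted_distinct_set_unique)
  show "sorted (filter is_pow2 [0..<Suc K])" "distinct (filter is_pow2 [0..<Suc K])"
    by (auto simp: sorted_wrt_filter simp del: upt_Suc)
  have "distinct (map ((*) 2) (filter is_pow2 [0..<Suc (K div 2)]))"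
    by (auto simp: distinct_map inj_on_def simp del: upt_Suc)
  then show "distinct (1 # map ((*) 2) (filter is_pow2 [0..<Suc (K div 2)]))" by auto
  have "sorted (map ((*) 2) (filter is_pow2 [0..<Suc (K div 2)]))"
    by (auto simp: sorted_map sorted_wrt_filter simp del: upt_Suc intro: sorted_wrt_mono_rel[of _ "(\<le>)"])
  moreover have "\<not> is_pow2 0" by (auto simp: is_pow2_def)
  then have "\<forall>y\<in>set (filter is_pow2 [0..<Suc (K div 2)]). 1 \<le> 2 * y"
    by (auto simp: Suc_le_eq intro: gr0I)
  ultimately show "sorted (1 # map ((*) 2) (filter is_pow2 [0..<Suc (K div 2)]))" by auto
  have "y = 1 \<or> (\<exists>z. y = 2 * z \<and> is_pow2 z)" if y: "is_pow2 y" for y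
  proof -
    obtain k where "y = 2 ^ k" using y by (auto simp: is_pow2_def)
    then show ?thesis by (cases k) (auto simp: is_pow2_def)
  qed
  moreover have "is_pow2 (2 * z)" if "is_pow2 z" for z
    using that by (auto simp: is_pow2_def) (metis power_Suc)
  moreover have "is_pow2 1" by (auto simp: is_pow2_def intro!: exI[of _ 0])
  ultimately have "{y. y < Suc K \<and> is_pow2 y} = insert 1 ((*) 2 ` {y. y < Suc (K div 2) \<and> is_pow2 y})"
    using assms by (auto simp: image_iff less_Suc_eq_le) (metis div_le_mono nonzero_mult_div_cancel_left zero_neq_numeral)
  moreover have "set (filter is_pow2 [0..<Suc n]) = {y. y < Suc n \<and> is_pow2 y}" for n
    by (auto simp del: upt_Suc)
  ultimately show "set (filter is_pow2 [0..<Suc K]) = set (1 # map ((*) 2) (filter is_pow2 [0..<Suc (K div 2)]))"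
    by (simp del: upt_Suc)
qed

text \<open>The bits, least significant first, are the parities of \<open>K div 2 ^ k\<close> for
  the powers \<open>2 ^ k\<close> up to \<open>K\<close>. Searching all \<open>y\<close> up to
  \<open>K\<close> for powers of two is affordable because values are polynomially bounded.\<close>

lemma binary_is_pow2: "binary K = map (\<lambda>y. odd (K div y)) (filter is_pow2 [0..<Suc K])"
proof (induction K rule: less_induct)
  case (less K)
  show ?case
  proof (cases "K = 0")
    case True
    then show ?thesis by (simp add: binary.simps is_pow2_def)
  next
    case False
    then have "binary (K div 2) = map (\<lambda>y. odd (K div 2 div y)) (filter is_pow2 [0..<Suc (K div 2)])"
      by (intro less.IH) auto
    then show ?thesis unfolding filter_is_pow2[OF False[unfolded neq0_conv]]
      using False by (simp add: binary.simps[of K] div_mult2_eq del: upt_Suc)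
  qed
qed

lemma concat_map_filter: "concat (map (\<lambda>y. if P y then f y else []) xs) = concat (map f (filter P xs))"
  by (induction xs) auto

lemma enc_nat_loop:
  "enc_nat K = concat (map (\<lambda>y. if is_pow2 y then [True] @ (if 2 dvd K div y then [False] else [True]) else []) [0..<K + 1]) @ [False]"
  unfolding concat_map_filter enc_nat_def enc_bits_def binary_is_pow2 map_map o_def
  by (auto intro!: arg_cong[of _ _ concat] simp del: upt_Suc)

text \<open>A conditional is a pair of loops that run once or not at all.\<close>

lemma wordf_if:
  assumes P: "boolf D P" and U: "wordf D U" and W: "wordf D W"
  shows "wordf D (\<lambda>x v. if P x v then U x v else W x v)"
proof -
  have "wordf D (\<lambda>x v. concat (map (\<lambda>j. U x v) [0..<of_bool (P x v)]) @ concat (map (\<lambda>j. W x v) [0..<of_bool (\<not> P x v)]))"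
    by (intro wordf_append wordf_concat P boolf_not wordf_weaken[OF U] wordf_weaken[OF W] subset_insertI
        wordf_depends[OF U] wordf_depends[OF W])
  moreover have "(\<lambda>x v. concat (map (\<lambda>j. U x v) [0..<of_bool (P x v)]) @ concat (map (\<lambda>j. W x v) [0..<of_bool (\<not> P x v)])) =
      (\<lambda>x v. if P x v then U x v else W x v)"
    by (intro ext) auto
  ultimately show ?thesis by simp
qed

lemma wordf_enc_nat:
  assumes F: "numf D F" and fin: "finite D"
  shows "wordf D (\<lambda>x v. enc_nat (F x v))"
proof -
  let ?W = "\<lambda>x v y. if is_pow2 y then [True] @ (if 2 dvd F x v div y then [False] else [True]) else []"
  have "wordf D (\<lambda>x v. concat (map (?W x v) [0..<F x v + 1]))"
  proof (rule wordf_concat[OF numf_add[OF F numf_const]])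
    show "wordf (insert e D) (\<lambda>x v. ?W x v (v e))" for e
      using fin by (intro wordf_if wordf_append wordf_const boolf_is_pow2 boolf_dvd numf_div numf_const numf_var
        numf_weaken[OF F] insertI1 subset_insertI finite.insertI)
  next
    fix x j and v v' :: "nat \<Rightarrow> nat" assume "\<And>i. i \<in> D \<Longrightarrow> v i = v' i"
    then have "F x v = F x v'" by (rule numf_depends[OF F])
    then show "?W x v j = ?W x v' j" by (simp only:)
  qed
  then show ?thesis unfolding enc_nat_loop by (rule wordf_append[OF _ wordf_const])
qed

section \<open>Layouts of groups of square size\<close>

text \<open>In a single-valued relation a path is determined by its start and its length, and no
  path continues beyond a root. Hence all paths from \<open>v\<close> to a root have the same
  length, and the description in \<open>layer\<close> is unique.\<close>

lemma layer_eq: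
  assumes sv: "single_valued E" and r: "r \<in> roots V E" and p: "(v, r) \<in> E ^^ n"
  shows "layer V E v = n"
proof -
  have det: "a = c" if "(u, a) \<in> E ^^ k" "(u, c) \<in> E ^^ k" for u a c k
    using that
  proof (induction k arbitrary: a c)
    case (Suc k)
    then obtain a' c' where "(u, a') \<in> E ^^ k" "(a', a) \<in> E" "(u, c') \<in> E ^^ k" "(c', c) \<in> E" by auto
    with Suc.IH sv show ?case by (metis single_valuedD)
  qed simp
  have ge: "j \<le> i" if "(v, s) \<in> E ^^ i" "s \<in> roots V E" "(v, t) \<in> E ^^ j" for s t i j
  proof (rule ccontr)
    assume "\<not> j \<le> i"
    then obtain k where k: "j = i + Suc k" by (metis add_Suc_right less_iff_Suc_add not_le)
    have "(v, t) \<in> E ^^ i O E ^^ Suc k" using that(3) unfolding k relpow_add .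
    then obtain z where "(v, z) \<in> E ^^ i" "(z, t) \<in> E ^^ Suc k" by blast
    moreover from this have "z = s" using det that(1) by blast
    ultimately obtain z' where "(s, z') \<in> E" by (metis relpow_Suc_D2)
    then show False using that(2) by (auto simp: roots_def)
  qed
  show ?thesis unfolding layer_def
    using r p ge by (intro the_equality) (auto intro: le_antisym)
qed

lemma rooted_forest_path:
  assumes "rooted_forest V E" "v \<in> V"
  shows "\<exists>r\<in>roots V E. (v, r) \<in> E ^^ layer V E v"
proof -
  have V: "finite V" "E \<subseteq> V \<times> V" "single_valued E" "acyclic E"
    using assms by (auto simp: rooted_forest_def)
  then have "finite E" using finite_subset by blast
  then have "wf (E\<inverse>)" using V(4) by (rule finite_acyclic_wf_converse)
  then have "v \<in> V \<longrightarrow> (\<exists>r\<in>roots V E. \<exists>n. (v, r) \<in> E ^^ n)"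
  proof (induction v rule: wf_induct_rule)
    case (less v)
    show ?case
    proof (cases "v \<in> roots V E")
      case True
      then show ?thesis by (intro impI bexI[of _ v] exI[of _ 0]) auto
    next
      case False
      show ?thesis
      proof
        assume "v \<in> V"
        with False obtain p where p: "(v, p) \<in> E" by (auto simp: roots_def)
        then obtain r n where "r \<in> roots V E" "(p, r) \<in> E ^^ n" using less[of p] V by blast
        with p show "\<exists>r\<in>roots V E. \<exists>n. (v, r) \<in> E ^^ n" by (meson relpow_Suc_I2)
      qed
    qed
  qed
  then show ?thesis using assms layer_eq[OF V(3)] by metis
qed

text \<open>\<delta> is at most half the distance of any two groups, and \<open>b_large\<close>
  places the charge \<open>1 / b\<close> of a source below it. A point is then farther than the
  charge from every group except possibly the nearest one.\<close>

locale square_groups =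
  fixes I :: "(nat, nat) flamecast" and grp :: "nat \<Rightarrow> nat" and P :: "nat \<Rightarrow> real ^ 2"
    and b :: "nat \<Rightarrow> nat" and m nb B :: nat and \<delta> :: real
  assumes fin: "finite (sources I)" and sinks: "sinks I = {..<nb}"
    and caps: "capacities I = [B, B, 1]" and alpha: "alpha I = 1 / 2"
    and sink_pos: "\<And>t. t < nb \<Longrightarrow> sink_pos I t = 0"
    and source_pos: "\<And>s. s \<in> sources I \<Longrightarrow> source_pos I s = P (grp s)"
    and grp: "\<And>s. s \<in> sources I \<Longrightarrow> grp s < m"
    and card_grp: "\<And>g. g < m \<Longrightarrow> card {s \<in> sources I. grp s = g} = b g ^ 2"
    and norm_P: "\<And>g. g < m \<Longrightarrow> norm (P g) = 1"
    and dist_P: "\<And>g h. g < m \<Longrightarrow> h < m \<Longrightarrow> g \<noteq> h \<Longrightarrow> 2 * \<delta> \<le> norm (P g - P h)"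
    and b_large: "\<And>g. g < m \<Longrightarrow> 1 < real (b g) * \<delta>" and \<delta>: "0 < \<delta>"
begin

lemma b_pos: "g < m \<Longrightarrow> 0 < b g"
  using b_large[of g] by (intro gr0I) auto

lemma group_nonempty: "\<exists>s\<in>sources I. grp s = g" if "g < m"
proof (rule ccontr)
  assume "\<not> ?thesis"
  then have e: "{s \<in> sources I. grp s = g} = {}" by blast
  show False using card_grp[OF that] b_pos[OF that] unfolding e by simp
qed

lemma charge_less: "g < m \<Longrightarrow> 1 / real (b g) < \<delta>"
  using b_large[of g] b_pos[of g] by (simp add: field_simps)

text \<open>\<open>C\<close> is the set of sources attached to a vertex at \<open>y\<close>; the
  cost counts the edges from \<open>C\<close> and one edge to the centre with load
  \<open>card C\<close>. The \<open>n\<close> sources of the group nearest to \<open>y\<close> have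
  charge \<open>n / b\<close>, at most \<open>sqrt n\<close> since \<open>n \<le> b^2\<close>, and
  \<open>sqrt n\<close> is a lower bound for their cost; every other source pays more than its
  charge on its own edge. Equality excludes other sources and forces \<open>n = b^2\<close>.\<close>

lemma node_cost:
  fixes y :: "real ^ 2"
  assumes C: "C \<subseteq> sources I" "C \<noteq> {}"
  defines "cost \<equiv> (\<Sum>s\<in>C. norm (P (grp s) - y)) + norm y * sqrt (card C)"
    and "charge \<equiv> (\<Sum>s\<in>C. 1 / real (b (grp s)))"
  shows "charge \<le> cost" and "charge = cost \<Longrightarrow> \<exists>g<m. C = {s \<in> sources I. grp s = g}"
proof -
  have finC: "finite C" using C fin finite_subset by blast
  have m: "{..<m} \<noteq> {}" using C grp by fastforce
  define g0 where "g0 = arg_min_on (\<lambda>g. norm (P g - y)) {..<m}"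
  have g0: "g0 < m" using arg_min_if_finite(1)[OF _ m] by (auto simp: g0_def)
  have near: "norm (P g0 - y) \<le> norm (P g - y)" if "g < m" for g
    using arg_min_least[OF _ m] that by (auto simp: g0_def)
  define A where "A = {s \<in> C. grp s = g0}"
  have A: "A \<subseteq> C" "finite A" using finC by (auto simp: A_def)
  \<comment> \<open>Since \<open>g0\<close> is nearest to \<open>y\<close>, twice the distance from
    \<open>y\<close> to another group is at least the distance of the two groups.\<close>
  have far: "1 / real (b (grp s)) < norm (P (grp s) - y)" if "s \<in> C - A" for s
  proof -
    have s: "grp s < m" "grp s \<noteq> g0" using that grp C by (auto simp: A_def)
    have "2 * \<delta> \<le> norm (P (grp s) - P g0)" using dist_P s g0 by auto
    also have "\<dots> \<le> norm (P (grp s) - y) + norm (P g0 - y)" by norm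
    also have "\<dots> \<le> 2 * norm (P (grp s) - y)" using near[OF s(1)] by simp
    finally show ?thesis using charge_less[OF s(1)] by simp
  qed
  let ?n = "real (card A)"
  have nA: "card A \<le> b g0 ^ 2"
    unfolding card_grp[OF g0, symmetric] using C fin by (intro card_mono) (auto simp: A_def)
  have sq: "sqrt ?n \<le> ?n"
  proof (cases "card A = 0")
    case False
    then have "?n \<le> ?n * ?n" by (metis less_one linorder_not_le mult_le_cancel_left1 of_nat_0_le_iff of_nat_1 of_nat_le_iff)
    then show ?thesis by (simp add: real_sqrt_le_iff real_le_lsqrt power2_eq_square)
  qed simp
  have chA: "(\<Sum>s\<in>A. 1 / real (b (grp s))) = ?n / real (b g0)"
    by (simp add: A_def)
  have chA_le: "?n / real (b g0) \<le> sqrt ?n"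
  proof -
    have "sqrt ?n \<le> real (b g0)" using nA by (intro real_le_lsqrt) (auto simp flip: of_nat_power)
    then have "sqrt ?n * sqrt ?n \<le> sqrt ?n * real (b g0)" by (intro mult_left_mono) auto
    then show ?thesis using b_pos[OF g0] by (simp add: field_simps)
  qed
  \<comment> \<open>Replacing the weights \<open>n\<close> and \<open>sqrt (card C)\<close> by
    \<open>sqrt n\<close> leaves a detour from the unit circle to the centre via \<open>y\<close>,
    of length at least 1.\<close>
  have coA: "sqrt ?n \<le> (\<Sum>s\<in>A. norm (P (grp s) - y)) + norm y * sqrt (card C)"
  proof -
    have "1 \<le> norm (P g0 - y) + norm y" using norm_P[OF g0] norm_triangle_sub[of "P g0" y] by simp
    then have "sqrt ?n * 1 \<le> sqrt ?n * (norm (P g0 - y) + norm y)" by (intro mult_left_mono) auto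
    also have "\<dots> \<le> ?n * norm (P g0 - y) + norm y * sqrt (card C)"
      using sq A finC by (auto simp: distrib_left mult.commute[of "norm y"] intro!: add_mono mult_right_mono card_mono)
    also have "?n * norm (P g0 - y) = (\<Sum>s\<in>A. norm (P (grp s) - y))" by (simp add: A_def)
    finally show ?thesis by simp
  qed
  have split: "(\<Sum>s\<in>C. f s) = (\<Sum>s\<in>A. f s) + (\<Sum>s\<in>C - A. f s)" for f :: "nat \<Rightarrow> real"
    using sum.subset_diff[OF A(1) finC, of f] by simp
  have rest: "(\<Sum>s\<in>C - A. 1 / real (b (grp s))) \<le> (\<Sum>s\<in>C - A. norm (P (grp s) - y))"
    using far by (intro sum_mono) (auto intro: less_imp_le)
  show "charge \<le> cost"
    unfolding charge_def cost_def split chA using rest chA_le coA by linarith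
  assume eq: "charge = cost"
  have "C - A = {}"
  proof (rule ccontr)
    assume "C - A \<noteq> {}"
    then have "(\<Sum>s\<in>C - A. 1 / real (b (grp s))) < (\<Sum>s\<in>C - A. norm (P (grp s) - y))"
      using far finC by (intro sum_strict_mono) auto
    then show False using eq chA_le coA unfolding charge_def cost_def split chA by linarith
  qed
  then have CA: "C = A" using A by auto
  have "sqrt ?n = ?n / real (b g0)"
    using eq rest chA_le coA unfolding charge_def cost_def split chA by linarith
  then have "sqrt ?n * real (b g0) = sqrt ?n * sqrt ?n" using b_pos[OF g0] by (simp add: field_simps)
  moreover have "?n > 0" using C(2) A unfolding CA by (simp add: card_gt_0_iff)
  ultimately have "sqrt ?n = real (b g0)" by (metis less_numeral_extra(3) mult_left_cancel real_sqrt_gt_0_iff)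
  then have "?n = real (b g0) ^ 2" by (metis of_nat_0_le_iff real_sqrt_pow2)
  then have "card A = b g0 ^ 2" by (metis of_nat_eq_iff of_nat_power)
  then have "A = {s \<in> sources I. grp s = g0}"
    using C fin card_grp[OF g0] by (intro card_subset_eq) (auto simp: A_def)
  then show "\<exists>g<m. C = {s \<in> sources I. grp s = g}" using CA g0 by auto
qed

lemma total_charge: "(\<Sum>s\<in>sources I. 1 / real (b (grp s))) = (\<Sum>g<m. real (b g))"
proof -
  have "(\<Sum>g<m. \<Sum>s\<in>{s \<in> sources I. grp s = g}. 1 / real (b (grp s))) = (\<Sum>s\<in>sources I. 1 / real (b (grp s)))"
    using grp by (intro sum.group fin) auto
  moreover have "(\<Sum>s\<in>{s \<in> sources I. grp s = g}. 1 / real (b (grp s))) = real (b g)" if "g < m" for g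
  proof -
    have "(\<Sum>s\<in>{s \<in> sources I. grp s = g}. 1 / real (b (grp s))) = real (b g ^ 2) / real (b g)"
      by (simp add: card_grp[OF that])
    then show ?thesis by (simp add: power2_eq_square)
  qed
  ultimately show ?thesis by simp
qed

lemma card_groups:
  "finite G \<Longrightarrow> G \<subseteq> {..<m} \<Longrightarrow> card {s \<in> sources I. grp s \<in> G} = (\<Sum>g\<in>G. b g ^ 2)"
proof -
  assume G: "finite G" "G \<subseteq> {..<m}"
  have "{s \<in> sources I. grp s \<in> G} = (\<Union>g\<in>G. {s \<in> sources I. grp s = g})" by auto
  also have "card \<dots> = (\<Sum>g\<in>G. card {s \<in> sources I. grp s = g})"
    using G fin by (intro card_UN_disjoint) auto
  also have "\<dots> = (\<Sum>g\<in>G. b g ^ 2)" using G card_grp by (intro sum.cong) auto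
  finally show ?thesis .
qed

text \<open>One Steiner vertex at the position of each group: edges from its sources have length 0,
  and the edge to the centre has length 1 and load \<open>b^2\<close>, hence cost
  \<open>b\<close>.\<close>

lemma packing_imp_layout:
  assumes \<beta>: "\<And>g. g < m \<Longrightarrow> \<beta> g < nb"
    and load: "\<And>t. t < nb \<Longrightarrow> (\<Sum>g | g < m \<and> \<beta> g = t. b g ^ 2) \<le> B"
  shows "has_layout_of_cost I (\<Sum>g<m. real (b g))"
proof -
  let ?S = "sources I"
  \<comment> \<open>Only sinks that receive a group are vertices. An isolated sink would be a leaf,
    while leaves have to be sources.\<close>
  define V where "V = Source ` ?S \<union> Steiner ` {..<m} \<union> (Sink ` \<beta> ` {..<m} :: (nat, nat) vertex set)"
  define E1 where "E1 = (\<lambda>s. (Source s, Steiner (grp s)) :: (nat, nat) vertex \<times> (nat, nat) vertex) ` ?S"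
  define E2 where "E2 = (\<lambda>g. (Steiner g, Sink (\<beta> g)) :: (nat, nat) vertex \<times> (nat, nat) vertex) ` {..<m}"
  define E where "E = E1 \<union> E2"
  define pos where "pos v = (case v of Source s \<Rightarrow> source_pos I s | Steiner g \<Rightarrow> P g | Sink t \<Rightarrow> sink_pos I t)" for v
  note EE = E_def E1_def E2_def
  define rk where "rk v = (case v of Source s \<Rightarrow> 2 | Steiner g \<Rightarrow> 1 | Sink t \<Rightarrow> (0 :: nat))" for v :: "(nat, nat) vertex"
  have sv: "single_valued E" by (auto simp: single_valued_def EE)
  have "E\<inverse> \<subseteq> Wellfounded.measure rk" by (auto simp: EE rk_def)
  then have "acyclic (E\<inverse>)" using wf_acyclic wf_subset wf_measure by blast
  then have ac: "acyclic E" by simp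
  have forest: "rooted_forest V E"
    using sv ac fin grp by (auto simp: rooted_forest_def V_def EE)
  have roots: "roots V E = Sink ` \<beta> ` {..<m}"
    using grp by (auto simp: roots_def V_def EE)
  have leaves: "leaves V E = Source ` ?S"
    using grp group_nonempty by (force simp: leaves_def V_def EE)
  have path2: "(Steiner g, Sink (\<beta> g)) \<in> E ^^ 1" if "g < m" for g
    using that by (auto simp: EE)
  have path1: "(Source s, Sink (\<beta> (grp s))) \<in> E ^^ 2" if "s \<in> ?S" for s
    using that grp by (auto simp: EE numeral_2_eq_2 relcomp.simps)
  have layer: "layer V E v = rk v" if v: "v \<in> V" for v
  proof -
    consider s where "v = Source s" "s \<in> ?S" | g where "v = Steiner g" "g < m" | g where "v = Sink (\<beta> g)" "g < m"
      using v by (auto simp: V_def)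
    then show ?thesis
    proof cases
      case 1
      then show ?thesis using layer_eq[OF sv _ path1] grp by (auto simp: roots rk_def)
    next
      case 2
      then show ?thesis using layer_eq[OF sv _ path2] by (auto simp: roots rk_def)
    next
      case 3
      then show ?thesis using layer_eq[OF sv, of v V v 0] by (auto simp: roots rk_def)
    qed
  qed
  have reach: "(Source s, v) \<in> E\<^sup>* \<longleftrightarrow> v \<in> {Source s, Steiner (grp s), Sink (\<beta> (grp s))}" if s: "s \<in> ?S" for s v
  proof
    assume "(Source s, v) \<in> E\<^sup>*"
    then show "v \<in> {Source s, Steiner (grp s), Sink (\<beta> (grp s))}"
      by (induction rule: rtrancl_induct) (auto simp: EE)
  next
    have "(Source s, Steiner (grp s)) \<in> E" "(Steiner (grp s), Sink (\<beta> (grp s))) \<in> E"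
      using s grp by (auto simp: EE)
    then show "v \<in> {Source s, Steiner (grp s), Sink (\<beta> (grp s))} \<Longrightarrow> (Source s, v) \<in> E\<^sup>*"
      by (auto intro: rtrancl_into_rtrancl)
  qed
  have load_source: "load I E (Source s) = 1" if "s \<in> ?S" for s
  proof -
    have "{s' \<in> ?S. (Source s', Source s) \<in> E\<^sup>*} = {s}" using that reach by auto
    then show ?thesis by (simp add: load_def)
  qed
  have load_steiner: "load I E (Steiner g) = b g ^ 2" if "g < m" for g
  proof -
    have "{s \<in> ?S. (Source s, Steiner g) \<in> E\<^sup>*} = {s \<in> ?S. grp s = g}" using reach by auto
    then show ?thesis using card_grp[OF that] by (simp add: load_def)
  qed
  have load_sink: "load I E (Sink t) = (\<Sum>g | g < m \<and> \<beta> g = t. b g ^ 2)" for t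
  proof -
    have "{s \<in> ?S. (Source s, Sink t) \<in> E\<^sup>*} = {s \<in> ?S. grp s \<in> {g. g < m \<and> \<beta> g = t}}"
      using reach grp by auto
    then show ?thesis using card_groups[of "{g. g < m \<and> \<beta> g = t}"] by (auto simp: load_def)
  qed
  have b_le: "b g ^ 2 \<le> B" if "g < m" for g
  proof -
    have "(\<Sum>h\<in>{g}. b h ^ 2) \<le> (\<Sum>h | h < m \<and> \<beta> h = \<beta> g. b h ^ 2)" using that by (intro sum_mono2) auto
    then show ?thesis using load[OF \<beta>[OF that]] by simp
  qed
  have "topology I V E"
    unfolding topology_def using forest layer leaves roots \<beta>
    by (auto simp: rk_def num_layers_def caps V_def sinks)
  moreover have "load I E v \<le> capacities I ! layer V E v" if "v \<in> V" for v
    unfolding layer[OF that] using that load_source load_steiner load_sink b_le load \<beta>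
    by (auto simp: V_def rk_def caps)
  ultimately have "valid_topology I V E" by (auto simp: valid_topology_def)
  moreover have "embedding I pos" by (auto simp: embedding_def pos_def)
  moreover have "layout_cost I E pos \<le> (\<Sum>g<m. real (b g))"
  proof -
    have disj: "E1 \<inter> E2 = {}" by (auto simp: E1_def E2_def)
    have "layout_cost I E pos = (\<Sum>(u, v)\<in>E1. norm (pos u - pos v) * real (load I E u) powr alpha I) +
        (\<Sum>(u, v)\<in>E2. norm (pos u - pos v) * real (load I E u) powr alpha I)"
      unfolding layout_cost_def by (subst E_def, rule sum.union_disjoint) (use fin disj in \<open>auto simp: E1_def E2_def\<close>)
    also have "(\<Sum>(u, v)\<in>E1. norm (pos u - pos v) * real (load I E u) powr alpha I) = 0"
      using source_pos by (auto simp: E1_def pos_def intro!: sum.neutral)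
    also have "(\<Sum>(u, v)\<in>E2. norm (pos u - pos v) * real (load I E u) powr alpha I) =
        (\<Sum>g<m. norm (P g - sink_pos I (\<beta> g)) * real (load I E (Steiner g)) powr alpha I)"
      unfolding E2_def by (subst sum.reindex) (auto simp: inj_on_def pos_def)
    also have "\<dots> = (\<Sum>g<m. real (b g))"
      by (intro sum.cong) (auto simp: load_steiner sink_pos \<beta> norm_P alpha powr_half_sqrt)
    finally show ?thesis by simp
  qed
  ultimately show ?thesis unfolding has_layout_of_cost_def by blast
qed

text \<open>The cost is distributed over the parents of sources and compared with the charges. The
  charges sum up to the cost bound, so every parent attains equality in \<open>node_cost\<close> and
  carries one whole group; the root above it is the bin of that group.\<close>

lemma layout_imp_packing:
  assumes "has_layout_of_cost I (\<Sum>g<m. real (b g))"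
  shows "\<exists>\<beta>. (\<forall>g<m. \<beta> g < nb) \<and> (\<forall>t<nb. (\<Sum>g | g < m \<and> \<beta> g = t. b g ^ 2) \<le> B)"
proof -
  let ?S = "sources I"
  obtain V E pos where valid: "valid_topology I V E" and emb: "embedding I pos"
    and cost: "layout_cost I E pos \<le> (\<Sum>g<m. real (b g))"
    using assms by (auto simp: has_layout_of_cost_def)
  have top: "topology I V E" and cap: "\<And>v. v \<in> V \<Longrightarrow> load I E v \<le> [B, B, 1] ! layer V E v"
    using valid by (auto simp: valid_topology_def caps)
  have forest: "rooted_forest V E" and leaves: "leaves V E = Source ` ?S" and roots: "roots V E \<subseteq> Sink ` {..<nb}"
    and inner: "V - leaves V E - roots V E \<subseteq> range Steiner" and lay: "\<And>v. v \<in> V \<Longrightarrow> layer V E v \<le> 2"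
    using top by (auto simp: topology_def sinks num_layers_def caps)
  have EV: "E \<subseteq> V \<times> V" and sv: "single_valued E" and finE: "finite E"
    using forest by (auto simp: rooted_forest_def intro: finite_subset)
  have "\<exists>w. (Source s, w) \<in> E" if "s \<in> ?S" for s
  proof -
    have "Source s \<in> V" using that leaves by (auto simp: leaves_def)
    moreover have "Source s \<notin> roots V E" using roots by auto
    ultimately show ?thesis by (auto simp: roots_def)
  qed
  then obtain par where par: "\<And>s. s \<in> ?S \<Longrightarrow> (Source s, par s) \<in> E" by metis
  \<comment> \<open>Sources lie in layer at most 2, so a parent that is not a root lies in layer 1,
    directly below a root.\<close>
  have down: "par s \<in> roots V E \<or> (par s \<in> range Steiner \<and> (\<exists>r\<in>roots V E. (par s, r) \<in> E))" if s: "s \<in> ?S" for s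
  proof (cases "par s \<in> roots V E")
    case False
    have w: "par s \<in> V" "par s \<notin> leaves V E" using par[OF s] EV by (auto simp: leaves_def)
    then have "par s \<in> range Steiner" using False inner by auto
    obtain r where r: "r \<in> roots V E" "(par s, r) \<in> E ^^ layer V E (par s)"
      using rooted_forest_path[OF forest w(1)] by blast
    have "(Source s, r) \<in> E ^^ Suc (layer V E (par s))" using par[OF s] r(2) by (meson relpow_Suc_I2)
    from layer_eq[OF sv r(1) this] have "layer V E (par s) \<le> 1"
      using lay[of "Source s"] s leaves by (auto simp: leaves_def)
    moreover have "layer V E (par s) \<noteq> 0" using r False by (intro notI) auto
    ultimately have "layer V E (par s) = 1" by simp
    then have "(par s, r) \<in> E" using r(2) by simp
    then show ?thesis using \<open>par s \<in> range Steiner\<close> r(1) by blast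
  qed simp
  have pos_root: "pos r = 0" if "r \<in> roots V E" for r
    using that roots emb sink_pos by (auto simp: embedding_def sinks)
  have pos_source: "pos (Source s) = P (grp s)" if "s \<in> ?S" for s
    using that emb source_pos by (auto simp: embedding_def)
  define ch where "ch w = {s \<in> ?S. par s = w}" for w
  have fin_ch: "finite (ch w)" for w using fin by (simp add: ch_def)
  define c where "c = (\<lambda>(u, v). norm (pos u - pos v) * real (load I E u) powr alpha I)"
  have load_ch: "card (ch w) \<le> load I E w" for w
    unfolding load_def using fin par by (intro card_mono) (auto simp: ch_def)
  have load_source: "1 \<le> load I E (Source s)" if "s \<in> ?S" for s
  proof -
    have "card {s} \<le> load I E (Source s)" unfolding load_def using fin that by (intro card_mono) auto
    then show ?thesis by simp
  qed
  define X where "X = par ` ?S"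
  define up where "up w = (SOME r. r \<in> roots V E \<and> (w, r) \<in> E)" for w
  have up: "up w \<in> roots V E \<and> (w, up w) \<in> E" if "w \<in> X - roots V E" for w
    unfolding up_def by (rule someI_ex) (use that down in \<open>auto simp: X_def\<close>)
  have finX: "finite X" using fin by (simp add: X_def)
  have source_cost: "norm (P (grp s) - pos (par s)) \<le> c (Source s, par s)" if "s \<in> ?S" for s
  proof -
    have "1 powr alpha I \<le> real (load I E (Source s)) powr alpha I"
      using load_source[OF that] by (intro powr_mono2) (auto simp: alpha)
    then show ?thesis using mult_left_mono[of 1 _ "norm (P (grp s) - pos (par s))"]
      by (simp add: c_def pos_source[OF that])
  qed
  have node_part: "norm (pos w) * sqrt (card (ch w)) \<le> c (w, up w)" if "w \<in> X - roots V E" for w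
  proof -
    have "sqrt (card (ch w)) \<le> real (load I E w) powr alpha I"
      using load_ch[of w] by (simp add: alpha powr_half_sqrt)
    then show ?thesis using up[OF that] by (auto simp: c_def pos_root intro!: mult_left_mono)
  qed
  have root_part: "norm (pos w) * sqrt (card (ch w)) = 0" if "w \<in> roots V E" for w
    using pos_root[OF that] by simp
  let ?E1 = "(\<lambda>s. (Source s, par s)) ` ?S" and ?E2 = "(\<lambda>w. (w, up w)) ` (X - roots V E)"
  have E12: "?E1 \<union> ?E2 \<subseteq> E" using par up by auto
  have "?E1 \<inter> ?E2 = {}" using down by (fastforce simp: X_def)
  then have "(\<Sum>s\<in>?S. c (Source s, par s)) + (\<Sum>w\<in>X - roots V E. c (w, up w)) = sum c (?E1 \<union> ?E2)"
    using fin finX by (subst sum.union_disjoint) (auto simp: sum.reindex inj_on_def)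
  also have "\<dots> \<le> sum c E"
    using E12 finE by (intro sum_mono2) (auto simp: c_def)
  also have "\<dots> \<le> (\<Sum>g<m. real (b g))"
    using cost by (simp add: layout_cost_def c_def)
  finally have total: "(\<Sum>s\<in>?S. c (Source s, par s)) + (\<Sum>w\<in>X - roots V E. c (w, up w)) \<le> (\<Sum>g<m. real (b g))" .
  \<comment> \<open>The share of vertex \<open>w\<close> in the cost, and the charge of its sources.
    A source may be attached directly to a root; as roots lie at the centre, the second summand is
    then 0 and \<open>node_cost\<close> still applies.\<close>
  define nc where "nc w = (\<Sum>s\<in>ch w. norm (P (grp s) - pos w)) + norm (pos w) * sqrt (card (ch w))" for w
  define cg where "cg w = (\<Sum>s\<in>ch w. 1 / real (b (grp s)))" for w
  have ch: "ch w \<subseteq> ?S" "w \<in> X \<Longrightarrow> ch w \<noteq> {}" for w by (auto simp: ch_def X_def)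
  have groupS: "(\<Sum>w\<in>X. \<Sum>s\<in>ch w. f s) = (\<Sum>s\<in>?S. f s)" for f :: "nat \<Rightarrow> real"
    unfolding ch_def using fin finX by (intro sum.group) (auto simp: X_def)
  have "(\<Sum>w\<in>X. nc w) = (\<Sum>w\<in>X. \<Sum>s\<in>ch w. norm (P (grp s) - pos (par s))) + (\<Sum>w\<in>X. norm (pos w) * sqrt (card (ch w)))"
    unfolding nc_def sum.distrib by (simp add: ch_def)
  also have "\<dots> = (\<Sum>s\<in>?S. norm (P (grp s) - pos (par s))) + (\<Sum>w\<in>X - roots V E. norm (pos w) * sqrt (card (ch w)))"
    unfolding groupS using finX root_part by (intro arg_cong2[of _ _ _ _ "(+)"] refl sum.mono_neutral_right) auto
  also have "\<dots> \<le> (\<Sum>s\<in>?S. c (Source s, par s)) + (\<Sum>w\<in>X - roots V E. c (w, up w))"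
    using source_cost node_part by (intro add_mono sum_mono) auto
  also note total
  also have "(\<Sum>g<m. real (b g)) = (\<Sum>w\<in>X. cg w)"
    unfolding total_charge[symmetric] cg_def groupS ..
  finally have le: "(\<Sum>w\<in>X. nc w) \<le> (\<Sum>w\<in>X. cg w)" .
  have ge: "cg w \<le> nc w" if "w \<in> X" for w
    unfolding cg_def nc_def using node_cost(1)[OF ch(1) ch(2)[OF that]] .
  have eq: "cg w = nc w" if "w \<in> X" for w
  proof (rule sum_mono_inv[of cg X nc w])
    show "sum cg X = sum nc X" using le sum_mono[OF ge] by (intro antisym) auto
  qed (use ge that finX in auto)
  have whole: "ch (par s) = {s' \<in> ?S. grp s' = grp s}" if s: "s \<in> ?S" for s
  proof -
    have "par s \<in> X" using s by (simp add: X_def)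
    from node_cost(2)[OF ch(1) ch(2)[OF this]] eq[OF this]
    obtain g where g: "ch (par s) = {s' \<in> ?S. grp s' = g}" unfolding cg_def nc_def by blast
    moreover have "s \<in> ch (par s)" using s by (simp add: ch_def)
    ultimately show ?thesis by auto
  qed
  obtain rep where rep: "\<And>g. g < m \<Longrightarrow> rep g \<in> ?S \<and> grp (rep g) = g" using group_nonempty by metis
  have "\<exists>t<nb. Sink t \<in> roots V E \<and> (par (rep g), Sink t) \<in> E\<^sup>*" if g: "g < m" for g
  proof -
    obtain r where r: "r \<in> roots V E" "(par (rep g), r) \<in> E\<^sup>*"
      using down[of "rep g"] rep[OF g] by auto
    moreover obtain t where "t < nb" "r = Sink t" using r(1) roots by auto
    ultimately show ?thesis by auto
  qed
  then obtain \<beta> where \<beta>: "\<And>g. g < m \<Longrightarrow> \<beta> g < nb \<and> Sink (\<beta> g) \<in> roots V E \<and> (par (rep g), Sink (\<beta> g)) \<in> E\<^sup>*"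
    by metis
  \<comment> \<open>All sources of a group share one parent, so they reach the sink chosen for their
    representative.\<close>
  have reach: "(Source s, Sink (\<beta> (grp s))) \<in> E\<^sup>*" if s: "s \<in> ?S" for s
  proof -
    have "rep (grp s) \<in> ch (par s)" using whole[OF s] rep[OF grp[OF s]] by auto
    then have "par (rep (grp s)) = par s" by (simp add: ch_def)
    then show ?thesis using par[OF s] \<beta>[OF grp[OF s]] by (metis converse_rtrancl_into_rtrancl)
  qed
  have "(\<Sum>g | g < m \<and> \<beta> g = t. b g ^ 2) \<le> B" if "t < nb" for t
  proof (cases "\<exists>g<m. \<beta> g = t")
    case True
    then have r: "Sink t \<in> roots V E" using \<beta> by auto
    have "(\<Sum>g | g < m \<and> \<beta> g = t. b g ^ 2) = card {s \<in> ?S. grp s \<in> {g. g < m \<and> \<beta> g = t}}"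
      by (rule card_groups[symmetric]) auto
    also have "\<dots> \<le> load I E (Sink t)"
      unfolding load_def using reach fin by (intro card_mono) auto
    also have "\<dots> \<le> B"
      using cap[of "Sink t"] layer_eq[OF sv r, of "Sink t" 0] r by (auto simp: roots_def)
    finally show ?thesis .
  next
    case False
    then have e: "{g. g < m \<and> \<beta> g = t} = {}" by auto
    show ?thesis unfolding e by simp
  qed
  then show ?thesis using \<beta> by blast
qed

end

section \<open>Exact cover as bin packing\<close>

definition exact_cover :: "nat \<Rightarrow> nat \<Rightarrow> nat \<Rightarrow> (nat \<Rightarrow> nat \<Rightarrow> nat) \<Rightarrow> bool" where
  "exact_cover F n r S \<longleftrightarrow> (\<exists>A\<subseteq>{..<F}. \<forall>s<r. \<forall>e<n. \<exists>!f. f \<in> A \<and> S f s = e)"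

text \<open>Frame \<open>f\<close> consists of the elements \<open>S f 0, \<dots>, S f (r - 1)\<close>. It contributes \<open>r + 1\<close> items: item \<open>(f, 0)\<close> stands for
  the frame, item \<open>(f, s + 1)\<close> is a copy of element \<open>S f s\<close>, called fresh if it is the first one of this element.
  A bin holds one frame and, for each \<open>s\<close>, one copy of its element in slot \<open>s\<close>; the copies are all fresh if the
  frame is chosen and all stale otherwise. The digits of the weight of an item enforce this: the first \<open>r\<close> digits
  identify the elements, digit \<open>r\<close> counts stale copies (a fresh copy in slot 0 counts for the \<open>r - 1\<close> others), and
  the last \<open>r + 1\<close> digits make the items of a bin belong to different slots.\<close>

definition fresh :: "(nat \<Rightarrow> nat \<Rightarrow> nat) \<Rightarrow> nat \<Rightarrow> nat \<Rightarrow> bool" where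
  "fresh S f s \<longleftrightarrow> (\<forall>f'<f. \<not> S f' s = S f s)"

definition flag :: "nat \<Rightarrow> (nat \<Rightarrow> nat \<Rightarrow> nat) \<Rightarrow> nat \<Rightarrow> nat \<Rightarrow> nat" where
  "flag r S f s = (if s = 0 then if fresh S f s then r - 1 else 0 else if fresh S f s then 0 else 1)"

definition digit :: "nat \<Rightarrow> nat \<Rightarrow> (nat \<Rightarrow> nat \<Rightarrow> nat) \<Rightarrow> nat \<Rightarrow> nat \<Rightarrow> nat \<Rightarrow> nat" where
  "digit n r S f k l =
     (if l < r then if k = 0 then n - S f l else if k = l + 1 then S f l else 0
      else if l = r then if k = 0 then 0 else flag r S f (k - 1)
      else if l = r + 1 + k then 1 else 0)"

definition target :: "nat \<Rightarrow> nat \<Rightarrow> nat \<Rightarrow> nat" where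
  "target n r l = (if l < r then n else if l = r then r - 1 else 1)"

text \<open>Exceeds \<open>(r + 1) * (n + r)\<close>, the largest possible sum of one digit over
  \<open>r + 1\<close> items, so that no carries occur within a bin.\<close>

definition radix :: "nat \<Rightarrow> nat \<Rightarrow> nat" where
  "radix n r = (r + 1) * (n + r + 1) + 1"

definition weight :: "nat \<Rightarrow> nat \<Rightarrow> (nat \<Rightarrow> nat \<Rightarrow> nat) \<Rightarrow> nat \<Rightarrow> nat \<Rightarrow> nat" where
  "weight n r S f k = (\<Sum>l<2 * r + 2. digit n r S f k l * radix n r ^ l)"

definition goal_weight :: "nat \<Rightarrow> nat \<Rightarrow> nat" where
  "goal_weight n r = (\<Sum>l<2 * r + 2. target n r l * radix n r ^ l)"

lemma digits_unique:
  fixes b :: nat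
  assumes "\<And>l. l < k \<Longrightarrow> u l < b" "\<And>l. l < k \<Longrightarrow> w l < b"
    and "(\<Sum>l<k. u l * b ^ l) = (\<Sum>l<k. w l * b ^ l)" "l < k"
  shows "u l = w l"
  using assms
proof (induction k arbitrary: u w l)
  case (Suc k)
  have shift: "(\<Sum>l<Suc k. u l * b ^ l) = u 0 + b * (\<Sum>l<k. u (Suc l) * b ^ l)" for u
    by (simp add: sum.lessThan_Suc_shift sum_distrib_left mult_ac del: sum.lessThan_Suc)
  have e: "u 0 + b * (\<Sum>l<k. u (Suc l) * b ^ l) = w 0 + b * (\<Sum>l<k. w (Suc l) * b ^ l)"
    using Suc.prems(3) unfolding shift .
  have b: "u 0 < b" "w 0 < b" using Suc.prems(1,2) by auto
  have "u 0 = (u 0 + b * (\<Sum>l<k. u (Suc l) * b ^ l)) mod b" using b by simp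
  also have "\<dots> = w 0" unfolding e using b by simp
  finally have 0: "u 0 = w 0" .
  then have "(\<Sum>l<k. u (Suc l) * b ^ l) = (\<Sum>l<k. w (Suc l) * b ^ l)" using e b by simp
  then have "u (Suc l') = w (Suc l')" if "l' < k" for l'
    using Suc.IH[of "\<lambda>l. u (Suc l)" "\<lambda>l. w (Suc l)" l'] Suc.prems(1,2) that by simp
  then show ?case using 0 Suc.prems(4) by (cases l) auto
qed simp

locale matching =
  fixes F n r :: nat and S :: "nat \<Rightarrow> nat \<Rightarrow> nat"
  assumes S: "\<And>f s. f < F \<Longrightarrow> s < r \<Longrightarrow> S f s < n"
    and occurs: "\<And>s e. s < r \<Longrightarrow> e < n \<Longrightarrow> \<exists>f<F. S f s = e"
    and r: "2 \<le> r" and F: "0 < F"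
begin

abbreviation "dg \<equiv> digit n r S"
abbreviation "tg \<equiv> target n r"
abbreviation "wt \<equiv> weight n r S"
abbreviation "X \<equiv> goal_weight n r"
abbreviation "items \<equiv> {..<F} \<times> {..r}"

definition first :: "nat \<Rightarrow> nat \<Rightarrow> nat" where
  "first s e = (LEAST f. S f s = e)"

lemma first:
  assumes "s < r" "e < n"
  shows "first s e < F" "S (first s e) s = e" "fresh S (first s e) s"
proof -
  obtain f where f: "f < F" "S f s = e" using occurs assms by blast
  show e: "S (first s e) s = e" unfolding first_def by (rule LeastI) (rule f(2))
  show "fresh S (first s e) s"
    unfolding fresh_def e
  proof (intro allI impI)
    fix f' assume "f' < first s e"
    then show "S f' s \<noteq> e" unfolding first_def by (rule not_less_Least)
  qed
  have "first s e \<le> f" unfolding first_def using f(2) by (rule Least_le)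
  then show "first s e < F" using f(1) by simp
qed

lemma fresh_first: "s < r \<Longrightarrow> f < F \<Longrightarrow> fresh S f s \<Longrightarrow> first s (S f s) = f"
proof (rule ccontr)
  assume a: "s < r" "f < F" "fresh S f s" and ne: "first s (S f s) \<noteq> f"
  note fi = first[OF a(1) S[OF a(2,1)]]
  from ne consider "first s (S f s) < f" | "f < first s (S f s)" by linarith
  then show False
    by cases (use a(3) fi(2,3) in \<open>auto simp: fresh_def\<close>)
qed

text \<open>Each element occurs in slot \<open>s\<close> and its first occurrence is the only fresh
  one, so fresh copies correspond to elements.\<close>

lemma card_fresh: "s < r \<Longrightarrow> card {f. f < F \<and> fresh S f s} = n"
proof -
  assume s: "s < r"
  have "bij_betw (first s) {..<n} {f. f < F \<and> fresh S f s}"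
    by (rule bij_betw_byWitness[where f' = "\<lambda>f. S f s"]) (use s S first fresh_first in auto)
  then show ?thesis using bij_betw_same_card by fastforce
qed

lemma n_le_F: "n \<le> F"
proof -
  have "card {f. f < F \<and> fresh S f 0} \<le> card {..<F}" by (intro card_mono) auto
  then show ?thesis using card_fresh[of 0] r by simp
qed

text \<open>The items match \<open>F\<close> full bins in every digit. For digit \<open>r\<close>
  this explains the weight \<open>r - 1\<close> of a fresh copy in slot 0: slot 0 contributes
  \<open>n * (r - 1)\<close> and each of the \<open>r - 1\<close> other slots its
  \<open>F - n\<close> stale copies, in total \<open>F * (r - 1)\<close> regardless of
  \<open>n\<close>.\<close>

lemma sum_digit:
  assumes l: "l < 2 * r + 2"
  shows "(\<Sum>(f, k)\<in>items. dg f k l) = F * tg l"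
proof -
  have "(\<Sum>(f, k)\<in>items. dg f k l) = (\<Sum>f<F. \<Sum>k\<le>r. dg f k l)" by (simp add: sum.cartesian_product)
  also have "\<dots> = F * tg l"
  proof -
    consider "l < r" | "l = r" | "l > r" by linarith
    then show ?thesis
    proof cases
      case 1
      have "(\<Sum>k\<le>r. dg f k l) = n" if "f < F" for f
      proof -
        have "(\<Sum>k\<le>r. dg f k l) = n - S f l + (\<Sum>k<r. if k = l then S f l else 0)"
          using 1 by (simp add: sum.atMost_shift digit_def)
        also have "\<dots> = n" using 1 S[OF that 1] by simp
        finally show ?thesis .
      qed
      then show ?thesis using 1 by (simp add: target_def)
    next
      case 2
      have "(\<Sum>f<F. \<Sum>k\<le>r. dg f k l) = (\<Sum>f<F. \<Sum>s<r. flag r S f s)"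
        using 2 by (simp add: sum.atMost_shift digit_def)
      also have "\<dots> = (\<Sum>s<r. \<Sum>f<F. flag r S f s)" by (rule sum.swap)
      also have "\<dots> = (\<Sum>s<r. if s = 0 then n * (r - 1) else F - n)"
      proof (rule sum.cong[OF refl])
        fix s assume "s \<in> {..<r}"
        then have s: "s < r" by simp
        have c: "card ({..<F} \<inter> {f. fresh S f s}) = n"
          using card_fresh[OF s] by (simp add: lessThan_def Collect_conj_eq)
        have "card ({..<F} \<inter> - {f. fresh S f s}) = F - n"
          using card_Diff_subset_Int[of "{..<F}" "{f. fresh S f s}"] c by (simp add: Diff_eq)
        then show "(\<Sum>f<F. flag r S f s) = (if s = 0 then n * (r - 1) else F - n)"
          using c by (auto simp: flag_def sum.If_cases)
      qed
      also have "\<dots> = n * (r - 1) + (r - 1) * (F - n)"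
      proof -
        obtain r' where r': "r = Suc r'" using r by (cases r) auto
        show ?thesis unfolding r' by (simp add: sum.lessThan_Suc_shift del: sum.lessThan_Suc)
      qed
      also have "\<dots> = (r - 1) * (n + (F - n))" by (simp only: add_mult_distrib2 mult.commute)
      also have "\<dots> = F * (r - 1)" using n_le_F by simp
      finally show ?thesis using 2 by (simp add: target_def)
    next
      case 3
      have "(\<Sum>k\<le>r. dg f k l) = (\<Sum>k\<le>r. if k = l - r - 1 then 1 else 0)" for f
        using 3 by (intro sum.cong) (auto simp: digit_def)
      also have "\<dots> = 1" using 3 l by simp
      finally show ?thesis using 3 by (simp add: target_def)
    qed
  qed
  finally show ?thesis .
qed

lemma sum_weight: "(\<Sum>(f, k)\<in>items. wt f k) = F * X"
proof -
  have "(\<Sum>(f, k)\<in>items. wt f k) = (\<Sum>l<2 * r + 2. (\<Sum>(f, k)\<in>items. dg f k l) * radix n r ^ l)"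
    unfolding weight_def case_prod_unfold sum_distrib_right by (rule sum.swap)
  then show ?thesis unfolding goal_weight_def sum_distrib_left
    by (simp add: sum_digit mult.assoc)
qed

lemma digit_le: "f < F \<Longrightarrow> k \<le> r \<Longrightarrow> dg f k l \<le> n + r"
  using S[of f l] r by (auto simp: digit_def flag_def)

lemma target_less: "tg l < radix n r"
  using r by (auto simp: target_def radix_def)

lemma bin_sum:
  assumes "\<And>k. k \<le> r \<Longrightarrow> \<phi> k < F" "\<And>f k. f < F \<Longrightarrow> k \<le> r \<Longrightarrow> \<beta> f k = t \<longleftrightarrow> f = \<phi> k"
  shows "(\<Sum>(f, k) | (f, k) \<in> items \<and> \<beta> f k = t. h f k) = (\<Sum>k\<le>r. h (\<phi> k) k)"
proof -
  have "{(f, k). (f, k) \<in> items \<and> \<beta> f k = t} = (\<lambda>k. (\<phi> k, k)) ` {..r}" using assms by auto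
  then show ?thesis by (simp add: sum.reindex inj_on_def)
qed

lemma cover_imp_bins:
  assumes "exact_cover F n r S"
  shows "\<exists>\<beta>. (\<forall>f<F. \<forall>k\<le>r. \<beta> f k < F) \<and>
    (\<forall>t<F. \<forall>l<2 * r + 2. (\<Sum>(f, k) | (f, k) \<in> items \<and> \<beta> f k = t. dg f k l) = tg l)"
proof -
  obtain A where A: "A \<subseteq> {..<F}" "\<And>s e. s < r \<Longrightarrow> e < n \<Longrightarrow> \<exists>!f. f \<in> A \<and> S f s = e"
    using assms by (auto simp: exact_cover_def)
  define inA where "inA s e = (THE f. f \<in> A \<and> S f s = e)" for s e
  have inA: "inA s e \<in> A" "S (inA s e) s = e" if "s < r" "e < n" for s e
    using theI'[OF A(2)[OF that]] by (auto simp: inA_def)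
  have inA_eq: "inA s (S f s) = f" if "s < r" "f \<in> A" for s f
    using A(2)[of s "S f s"] inA[of s "S f s"] that A(1) S by blast
  \<comment> \<open>In every slot, a chosen frame trades its copy for the fresh copy of the same
    element. \<open>\<pi> s\<close> is an involution because the element occurs in exactly one
    chosen frame and has exactly one fresh copy; a chosen frame that already holds the fresh copy is
    a fixed point.\<close>
  define \<pi> where "\<pi> s f = (if f \<in> A then first s (S f s) else if fresh S f s then inA s (S f s) else f)" for s f
  have less: "\<pi> s f < F" and same: "S (\<pi> s f) s = S f s" if "s < r" "f < F" for s f
    using that S[of f s] first[of s "S f s"] inA[of s "S f s"] A(1) by (auto simp: \<pi>_def)
  have inv: "\<pi> s (\<pi> s f) = f" if "s < r" "f < F" for s f
  proof -
    have e: "S f s < n" using S that by blast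
    note fi = first[OF that(1) e] and ia = inA[OF that(1) e]
    consider "f \<in> A" "first s (S f s) \<in> A" | "f \<in> A" "first s (S f s) \<notin> A"
      | "f \<notin> A" "fresh S f s" | "f \<notin> A" "\<not> fresh S f s" by blast
    then show ?thesis
    proof cases
      case 1
      then have "first s (S f s) = f" using inA_eq[OF that(1)] fi(2) by metis
      then show ?thesis using 1 by (simp add: \<pi>_def)
    next
      case 2
      then show ?thesis using inA_eq[OF that(1) 2(1)] fi by (simp add: \<pi>_def)
    next
      case 3
      then show ?thesis using fresh_first[OF that 3(2)] ia by (simp add: \<pi>_def)
    next
      case 4
      then show ?thesis by (simp add: \<pi>_def)
    qed
  qed
  have fr: "fresh S (\<pi> s f) s \<longleftrightarrow> f \<in> A" if "s < r" "f < F" for s f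
  proof (cases "f \<in> A \<or> \<not> fresh S f s")
    case True
    then show ?thesis using that S[of f s] first[of s "S f s"] by (auto simp: \<pi>_def)
  next
    case False
    then have p: "\<pi> s f = inA s (S f s)" by (simp add: \<pi>_def)
    have "inA s (S f s) < F" "S (inA s (S f s)) s = S f s" "inA s (S f s) \<in> A"
      using inA[of s "S f s"] that S A(1) by auto
    then show ?thesis using False that fresh_first[of s "inA s (S f s)"] fresh_first[of s f] p by metis
  qed
  define \<beta> where "\<beta> f k = (if k = 0 then f else \<pi> (k - 1) f)" for f k
  have "(\<Sum>(f, k) | (f, k) \<in> items \<and> \<beta> f k = t. dg f k l) = tg l" if t: "t < F" and l: "l < 2 * r + 2" for t l
  proof -
    have \<beta>2: "\<beta> f k = t \<longleftrightarrow> f = \<beta> t k" if "f < F" "k \<le> r" for f k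
      using that t inv[of "k - 1" f] inv[of "k - 1" t] by (auto simp: \<beta>_def)
    have "\<beta> t k < F" if "k \<le> r" for k using that t less[of "k - 1" t] by (auto simp: \<beta>_def)
    then have "(\<Sum>(f, k) | (f, k) \<in> items \<and> \<beta> f k = t. dg f k l) = (\<Sum>k\<le>r. dg (\<beta> t k) k l)"
      using \<beta>2 by (intro bin_sum) auto
    also have "\<dots> = dg t 0 l + (\<Sum>s<r. dg (\<pi> s t) (Suc s) l)"
      by (simp add: sum.atMost_shift \<beta>_def)
    also have "\<dots> = tg l"
    proof -
      consider "l < r" | "l = r" | "l > r" by linarith
      then show ?thesis
      proof cases
        case 1
        then have "(\<Sum>s<r. dg (\<pi> s t) (Suc s) l) = (\<Sum>s<r. if s = l then S t l else 0)"
          using same t by (intro sum.cong) (auto simp: digit_def)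
        then show ?thesis using 1 S[OF t 1] by (simp add: digit_def target_def)
      next
        case 2
        obtain r' where r': "r = Suc r'" using r by (cases r) auto
        have "(\<Sum>s<r. dg (\<pi> s t) (Suc s) l) = (\<Sum>s<r. if s = 0 then if t \<in> A then r - 1 else 0 else if t \<in> A then 0 else 1)"
          using 2 t fr by (intro sum.cong) (auto simp: digit_def flag_def)
        also have "\<dots> = r - 1" unfolding r' by (simp add: sum.lessThan_Suc_shift del: sum.lessThan_Suc)
        finally show ?thesis using 2 by (simp add: digit_def target_def)
      next
        case 3
        show ?thesis
        proof (cases "l = r + 1")
          case True
          then show ?thesis by (simp add: digit_def target_def)
        next
          case False
          have "(\<Sum>s<r. dg (\<pi> s t) (Suc s) l) = (\<Sum>s<r. if s = l - r - 2 then 1 else 0)"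
            using 3 False by (intro sum.cong) (auto simp: digit_def)
          then show ?thesis using 3 False l by (simp add: digit_def target_def)
        qed
      qed
    qed
    finally show ?thesis .
  qed
  moreover have "\<beta> f k < F" if "f < F" "k \<le> r" for f k
    using that less[of "k - 1" f] by (auto simp: \<beta>_def)
  ultimately show ?thesis by blast
qed

text \<open>The slot digits give each bin exactly one item of every kind \<open>k\<close>, the
  identity digits make the copies match the frame, and digit \<open>r\<close> makes them all fresh
  or all stale. The frames of the fresh bins form the cover.\<close>

lemma bins_imp_cover:
  assumes \<beta>: "\<And>f k. f < F \<Longrightarrow> k \<le> r \<Longrightarrow> \<beta> f k < F"
    and bins: "\<And>t l. t < F \<Longrightarrow> l < 2 * r + 2 \<Longrightarrow> (\<Sum>(f, k) | (f, k) \<in> items \<and> \<beta> f k = t. dg f k l) = tg l"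
  shows "exact_cover F n r S"
proof -
  have "\<exists>!f. f < F \<and> \<beta> f k = t" if t: "t < F" and k: "k \<le> r" for t k
  proof -
    let ?B = "{(f, k). (f, k) \<in> items \<and> \<beta> f k = t}"
    have fin: "finite ?B" by (rule finite_subset[of _ items]) auto
    have "(\<Sum>(f, k')\<in>?B. dg f k' (r + 1 + k)) = (\<Sum>fk\<in>?B. if snd fk = k then 1 else 0)"
      by (intro sum.cong) (auto simp: digit_def)
    also have "\<dots> = card {fk \<in> ?B. snd fk = k}"
      by (simp only: card_eq_sum sum.inter_filter[OF fin])
    also have "{fk \<in> ?B. snd fk = k} = (\<lambda>f. (f, k)) ` {f. f < F \<and> \<beta> f k = t}" using k by auto
    also have "card \<dots> = card {f. f < F \<and> \<beta> f k = t}" by (intro card_image) (auto simp: inj_on_def)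
    finally have "card {f. f < F \<and> \<beta> f k = t} = 1"
      using bins[OF t, of "r + 1 + k"] k by (simp add: target_def)
    then obtain f where "{f. f < F \<and> \<beta> f k = t} = {f}" by (auto simp: card_1_singleton_iff)
    then have "f' < F \<and> \<beta> f' k = t \<longleftrightarrow> f' = f" for f' by blast
    then show ?thesis by simp
  qed
  note ex1 = this
  define \<phi> where "\<phi> t k = (THE f. f < F \<and> \<beta> f k = t)" for t k
  have \<phi>: "\<phi> t k < F \<and> \<beta> (\<phi> t k) k = t" if "t < F" "k \<le> r" for t k
    unfolding \<phi>_def by (rule theI'[OF ex1[OF that]])
  have \<phi>_unique: "f = \<phi> t k" if "t < F" "k \<le> r" "f < F" "\<beta> f k = t" for t k f
    using ex1[OF that(1,2)] \<phi>[OF that(1,2)] that(3,4) by blast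
  have dsum: "dg (\<phi> t 0) 0 l + (\<Sum>s<r. dg (\<phi> t (Suc s)) (Suc s) l) = tg l" if "t < F" "l < 2 * r + 2" for t l
  proof -
    have "(\<Sum>(f, k) | (f, k) \<in> items \<and> \<beta> f k = t. dg f k l) = (\<Sum>k\<le>r. dg (\<phi> t k) k l)"
      using \<phi>[OF that(1)] \<phi>_unique[OF that(1)] by (intro bin_sum) metis+
    then show ?thesis using bins[OF that] by (simp add: sum.atMost_shift)
  qed
  \<comment> \<open>Digit \<open>s\<close> of the bin reads
    \<open>n - S (\<phi> t 0) s + S (\<phi> t (Suc s)) s = n\<close>, where the subtraction is not
    truncated.\<close>
  have ids: "S (\<phi> t (Suc s)) s = S (\<phi> t 0) s" if t: "t < F" and s: "s < r" for t s
  proof -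
    have "(\<Sum>s'<r. dg (\<phi> t (Suc s')) (Suc s') s) = (\<Sum>s'<r. if s' = s then S (\<phi> t (Suc s)) s else 0)"
      using s by (intro sum.cong) (auto simp: digit_def)
    then show ?thesis using dsum[OF t, of s] s S[of "\<phi> t 0" s] \<phi>[OF t, of 0]
      by (simp add: digit_def target_def)
  qed
  have flags: "fresh S (\<phi> t (Suc s)) s \<longleftrightarrow> fresh S (\<phi> t 1) 0" if t: "t < F" and s: "s < r" for t s
  proof -
    obtain r' where r': "r = Suc r'" using r by (cases r) auto
    have "(\<Sum>s<r. flag r S (\<phi> t (Suc s)) s) = r - 1"
      using dsum[OF t, of r] by (simp add: digit_def target_def)
    \<comment> \<open>Here \<open>r' = r - 1\<close>. A fresh copy in slot 0 already reaches the
      target, so no stale copy fits; a stale one contributes 0, so all \<open>r'\<close> other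
      copies must be stale.\<close>
    then have sum: "(if fresh S (\<phi> t 1) 0 then r' else 0) + (\<Sum>s<r'. if fresh S (\<phi> t (Suc (Suc s))) (Suc s) then 0 else 1) = r'"
      unfolding r' by (cases "fresh S (\<phi> t 1) 0") (simp_all add: sum.lessThan_Suc_shift flag_def del: sum.lessThan_Suc)
    show ?thesis
    proof (cases s)
      case (Suc s')
      show ?thesis
      proof (cases "fresh S (\<phi> t 1) 0")
        case True
        then have "(\<Sum>s<r'. if fresh S (\<phi> t (Suc (Suc s))) (Suc s) then 0 else 1 :: nat) = 0" using sum by simp
        then have "(if fresh S (\<phi> t (Suc (Suc s'))) (Suc s') then 0 else 1 :: nat) = 0" using Suc s r' by simp
        then have "fresh S (\<phi> t (Suc (Suc s'))) (Suc s')" by (metis zero_neq_one)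
        then show ?thesis using True unfolding Suc by blast
      next
        case False
        then have e: "(\<Sum>s<r'. if fresh S (\<phi> t (Suc (Suc s))) (Suc s) then 0 else 1 :: nat) = (\<Sum>s<r'. 1)" using sum by simp
        have s': "s' \<in> {..<r'}" using Suc s r' by simp
        have "(if fresh S (\<phi> t (Suc (Suc s'))) (Suc s') then 0 else 1 :: nat) = 1"
          by (rule sum_mono_inv[OF e _ s']) simp_all
        then have "\<not> fresh S (\<phi> t (Suc (Suc s'))) (Suc s')" by (metis zero_neq_one)
        then show ?thesis using False unfolding Suc by blast
      qed
    qed simp
  qed
  \<comment> \<open>An element has one fresh copy in slot \<open>s\<close>, this copy lies in one
    bin, and that bin holds one frame: the element is covered exactly once.\<close>
  define A where "A = {\<phi> t 0 |t. t < F \<and> fresh S (\<phi> t 1) 0}"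
  have "\<exists>!f. f \<in> A \<and> S f s = e" if s: "s < r" and e: "e < n" for s e
  proof -
    define t where "t = \<beta> (first s e) (Suc s)"
    have t: "t < F" using \<beta> first[OF s e] s by (auto simp: t_def)
    have f: "first s e = \<phi> t (Suc s)" using \<phi>_unique[OF t, of "Suc s" "first s e"] first[OF s e] s by (simp add: t_def)
    have "\<phi> t 0 \<in> A \<and> S (\<phi> t 0) s = e"
      using t flags[OF t s] ids[OF t s] first[OF s e] by (auto simp: A_def f)
    moreover have "f' = \<phi> t 0" if f': "f' \<in> A" "S f' s = e" for f'
    proof -
      obtain t' where t': "t' < F" "f' = \<phi> t' 0" "fresh S (\<phi> t' 1) 0" using f'(1) by (auto simp: A_def)
      have "fresh S (\<phi> t' (Suc s)) s" "S (\<phi> t' (Suc s)) s = e" "\<phi> t' (Suc s) < F"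
        using flags[OF t'(1) s] ids[OF t'(1) s] t' f'(2) \<phi>[OF t'(1)] s by auto
      then have "\<phi> t' (Suc s) = \<phi> t (Suc s)" using fresh_first[OF s] f by metis
      moreover have "\<beta> (\<phi> t' (Suc s)) (Suc s) = t'" "\<beta> (\<phi> t (Suc s)) (Suc s) = t"
        using \<phi>[OF t'(1), of "Suc s"] \<phi>[OF t, of "Suc s"] s by simp_all
      ultimately have "t' = t" by metis
      then show ?thesis using t'(2) by simp
    qed
    ultimately show ?thesis by blast
  qed
  moreover have "A \<subseteq> {..<F}" using \<phi> by (auto simp: A_def)
  ultimately show ?thesis unfolding exact_cover_def by blast
qed

lemma sum_items:
  "(\<Sum>g | g < (r + 1) * F \<and> \<beta> (g div (r + 1)) (g mod (r + 1)) = t. h (g div (r + 1)) (g mod (r + 1))) =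
   (\<Sum>(f, k) | (f, k) \<in> items \<and> \<beta> f k = t. h f k)"
proof -
  let ?A = "{g. g < (r + 1) * F \<and> \<beta> (g div (r + 1)) (g mod (r + 1)) = t}"
  let ?B = "{(f, k). (f, k) \<in> items \<and> \<beta> f k = t}"
  let ?\<phi> = "\<lambda>g. (g div (r + 1), g mod (r + 1))"
  have "bij_betw ?\<phi> ?A ?B"
  proof (rule bij_betw_byWitness[where f' = "\<lambda>(f, k). f * (r + 1) + k"])
    have dm: "(f * (r + 1) + k) div (r + 1) = f" "(f * (r + 1) + k) mod (r + 1) = k" if "k \<le> r" for f k
      using that by (simp_all only: div_mult_self3 mod_mult_self3 div_less mod_less less_Suc_eq_le Suc_eq_plus1[symmetric])
    have less: "f * (r + 1) + k < (r + 1) * F" if "f < F" "k \<le> r" for f k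
    proof -
      have "f * (r + 1) + k < (f + 1) * (r + 1)" using that(2) by simp
      also have "\<dots> \<le> F * (r + 1)" using that(1) by (intro mult_le_mono1) simp
      finally show ?thesis by (simp only: mult.commute)
    qed
    show "\<forall>a\<in>?A. (case ?\<phi> a of (f, k) \<Rightarrow> f * (r + 1) + k) = a"
      by (simp only: prod.case div_mult_mod_eq) simp
    show "\<forall>a\<in>?B. ?\<phi> (case a of (f, k) \<Rightarrow> f * (r + 1) + k) = a"
    proof
      fix a assume "a \<in> ?B"
      then obtain f k where "a = (f, k)" "k \<le> r" by blast
      then show "?\<phi> (case a of (f, k) \<Rightarrow> f * (r + 1) + k) = a" by (simp only: prod.case dm)
    qed
    show "?\<phi> ` ?A \<subseteq> ?B"
    proof
      fix a assume "a \<in> ?\<phi> ` ?A"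
      then obtain g where g: "a = ?\<phi> g" "g < (r + 1) * F" "\<beta> (g div (r + 1)) (g mod (r + 1)) = t" by blast
      have "g div (r + 1) < F" using g(2) by (simp add: less_mult_imp_div_less mult.commute)
      moreover have "g mod (r + 1) \<le> r" using mod_less_divisor[of "r + 1" g] by linarith
      ultimately show "a \<in> ?B" using g(1,3) by blast
    qed
    show "(\<lambda>(f, k). f * (r + 1) + k) ` ?B \<subseteq> ?A"
    proof
      fix g assume "g \<in> (\<lambda>(f, k). f * (r + 1) + k) ` ?B"
      then obtain a where a: "a \<in> ?B" "g = (case a of (f, k) \<Rightarrow> f * (r + 1) + k)" by blast
      then obtain f k where "a = (f, k)" "f < F" "k \<le> r" "\<beta> f k = t" by blast
      moreover from this have "g = f * (r + 1) + k" using a(2) by (simp only: prod.case)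
      ultimately show "g \<in> ?A" using less dm by (simp only: mem_Collect_eq)
    qed
  qed
  from sum.reindex_bij_betw[OF this, of "\<lambda>(f, k). h f k"] show ?thesis by (simp only: prod.case)
qed

text \<open>\<open>M\<close> dominates everything else, so that \<open>(M + x)\<^sup>2 = M\<^sup>2 + 2 M x + x\<^sup>2\<close> acts as \<open>x\<close> in the second digit
  to base \<open>M\<close>.\<close>

lemma squares_packing:
  fixes m M pad :: nat
  defines "q \<equiv> r + 1"
  defines "sz g \<equiv> if g < q * F then M + wt (g div q) (g mod q) else pad"
  assumes m: "q * F \<le> m" and M: "X ^ 2 + m * pad ^ 2 + 2 * X + 2 \<le> M"
  shows "(\<exists>\<beta>. (\<forall>g<m. \<beta> g < F) \<and> (\<forall>t<F. (\<Sum>g | g < m \<and> \<beta> g = t. sz g ^ 2) \<le> q * M ^ 2 + 2 * M * X + 2 * M - 1)) \<longleftrightarrow>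
    exact_cover F n r S"
proof
  let ?x = "\<lambda>g. wt (g div q) (g mod q)"
  assume "\<exists>\<beta>. (\<forall>g<m. \<beta> g < F) \<and> (\<forall>t<F. (\<Sum>g | g < m \<and> \<beta> g = t. sz g ^ 2) \<le> q * M ^ 2 + 2 * M * X + 2 * M - 1)"
  then obtain \<beta> where \<beta>: "\<And>g. g < m \<Longrightarrow> \<beta> g < F"
    and le: "\<And>t. t < F \<Longrightarrow> (\<Sum>g | g < m \<and> \<beta> g = t. sz g ^ 2) \<le> q * M ^ 2 + 2 * M * X + 2 * M - 1" by blast
  define N where "N t = {g. g < q * F \<and> \<beta> g = t}" for t
  have finN: "finite (N t)" for t by (simp add: N_def)
  have leN: "(\<Sum>g\<in>N t. (M + ?x g) ^ 2) \<le> q * M ^ 2 + 2 * M * X + 2 * M - 1" if "t < F" for t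
  proof -
    have "(\<Sum>g\<in>N t. (M + ?x g) ^ 2) = (\<Sum>g\<in>N t. sz g ^ 2)" by (intro sum.cong) (auto simp: N_def sz_def)
    also have "\<dots> \<le> (\<Sum>g | g < m \<and> \<beta> g = t. sz g ^ 2)" using m by (intro sum_mono2) (auto simp: N_def)
    finally show ?thesis using le[OF that] by simp
  qed
  \<comment> \<open>The capacity stays below \<open>(q + 1) * M^2\<close>, so no bin holds more than
    \<open>q\<close> items. With \<open>q * F\<close> items in \<open>F\<close> bins, every bin
    holds exactly \<open>q\<close>.\<close>
  have "2 * M * X + 2 * M - 1 < M ^ 2"
  proof -
    have "(2 * X + 2) * M \<le> M * M" using M by (intro mult_le_mono1) simp
    then show ?thesis using M by (simp add: power2_eq_square algebra_simps)
  qed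
  then have cap: "q * M ^ 2 + 2 * M * X + 2 * M - 1 < (q + 1) * M ^ 2" using M by (simp add: algebra_simps)
  have card_le: "card (N t) \<le> q" if "t < F" for t
  proof (rule ccontr)
    assume "\<not> card (N t) \<le> q"
    then have "(q + 1) * M ^ 2 \<le> card (N t) * M ^ 2" by (intro mult_le_mono1) simp
    also have "\<dots> = (\<Sum>g\<in>N t. M ^ 2)" by simp
    also have "\<dots> \<le> (\<Sum>g\<in>N t. (M + ?x g) ^ 2)" by (intro sum_mono power_mono) auto
    finally show False using leN[OF that] cap by simp
  qed
  have group: "(\<Sum>t<F. \<Sum>g\<in>N t. h g) = (\<Sum>g<q * F. h g)" for h :: "nat \<Rightarrow> nat"
  proof -
    have "\<beta> ` {..<q * F} \<subseteq> {..<F}" using \<beta> m by (auto intro: less_le_trans)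
    then show ?thesis using sum.group[of "{..<q * F}" "{..<F}" \<beta> h] by (simp add: N_def)
  qed
  have card_eq: "card (N t) = q" if "t < F" for t
  proof (rule sum_mono_inv[of "\<lambda>t. card (N t)" "{..<F}" "\<lambda>_. q"])
    show "(\<Sum>t<F. card (N t)) = (\<Sum>t<F. q)" using group[of "\<lambda>_. 1"] by simp
  qed (use card_le that in auto)
  \<comment> \<open>With \<open>q\<close> items and weight at least \<open>X + 1\<close> the bin
    would contain at least \<open>q * M^2 + 2 * M * (X + 1)\<close>, one more than its capacity;
    this is the origin of the final \<open>- 1\<close>. Equality follows from the total weight
    \<open>F * X\<close>.\<close>
  have x_le: "(\<Sum>g\<in>N t. ?x g) \<le> X" if t: "t < F" for t
  proof (rule ccontr)
    assume "\<not> ?thesis"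
    then have "2 * M * (X + 1) \<le> 2 * M * (\<Sum>g\<in>N t. ?x g)" by (intro mult_le_mono2) simp
    moreover have "(\<Sum>g\<in>N t. (M + ?x g) ^ 2) = card (N t) * M ^ 2 + 2 * M * (\<Sum>g\<in>N t. ?x g) + (\<Sum>g\<in>N t. ?x g ^ 2)"
      by (simp add: power2_sum sum.distrib sum_distrib_left mult.assoc)
    ultimately show False using leN[OF t] card_eq[OF t] M by (simp add: algebra_simps)
  qed
  have total: "(\<Sum>g<q * F. ?x g) = F * X"
  proof -
    have "{(f, k). (f, k) \<in> items \<and> (0 :: nat) = 0} = items" "{g. g < (r + 1) * F \<and> (0 :: nat) = 0} = {..<(r + 1) * F}"
      by auto
    then show ?thesis
      using sum_items[where \<beta> = "\<lambda>_ _. 0 :: nat" and t = 0 and h = wt] sum_weight unfolding q_def by (simp only:)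
  qed
  have x_eq: "(\<Sum>g\<in>N t. ?x g) = X" if "t < F" for t
  proof (rule sum_mono_inv[of "\<lambda>t. \<Sum>g\<in>N t. ?x g" "{..<F}" "\<lambda>_. X"])
    show "(\<Sum>t<F. \<Sum>g\<in>N t. ?x g) = (\<Sum>t<F. X)" using group[of ?x] total by simp
  qed (use x_le that in auto)
  have N_less: "g div q < F" "g mod q \<le> r" if "g \<in> N t" for g t
    using that mod_less_divisor[of q g] by (auto simp: N_def q_def less_mult_imp_div_less mult.commute simp del: mod_less_divisor)
  define \<gamma> where "\<gamma> f k = \<beta> (f * q + k)" for f k
  have \<gamma>: "\<gamma> (g div q) (g mod q) = \<beta> g" for g by (simp add: \<gamma>_def)
  show "exact_cover F n r S"
  proof (rule bins_imp_cover[of \<gamma>])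
    fix f k assume fk: "f < F" "k \<le> r"
    have "f * q + k < (f + 1) * q" using fk by (simp add: q_def)
    also have "\<dots> \<le> F * q" using fk by (intro mult_le_mono1) simp
    finally show "\<gamma> f k < F" using m \<beta> by (simp add: \<gamma>_def mult.commute)
  next
    fix t l assume t: "t < F" and l: "l < 2 * r + 2"
    have "(\<Sum>l<2 * r + 2. (\<Sum>g\<in>N t. dg (g div q) (g mod q) l) * radix n r ^ l) = (\<Sum>g\<in>N t. ?x g)"
      unfolding weight_def sum_distrib_right by (rule sum.swap)
    also have "\<dots> = (\<Sum>l<2 * r + 2. tg l * radix n r ^ l)" using x_eq[OF t] by (simp add: goal_weight_def)
    finally have e: "(\<Sum>l<2 * r + 2. (\<Sum>g\<in>N t. dg (g div q) (g mod q) l) * radix n r ^ l) = (\<Sum>l<2 * r + 2. tg l * radix n r ^ l)" .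
    have "(\<Sum>g\<in>N t. dg (g div q) (g mod q) l) < radix n r" for l
    proof -
      have "(\<Sum>g\<in>N t. dg (g div q) (g mod q) l) \<le> (\<Sum>g\<in>N t. n + r)"
        using N_less digit_le by (intro sum_mono) auto
      also have "\<dots> = q * (n + r)" using card_eq[OF t] by simp
      also have "\<dots> < radix n r" by (simp add: radix_def q_def)
      finally show ?thesis .
    qed
    from digits_unique[OF this target_less e l]
    have "(\<Sum>g\<in>N t. dg (g div q) (g mod q) l) = tg l" .
    then show "(\<Sum>(f, k) | (f, k) \<in> items \<and> \<gamma> f k = t. dg f k l) = tg l"
      using sum_items[where \<beta> = \<gamma> and t = t and h = "\<lambda>f k. dg f k l", folded q_def]
      by (simp only: N_def \<gamma>)
  qed
next
  let ?x = "\<lambda>g. wt (g div q) (g mod q)"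
  assume "exact_cover F n r S"
  from cover_imp_bins[OF this] obtain \<gamma> where \<gamma>: "\<And>f k. f < F \<Longrightarrow> k \<le> r \<Longrightarrow> \<gamma> f k < F"
    and bins: "\<And>t l. t < F \<Longrightarrow> l < 2 * r + 2 \<Longrightarrow> (\<Sum>(f, k) | (f, k) \<in> items \<and> \<gamma> f k = t. dg f k l) = tg l" by blast
  \<comment> \<open>All padding items go to bin 0. The estimate below reserves room for them in
    every bin: \<open>M\<close> is chosen such that \<open>X^2 + m * pad^2\<close> fits into the
    slack \<open>2 * M - 1\<close>.\<close>
  define \<beta> where "\<beta> g = (if g < q * F then \<gamma> (g div q) (g mod q) else 0)" for g
  have "\<beta> g < F" for g
    using \<gamma>[of "g div q" "g mod q"] F mod_less_divisor[of q g]
    by (auto simp: \<beta>_def q_def less_mult_imp_div_less mult.commute simp del: mod_less_divisor)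
  moreover have "(\<Sum>g | g < m \<and> \<beta> g = t. sz g ^ 2) \<le> q * M ^ 2 + 2 * M * X + 2 * M - 1" if t: "t < F" for t
  proof -
    define N where "N = {g. g < q * F \<and> \<gamma> (g div q) (g mod q) = t}"
    have finN: "finite N" by (simp add: N_def)
    have dN: "(\<Sum>g\<in>N. dg (g div q) (g mod q) l) = tg l" if "l < 2 * r + 2" for l
      using bins[OF t that] sum_items[where \<beta> = \<gamma> and t = t and h = "\<lambda>f k. dg f k l", folded q_def]
      by (simp only: N_def)
    have "(\<Sum>g\<in>N. ?x g) = (\<Sum>l<2 * r + 2. (\<Sum>g\<in>N. dg (g div q) (g mod q) l) * radix n r ^ l)"
      unfolding weight_def sum_distrib_right by (rule sum.swap)
    then have xN: "(\<Sum>g\<in>N. ?x g) = X" using dN by (simp add: goal_weight_def)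
    have one: "(\<Sum>k\<le>r. dg (g div q) (g mod q) (r + 1 + k)) = 1" for g
    proof -
      have "(\<Sum>k\<le>r. dg (g div q) (g mod q) (r + 1 + k)) = (\<Sum>k\<le>r. if k = g mod q then 1 else 0)"
        by (intro sum.cong) (auto simp: digit_def)
      moreover have "g mod q \<le> r" using mod_less_divisor[of q g] by (simp add: q_def)
      ultimately show ?thesis by simp
    qed
    have "card N = (\<Sum>g\<in>N. \<Sum>k\<le>r. dg (g div q) (g mod q) (r + 1 + k))" by (simp only: one sum_constant) simp
    also have "\<dots> = (\<Sum>k\<le>r. \<Sum>g\<in>N. dg (g div q) (g mod q) (r + 1 + k))" by (rule sum.swap)
    also have "\<dots> = (\<Sum>k\<le>r. 1)" using dN by (intro sum.cong) (auto simp: target_def)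
    finally have cN: "card N = q" by (simp add: q_def)
    \<comment> \<open>Each weight is at most the sum \<open>X\<close> of all weights in the
      bin.\<close>
    have "(\<Sum>g\<in>N. ?x g ^ 2) \<le> (\<Sum>g\<in>N. X * ?x g)"
      using member_le_sum[of _ N ?x] finN xN by (intro sum_mono) (auto simp: power2_eq_square)
    also have "\<dots> = X ^ 2" unfolding sum_distrib_left[symmetric] xN by (simp add: power2_eq_square)
    finally have sqN: "(\<Sum>g\<in>N. ?x g ^ 2) \<le> X ^ 2" .
    have "(\<Sum>g | g < m \<and> \<beta> g = t. sz g ^ 2) \<le> (\<Sum>g\<in>N \<union> {q * F..<m}. sz g ^ 2)"
      using finN by (intro sum_mono2) (auto simp: N_def \<beta>_def split: if_splits)
    also have "\<dots> = (\<Sum>g\<in>N. sz g ^ 2) + (\<Sum>g\<in>{q * F..<m}. sz g ^ 2)"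
      using finN by (intro sum.union_disjoint) (auto simp: N_def)
    also have "(\<Sum>g\<in>N. sz g ^ 2) = (\<Sum>g\<in>N. (M + ?x g) ^ 2)" by (intro sum.cong) (auto simp: N_def sz_def)
    also have "\<dots> = q * M ^ 2 + 2 * M * X + (\<Sum>g\<in>N. ?x g ^ 2)"
      using xN cN by (simp add: power2_sum sum.distrib mult.assoc flip: sum_distrib_left)
    also have "(\<Sum>g\<in>{q * F..<m}. sz g ^ 2) \<le> m * pad ^ 2" by (simp add: sz_def)
    finally show ?thesis using sqN M by simp
  qed
  ultimately show "\<exists>\<beta>. (\<forall>g<m. \<beta> g < F) \<and> (\<forall>t<F. (\<Sum>g | g < m \<and> \<beta> g = t. sz g ^ 2) \<le> q * M ^ 2 + 2 * M * X + 2 * M - 1)"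
    by blast
qed

end

section \<open>Tilings of a torus as exact covers\<close>

definition base_digit :: "nat \<Rightarrow> nat \<Rightarrow> nat \<Rightarrow> nat" where
  "base_digit G u i = u div G ^ i mod G"

definition colours :: "nat \<Rightarrow> nat" where
  "colours G = G ^ 2 + 1"

text \<open>\<open>G ^ 4\<close> tiles, followed by one filler for each \<open>j\<close> from 1 to
  \<open>G^2\<close> and each pair of colours. In slot 0 a tile covers element 0 of its cell and a
  filler covers element \<open>j\<close>, so a cover selects one tile and \<open>G^2\<close> fillers
  per cell: just enough for the \<open>colours G\<close> colours of a border.\<close>

definition frames_per_cell :: "nat \<Rightarrow> nat" where
  "frames_per_cell G = G ^ 4 + G ^ 2 * (colours G * colours G)"

text \<open>A tile \<open>u < G ^ 4\<close> at cell \<open>p\<close> consists of the symbols of the left neighbour, of \<open>p\<close>, of the right neighbour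
  and of the upper neighbour. Element \<open>(w, c)\<close> of slots 1 and 2 says that the lower border of cell \<open>w\<close> is
  coloured \<open>c\<close>, as seen from \<open>w\<close> and from the cell below; slots 3 and 4 do the same for the left border.
  The frames with \<open>u \<ge> G ^ 4\<close> cover the unused colours of both sides at once. Colour \<open>G\<^sup>2\<close> is never the colour of
  an upper border, so that forbidden tiles are unusable.\<close>

definition cell_frame :: "(nat \<Rightarrow> nat) \<Rightarrow> (nat \<Rightarrow> nat) \<Rightarrow> nat \<Rightarrow> (nat \<Rightarrow> nat \<Rightarrow> bool) \<Rightarrow> nat \<Rightarrow> nat \<Rightarrow> nat \<Rightarrow> nat" where
  "cell_frame up rt G ok p u s =
     (if u < G ^ 4 then
        if s = 0 then p * colours G
        else if s = 1 then p * colours G + (if ok p u then base_digit G u 1 else G ^ 2)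
        else if s = 2 then up p * colours G + (if ok p u then base_digit G u 3 else 0)
        else if s = 3 then p * colours G + (if ok p u then base_digit G u 0 + G * base_digit G u 1 else 0)
        else rt p * colours G + (if ok p u then base_digit G u 1 + G * base_digit G u 2 else 0)
      else p * colours G +
        (if s = 0 then (u - G ^ 4) div (colours G * colours G) + 1
         else if s \<le> 2 then (u - G ^ 4) div colours G mod colours G
         else (u - G ^ 4) mod colours G))"

definition frame :: "(nat \<Rightarrow> nat) \<Rightarrow> (nat \<Rightarrow> nat) \<Rightarrow> nat \<Rightarrow> (nat \<Rightarrow> nat \<Rightarrow> bool) \<Rightarrow> nat \<Rightarrow> nat \<Rightarrow> nat" where
  "frame up rt G ok f s = cell_frame up rt G ok (f div frames_per_cell G) (f mod frames_per_cell G) s"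

definition tiling :: "nat \<Rightarrow> (nat \<Rightarrow> nat) \<Rightarrow> (nat \<Rightarrow> nat) \<Rightarrow> nat \<Rightarrow> (nat \<Rightarrow> nat \<Rightarrow> bool) \<Rightarrow> (nat \<Rightarrow> nat) \<Rightarrow> bool" where
  "tiling N up rt G ok \<tau> \<longleftrightarrow> (\<forall>p<N. \<tau> p < G ^ 4 \<and> ok p (\<tau> p) \<and>
     base_digit G (\<tau> p) 3 = base_digit G (\<tau> (up p)) 1 \<and>
     base_digit G (\<tau> p) 1 + G * base_digit G (\<tau> p) 2 =
       base_digit G (\<tau> (rt p)) 0 + G * base_digit G (\<tau> (rt p)) 1)"

lemma mult_add_eq_iff:
  fixes C :: nat
  assumes "c < C" "c' < C"
  shows "w * C + c = w' * C + c' \<longleftrightarrow> w = w' \<and> c = c'"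
proof
  assume e: "w * C + c = w' * C + c'"
  have "(w * C + c) div C = w" "(w' * C + c') div C = w'" using assms by simp_all
  with e have "w = w'" by simp
  with e show "w = w' \<and> c = c'" by simp
qed simp

text \<open>The fillers of a cell with border colour \<open>b\<close> are given the colours
  \<open>(b + j) mod C\<close>; together with the tile, which acts as \<open>j = 0\<close>, they run
  through every colour once.\<close>

lemma rotation_ex1:
  fixes C :: nat
  assumes "b < C" "c < C"
  shows "\<exists>!j. j < C \<and> (b + j) mod C = c"
proof -
  have aux: False if "i < j" "j < C" "(b + j) mod C = (b + i) mod C" for i j
  proof -
    have "C dvd (b + j) - (b + i)" using that mod_eq_dvd_iff_nat[of "b + i" "b + j" C] by simp
    then have "C \<le> j - i" using that(1) by (intro dvd_imp_le) auto
    then show False using that by simp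
  qed
  have "inj_on (\<lambda>j. (b + j) mod C) {..<C}"
  proof (rule inj_onI)
    fix i j assume ij: "i \<in> {..<C}" "j \<in> {..<C}" "(b + i) mod C = (b + j) mod C"
    then show "i = j" using aux[of i j] aux[of j i] by (cases i j rule: linorder_cases) auto
  qed
  moreover have "(\<lambda>j. (b + j) mod C) ` {..<C} \<subseteq> {..<C}" using assms by auto
  ultimately have "(\<lambda>j. (b + j) mod C) ` {..<C} = {..<C}" by (intro endo_inj_surj) auto
  then have "c \<in> (\<lambda>j. (b + j) mod C) ` {..<C}" using assms(2) by simp
  then obtain j where j: "j < C" "(b + j) mod C = c" by blast
  have "i = j" if "i < C" "(b + i) mod C = c" for i
    using aux[of i j] aux[of j i] that j by (cases i j rule: linorder_cases) simp_all
  then show ?thesis using j by blast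
qed

text \<open>The selected frame with index \<open>(w, j)\<close> is the tile of cell \<open>w\<close>
  if \<open>j = 0\<close> and a filler otherwise. In the given slot a tile covers an element of cell
  \<open>\<pi> w\<close>, possibly a neighbour, while a filler stays in its own cell; as \<pi> is a
  bijection, each element is still hit once.\<close>

lemma rotation_cells_ex1:
  fixes \<beta> \<pi> :: "nat \<Rightarrow> nat"
  assumes \<pi>: "bij_betw \<pi> {..<N} {..<N}" and w: "w < N" and c: "c < C" and \<beta>: "\<beta> w < C"
  shows "\<exists>!k. k \<in> {..<N} \<times> {..<C} \<and>
    (if snd k = 0 then \<pi> (fst k) = w \<and> \<beta> w = c else fst k = w \<and> (\<beta> w + snd k) mod C = c)"
proof -
  obtain v where v: "v < N" "\<pi> v = w" using \<pi> w by (metis bij_betw_def imageE lessThan_iff)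
  have vu: "v' = v" if "v' < N" "\<pi> v' = w" for v'
    using \<pi> v that by (metis bij_betw_def inj_onD lessThan_iff)
  obtain j where j: "j < C" "(\<beta> w + j) mod C = c" and ju: "\<And>i. i < C \<Longrightarrow> (\<beta> w + i) mod C = c \<Longrightarrow> i = j"
    using rotation_ex1[OF \<beta> c] by blast
  have z: "\<beta> w = c \<longleftrightarrow> j = 0"
    using j ju[of 0] \<beta> c by auto
  let ?Q = "\<lambda>k. if snd k = 0 then \<pi> (fst k) = w \<and> \<beta> w = c else fst k = w \<and> (\<beta> w + snd k) mod C = c"
  have Q0: "a = v \<and> j = 0" if "a < N" "?Q (a, 0)" for a
    using that vu[of a] z by simp
  have Q1: "a = w \<and> i = j" if "i < C" "i \<noteq> 0" "?Q (a, i)" for a i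
    using that ju[of i] by simp
  show ?thesis
  proof (cases "j = 0")
    case True
    have Q: "?Q (v, 0)" using v(2) z True by simp
    have K: "(v, 0) \<in> {..<N} \<times> {..<C}" using v(1) c by simp
    have U: "k = (v, 0)" if k: "k \<in> {..<N} \<times> {..<C}" "?Q k" for k
    proof -
      obtain a i where ai: "k = (a, i)" "a < N" "i < C" using k(1) by blast
      have Qk: "?Q (a, i)" using k(2) unfolding ai(1) .
      show ?thesis
      proof (cases "i = 0")
        case i0: True
        have "?Q (a, 0)" using Qk unfolding i0 .
        from Q0[OF ai(2) this] show ?thesis using True ai(1) i0 by blast
      next
        case i0: False
        from Q1[OF ai(3) i0 Qk] show ?thesis using True ai(1) i0 by blast
      qed
    qed
    show ?thesis
    proof (rule ex1I[of _ "(v, 0)"])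
      show "(v, 0) \<in> {..<N} \<times> {..<C} \<and> ?Q (v, 0)" using K Q by (rule conjI)
    next
      fix k assume h: "k \<in> {..<N} \<times> {..<C} \<and> ?Q k"
      show "k = (v, 0)" by (rule U[OF conjunct1[OF h] conjunct2[OF h]])
    qed
  next
    case False
    have Q: "?Q (w, j)" using j(2) False by simp
    have K: "(w, j) \<in> {..<N} \<times> {..<C}" using w j(1) by simp
    have U: "k = (w, j)" if k: "k \<in> {..<N} \<times> {..<C}" "?Q k" for k
    proof -
      obtain a i where ai: "k = (a, i)" "a < N" "i < C" using k(1) by blast
      have Qk: "?Q (a, i)" using k(2) unfolding ai(1) .
      show ?thesis
      proof (cases "i = 0")
        case i0: True
        have "?Q (a, 0)" using Qk unfolding i0 .
        from Q0[OF ai(2) this] show ?thesis using False ai(1) i0 by blast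
      next
        case i0: False
        from Q1[OF ai(3) i0 Qk] show ?thesis using False ai(1) i0 by blast
      qed
    qed
    show ?thesis
    proof (rule ex1I[of _ "(w, j)"])
      show "(w, j) \<in> {..<N} \<times> {..<C} \<and> ?Q (w, j)" using K Q by (rule conjI)
    next
      fix k assume h: "k \<in> {..<N} \<times> {..<C} \<and> ?Q k"
      show "k = (w, j)" by (rule U[OF conjunct1[OF h] conjunct2[OF h]])
    qed
  qed
qed

locale torus =
  fixes N G :: nat and up rt :: "nat \<Rightarrow> nat" and ok :: "nat \<Rightarrow> nat \<Rightarrow> bool"
  assumes up: "bij_betw up {..<N} {..<N}" and rt: "bij_betw rt {..<N} {..<N}" and G: "0 < G"
begin

abbreviation "C \<equiv> colours G"
abbreviation "\<Psi> \<equiv> frames_per_cell G"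
abbreviation "fr \<equiv> cell_frame up rt G ok"
abbreviation "S \<equiv> frame up rt G ok"

lemma up_less: "p < N \<Longrightarrow> up p < N" and rt_less: "p < N \<Longrightarrow> rt p < N"
  using up rt by (auto simp: bij_betw_def)

lemma C_gt: "G ^ 2 < C" and C_pos: "0 < C"
  by (auto simp: colours_def)

lemma digit_less: "base_digit G u i < G"
  using G by (simp add: base_digit_def)

lemma G_le: "G \<le> G ^ 2"
  using G by (simp add: power2_eq_square)

lemma pair_less: "base_digit G u i + G * base_digit G u' i' < C"
proof -
  have "base_digit G u i + G * base_digit G u' i' < G * (base_digit G u' i' + 1)"
    using digit_less[of u i] by simp
  also have "\<dots> \<le> G * G" using digit_less[of u' i'] by (intro mult_le_mono2) simp
  finally show ?thesis by (simp add: colours_def power2_eq_square)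
qed

text \<open>Elements are coded as \<open>w * C + c\<close>. \<open>wire\<close> and
  \<open>col\<close> split the element that frame \<open>u\<close> of cell \<open>p\<close> has in
  slot \<open>s\<close> into the cell whose border is meant and the colour.\<close>

definition wire :: "nat \<Rightarrow> nat \<Rightarrow> nat \<Rightarrow> nat" where
  "wire p u s = (if u < G ^ 4 then if s = 2 then up p else if s < 4 then p else rt p else p)"

definition col :: "nat \<Rightarrow> nat \<Rightarrow> nat \<Rightarrow> nat" where
  "col p u s = fr p u s - wire p u s * C"

lemma u_div: "u < \<Psi> \<Longrightarrow> (u - G ^ 4) div (C * C) < G ^ 2"
  using C_pos G by (cases "u < G ^ 4") (auto simp: frames_per_cell_def less_mult_imp_div_less)

lemma fr_wire_col:
  assumes "u < \<Psi>" "s < 5"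
  shows "fr p u s = wire p u s * C + col p u s" "col p u s < C"
proof -
  have d: "base_digit G u i < C" for i using digit_less[of u i] G_le C_gt by linarith
  have s: "s = 0 \<or> s = 1 \<or> s = 2 \<or> s = 3 \<or> s = 4" using assms by auto
  have u: "(u - G ^ 4) div (C * C) + 1 < C" if "\<not> u < G ^ 4"
    using u_div[OF assms(1)] by (simp add: colours_def)
  show "fr p u s = wire p u s * C + col p u s"
    using s by (auto simp: col_def wire_def cell_frame_def)
  show "col p u s < C"
    using s d u pair_less C_gt C_pos by (auto simp: col_def wire_def cell_frame_def)
qed

lemma wire_less: "p < N \<Longrightarrow> wire p u s < N"
  using up_less rt_less by (auto simp: wire_def)

lemma \<Psi>_pos: "0 < \<Psi>"
  using G by (simp add: frames_per_cell_def)

lemma frame_of: "u < \<Psi> \<Longrightarrow> S (p * \<Psi> + u) s = fr p u s"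
  by (simp add: frame_def)

lemma frame_index: "f < N * \<Psi> \<Longrightarrow> f div \<Psi> < N \<and> f mod \<Psi> < \<Psi>"
  using \<Psi>_pos by (simp add: less_mult_imp_div_less)

lemma frame_index_less: "p < N \<Longrightarrow> u < \<Psi> \<Longrightarrow> p * \<Psi> + u < N * \<Psi>"
proof -
  assume "p < N" "u < \<Psi>"
  then have "p * \<Psi> + u < (p + 1) * \<Psi>" by simp
  also have "\<dots> \<le> N * \<Psi>" using \<open>p < N\<close> by (intro mult_le_mono1) simp
  finally show ?thesis .
qed

definition filler :: "nat \<Rightarrow> nat \<Rightarrow> nat \<Rightarrow> nat" where
  "filler j c d = G ^ 4 + ((j - 1) * (C * C) + c * C + d)"

lemma filler:
  assumes "1 \<le> j" "j < C" "c < C" "d < C"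
  shows "filler j c d < \<Psi>" "\<not> filler j c d < G ^ 4"
    and "fr p (filler j c d) 0 = p * C + j"
    and "s = 1 \<or> s = 2 \<Longrightarrow> fr p (filler j c d) s = p * C + c"
    and "s = 3 \<or> s = 4 \<Longrightarrow> fr p (filler j c d) s = p * C + d"
proof -
  have cd: "c * C + d < C * C"
  proof -
    have "c * C + d < (c + 1) * C" using assms by simp
    also have "\<dots> \<le> C * C" using assms by (intro mult_le_mono1) simp
    finally show ?thesis .
  qed
  have j: "j - 1 < G ^ 2" using assms by (simp add: colours_def)
  have "(j - 1) * (C * C) + c * C + d < (j - 1 + 1) * (C * C)" using cd by simp
  also have "\<dots> \<le> G ^ 2 * (C * C)" using j by (intro mult_le_mono1) simp
  finally show "filler j c d < \<Psi>" by (simp add: filler_def frames_per_cell_def)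
  show n: "\<not> filler j c d < G ^ 4" by (simp add: filler_def)
  have sub: "filler j c d - G ^ 4 = (j - 1) * (C * C) + (c * C + d)" by (simp add: filler_def)
  have d1: "((j - 1) * (C * C) + (c * C + d)) div (C * C) = j - 1"
    using cd C_pos by simp
  have e: "(j - 1) * (C * C) + (c * C + d) = ((j - 1) * C + c) * C + d" by (simp add: algebra_simps)
  have d2: "((j - 1) * (C * C) + (c * C + d)) div C mod C = c" "((j - 1) * (C * C) + (c * C + d)) mod C = d"
    unfolding e using assms by simp_all
  show "fr p (filler j c d) 0 = p * C + j"
    using n d1 assms(1) by (simp add: cell_frame_def sub)
  show "s = 1 \<or> s = 2 \<Longrightarrow> fr p (filler j c d) s = p * C + c"
    using n d2 by (auto simp: cell_frame_def sub)
  show "s = 3 \<or> s = 4 \<Longrightarrow> fr p (filler j c d) s = p * C + d"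
    using n d2 by (auto simp: cell_frame_def sub)
qed

lemma frame_less: "f < N * \<Psi> \<Longrightarrow> s < 5 \<Longrightarrow> S f s < N * C"
proof -
  assume f: "f < N * \<Psi>" and s: "s < 5"
  let ?p = "f div \<Psi>" and ?u = "f mod \<Psi>"
  have pu: "?p < N" "?u < \<Psi>" using frame_index[OF f] by auto
  have "S f s = wire ?p ?u s * C + col ?p ?u s" using fr_wire_col[OF pu(2) s] by (simp add: frame_def)
  also have "\<dots> < (wire ?p ?u s + 1) * C" using fr_wire_col(2)[OF pu(2) s] by simp
  also have "\<dots> \<le> N * C" using wire_less[OF pu(1)] by (intro mult_le_mono1) (simp add: Suc_le_eq)
  finally show ?thesis .
qed

lemma frame_occurs: "s < 5 \<Longrightarrow> e < N * C \<Longrightarrow> \<exists>f<N * \<Psi>. S f s = e"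
proof -
  assume s: "s < 5" and e: "e < N * C"
  let ?w = "e div C" and ?c = "e mod C"
  have w: "?w < N" "?c < C" "?w * C + ?c = e" using e C_pos by (simp_all add: less_mult_imp_div_less)
  have C1: "1 < C" using G by (simp add: colours_def)
  have "\<exists>u<\<Psi>. fr ?w u s = e"
  proof -
    consider "s = 0" "?c = 0" | "s = 0" "?c \<noteq> 0" | "s = 1 \<or> s = 2" | "s = 3 \<or> s = 4" using s by linarith
    then show ?thesis
    proof cases
      case 1
      then show ?thesis using G w by (intro exI[of _ 0]) (auto simp: cell_frame_def frames_per_cell_def)
    next
      case 2
      then show ?thesis using filler(1)[of ?c 0 0] filler(3)[of ?c 0 0 ?w] w C_pos by (intro exI[of _ "filler ?c 0 0"]) auto
    next
      case 3
      then show ?thesis using filler(1)[of 1 ?c 0] filler(4)[of 1 ?c 0 s ?w] w C1 C_pos by (intro exI[of _ "filler 1 ?c 0"]) auto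
    next
      case 4
      then show ?thesis using filler(1)[of 1 0 ?c] filler(5)[of 1 0 ?c s ?w] w C1 C_pos by (intro exI[of _ "filler 1 0 ?c"]) auto
    qed
  qed
  then obtain u where "u < \<Psi>" "fr ?w u s = e" by blast
  then show ?thesis using w(1) frame_of frame_index_less by (intro exI[of _ "?w * \<Psi> + u"]) auto
qed

lemma cover_imp_tiling:
  assumes "exact_cover (N * \<Psi>) (N * C) 5 S"
  shows "\<exists>\<tau>. tiling N up rt G ok \<tau>"
proof -
  obtain A where A: "A \<subseteq> {..<N * \<Psi>}" "\<And>s e. s < 5 \<Longrightarrow> e < N * C \<Longrightarrow> \<exists>!f. f \<in> A \<and> S f s = e"
    using assms by (auto simp: exact_cover_def)
  define A' where "A' = {(p, u). p < N \<and> u < \<Psi> \<and> p * \<Psi> + u \<in> A}"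
  have enc_less: "w * C + c < N * C" if "w < N" "c < C" for w c
  proof -
    have "w * C + c < (w + 1) * C" using that by simp
    also have "\<dots> \<le> N * C" using that by (intro mult_le_mono1) simp
    finally show ?thesis .
  qed
  have ex: "\<exists>p u. (p, u) \<in> A' \<and> wire p u s = w \<and> col p u s = c" if s: "s < 5" "w < N" "c < C" for s w c
  proof -
    obtain f where f: "f \<in> A" "S f s = w * C + c" using A(2)[OF s(1) enc_less[OF s(2,3)]] by blast
    let ?p = "f div \<Psi>" and ?u = "f mod \<Psi>"
    have pu: "?p < N" "?u < \<Psi>" using frame_index f(1) A(1) by auto
    then have "(?p, ?u) \<in> A'" using f(1) by (simp add: A'_def)
    moreover have "wire ?p ?u s = w \<and> col ?p ?u s = c"
      using f(2) fr_wire_col[OF pu(2) s(1), of ?p] mult_add_eq_iff[of "col ?p ?u s" C c] s(3) by (simp add: frame_def)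
    ultimately show ?thesis by blast
  qed
  have unique: "p = p' \<and> u = u'" if "(p, u) \<in> A'" "(p', u') \<in> A'" "s < 5"
    "wire p u s = wire p' u' s" "col p u s = col p' u' s" for p u p' u' s
  proof -
    have pu: "p < N" "u < \<Psi>" "p * \<Psi> + u \<in> A" "p' < N" "u' < \<Psi>" "p' * \<Psi> + u' \<in> A"
      using that by (auto simp: A'_def)
    have "S (p * \<Psi> + u) s = wire p u s * C + col p u s" "S (p' * \<Psi> + u') s = wire p u s * C + col p u s"
      using fr_wire_col[OF pu(2) that(3)] fr_wire_col[OF pu(5) that(3)] that(4,5) pu by (simp_all add: frame_of)
    moreover have "wire p u s * C + col p u s < N * C"
      using enc_less[OF wire_less[OF pu(1)] fr_wire_col(2)[OF pu(2) that(3)]] .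
    ultimately have "p * \<Psi> + u = p' * \<Psi> + u'" using A(2)[OF that(3)] pu(3,6) by metis
    then show ?thesis using mult_add_eq_iff pu by blast
  qed
  \<comment> \<open>Colour 0 in slot 0 can only come from a tile.\<close>
  have "\<exists>u. (p, u) \<in> A' \<and> u < G ^ 4" if p: "p < N" for p
  proof -
    obtain p' u where u: "(p', u) \<in> A'" "wire p' u 0 = p" "col p' u 0 = 0"
      using ex[of 0 p 0] p C_pos by auto
    have "p' = p" using u(2) by (auto simp: wire_def split: if_splits)
    moreover have "u < G ^ 4"
    proof (rule ccontr)
      assume "\<not> u < G ^ 4"
      then show False using u(3) by (simp add: col_def wire_def cell_frame_def)
    qed
    ultimately show ?thesis using u(1) by blast
  qed
  then obtain \<tau> where \<tau>: "\<And>p. p < N \<Longrightarrow> (p, \<tau> p) \<in> A' \<and> \<tau> p < G ^ 4" by metis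
  have \<tau>_unique: "u = \<tau> p" if "(p, u) \<in> A'" "u < G ^ 4" for p u
  proof -
    have "p < N" using that by (simp add: A'_def)
    then show ?thesis using unique[OF that(1), of p "\<tau> p" 0] \<tau>[of p] that
      by (simp add: wire_def col_def cell_frame_def)
  qed
  \<comment> \<open>The colour that the tile of \<open>p\<close> shows its neighbour in slot
    \<open>t\<close> must also be covered in slot \<open>s\<close>. A filler doing so would cover
    the same element in slot \<open>t\<close> too, where the tile of \<open>p\<close> already does;
    hence the neighbour's tile shows this colour.\<close>
  have match: "col p (\<tau> p) t = col (wire p (\<tau> p) t) (\<tau> (wire p (\<tau> p) t)) s"
    if p: "p < N" and st: "s = 1 \<and> t = 2 \<or> s = 3 \<and> t = 4" for p s t
  proof -
    let ?w = "wire p (\<tau> p) t" and ?c = "col p (\<tau> p) t"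
    have pA: "(p, \<tau> p) \<in> A'" "\<tau> p < G ^ 4" "\<tau> p < \<Psi>" using \<tau>[OF p] by (auto simp: A'_def)
    have w: "?w < N" "?c < C" "s < 5" "t < 5" using wire_less[OF p] fr_wire_col(2)[OF pA(3)] st by auto
    obtain p' u where u: "(p', u) \<in> A'" "wire p' u s = ?w" "col p' u s = ?c" using ex[OF w(3,1,2)] by blast
    have p': "p' = ?w" using u(2) st by (auto simp: wire_def split: if_splits)
    show ?thesis
    proof (cases "u < G ^ 4")
      case True
      then show ?thesis using \<tau>_unique[OF u(1)] u(3) p' by simp
    next
      case False
      then have "wire p' u t = ?w" "col p' u t = ?c" using u(2,3) st by (auto simp: wire_def col_def cell_frame_def)
      then have "u = \<tau> p" using unique[OF u(1) pA(1) w(4)] by simp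
      then show ?thesis using False pA by simp
    qed
  qed
  \<comment> \<open>A forbidden tile shows colour \<open>G^2\<close> at its lower border, whereas
    the tile of the cell \<open>v\<close> below shows a smaller colour at its upper border, even if
    it is forbidden itself.\<close>
  have ok: "ok p (\<tau> p)" if p: "p < N" for p
  proof (rule ccontr)
    assume n: "\<not> ok p (\<tau> p)"
    obtain v where v: "v < N" "up v = p" using up p by (metis bij_betw_def imageE lessThan_iff)
    have "col v (\<tau> v) 2 = col p (\<tau> p) 1" using match[OF v(1), of 1 2] \<tau>[OF v(1)] v(2) by (simp add: wire_def)
    also have "\<dots> = G ^ 2" using n \<tau>[OF p] by (simp add: col_def wire_def cell_frame_def)
    finally have "col v (\<tau> v) 2 = G ^ 2" .
    moreover have "col v (\<tau> v) 2 < G ^ 2"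
      using \<tau>[OF v(1)] digit_less[of "\<tau> v" 3] G_le G by (simp add: col_def wire_def cell_frame_def)
    ultimately show False by simp
  qed
  have "tiling N up rt G ok \<tau>"
    unfolding tiling_def
  proof (intro allI impI conjI)
    fix p assume p: "p < N"
    show "\<tau> p < G ^ 4" "ok p (\<tau> p)" using \<tau>[OF p] ok[OF p] by auto
    show "base_digit G (\<tau> p) 3 = base_digit G (\<tau> (up p)) 1"
      using match[OF p, of 1 2] \<tau>[OF p] \<tau>[OF up_less[OF p]] ok[OF p] ok[OF up_less[OF p]]
      by (simp add: wire_def col_def cell_frame_def)
    show "base_digit G (\<tau> p) 1 + G * base_digit G (\<tau> p) 2 = base_digit G (\<tau> (rt p)) 0 + G * base_digit G (\<tau> (rt p)) 1"
      using match[OF p, of 3 4] \<tau>[OF p] \<tau>[OF rt_less[OF p]] ok[OF p] ok[OF rt_less[OF p]]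
      by (simp add: wire_def col_def cell_frame_def)
  qed
  then show ?thesis by blast
qed

lemma tiling_imp_cover:
  assumes \<tau>: "tiling N up rt G ok \<tau>"
  shows "exact_cover (N * \<Psi>) (N * C) 5 S"
proof -
  have t: "\<tau> p < G ^ 4" "ok p (\<tau> p)" "base_digit G (\<tau> p) 3 = base_digit G (\<tau> (up p)) 1"
    "base_digit G (\<tau> p) 1 + G * base_digit G (\<tau> p) 2 = base_digit G (\<tau> (rt p)) 0 + G * base_digit G (\<tau> (rt p)) 1"
    if "p < N" for p using \<tau> that by (auto simp: tiling_def)
  define b where "b w = base_digit G (\<tau> w) 1" for w
  define l where "l w = base_digit G (\<tau> w) 0 + G * base_digit G (\<tau> w) 1" for w
  have bC: "b w < C" for w using digit_less[of "\<tau> w" 1] G_le C_gt by (simp add: b_def)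
  have lC: "l w < C" for w using pair_less by (simp add: l_def)
  \<comment> \<open>The tile of each cell, and for each \<open>j > 0\<close> the filler that shifts
    both border colours of the tile by \<open>j\<close>. Both sides of a border are filled alike,
    since matching tiles leave the same colour to be omitted.\<close>
  define a where "a = (\<lambda>(w, j). w * \<Psi> + (if j = 0 then \<tau> w else filler j ((b w + j) mod C) ((l w + j) mod C)))"
  let ?K = "{..<N} \<times> {..<C}"
  define \<beta> where "\<beta> s w = (if s = (0 :: nat) then 0 else if s \<le> 2 then b w else l w)" for s w
  define \<pi> where "\<pi> s = (if s = 2 then up else if s = 4 then rt else id)" for s :: nat
  have \<beta>C: "\<beta> s w < C" for s w using bC lC C_pos by (simp add: \<beta>_def)
  have val: "S (a (w, j)) s = (if j = 0 then \<pi> s w * C + \<beta> s (\<pi> s w) else w * C + (\<beta> s w + j) mod C)"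
    if w: "w < N" and j: "j < C" and s: "s < 5" for w j s
  proof -
    have s': "s = 0 \<or> s = 1 \<or> s = 2 \<or> s = 3 \<or> s = 4" using s by auto
    show ?thesis
    proof (cases "j = 0")
      case True
      have "\<tau> w < \<Psi>" using t(1)[OF w] by (simp add: frames_per_cell_def)
      then have "S (a (w, j)) s = fr w (\<tau> w) s" using True by (simp add: a_def frame_of)
      also have "\<dots> = \<pi> s w * C + \<beta> s (\<pi> s w)"
        using s' t[OF w] by (auto simp: cell_frame_def \<beta>_def \<pi>_def b_def l_def)
      finally show ?thesis using True by simp
    next
      case False
      have f: "1 \<le> j" "j < C" "(b w + j) mod C < C" "(l w + j) mod C < C" using False j C_pos by auto
      have "S (a (w, j)) s = fr w (filler j ((b w + j) mod C) ((l w + j) mod C)) s"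
        using False filler(1)[OF f] by (simp add: a_def frame_of)
      also have "\<dots> = w * C + (\<beta> s w + j) mod C"
        using s' filler(3)[OF f] filler(4)[OF f, of s] filler(5)[OF f, of s] j by (auto simp: \<beta>_def)
      finally show ?thesis using False by simp
    qed
  qed
  have cover: "\<exists>!f. f \<in> a ` ?K \<and> S f s = e" if s: "s < 5" and e: "e < N * C" for s e
  proof -
    let ?w = "e div C" and ?c = "e mod C"
    have w: "?w < N" "?c < C" "?w * C + ?c = e" using e C_pos by (simp_all add: less_mult_imp_div_less)
    have "bij_betw (\<pi> s) {..<N} {..<N}" using up rt by (simp add: \<pi>_def)
    note bij = this
    define Q where "Q k \<longleftrightarrow> (if snd k = 0 then \<pi> s (fst k) = ?w \<and> \<beta> s ?w = ?c else fst k = ?w \<and> (\<beta> s ?w + snd k) mod C = ?c)" for k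
    have "\<exists>!k. k \<in> ?K \<and> Q k" unfolding Q_def by (rule rotation_cells_ex1[OF bij w(1,2) \<beta>C])
    then obtain k where k: "k \<in> ?K" "Q k" and ku: "\<And>k'. k' \<in> ?K \<Longrightarrow> Q k' \<Longrightarrow> k' = k" by blast
    have iff: "S (a k') s = e \<longleftrightarrow> Q k'" if k': "k' \<in> ?K" for k'
    proof -
      obtain v j where v: "k' = (v, j)" "v < N" "j < C" using k' by blast
      show ?thesis
      proof (cases "j = 0")
        case True
        have "S (a k') s = e \<longleftrightarrow> \<pi> s v * C + \<beta> s (\<pi> s v) = ?w * C + ?c"
          using val[OF v(2,3) s] True by (simp add: v(1) w(3))
        also have "\<dots> \<longleftrightarrow> \<pi> s v = ?w \<and> \<beta> s (\<pi> s v) = ?c"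
          by (rule mult_add_eq_iff[OF \<beta>C w(2)])
        also have "\<dots> \<longleftrightarrow> Q k'" unfolding Q_def v(1) using True by auto
        finally show ?thesis .
      next
        case False
        have "S (a k') s = e \<longleftrightarrow> v * C + (\<beta> s v + j) mod C = ?w * C + ?c"
          using val[OF v(2,3) s] False by (simp add: v(1) w(3))
        also have "\<dots> \<longleftrightarrow> v = ?w \<and> (\<beta> s v + j) mod C = ?c"
          using C_pos by (intro mult_add_eq_iff w(2)) simp
        also have "\<dots> \<longleftrightarrow> Q k'" unfolding Q_def v(1) using False by auto
        finally show ?thesis .
      qed
    qed
    show ?thesis
    proof (rule ex1I[of _ "a k"])
      show "a k \<in> a ` ?K \<and> S (a k) s = e" using iff k by blast
      show "f = a k" if "f \<in> a ` ?K \<and> S f s = e" for f using that iff ku by blast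
    qed
  qed
  have sub: "a ` ?K \<subseteq> {..<N * \<Psi>}"
  proof
    fix f assume "f \<in> a ` ?K"
    then obtain w j where f: "f = a (w, j)" "w < N" "j < C" by auto
    have "(if j = 0 then \<tau> w else filler j ((b w + j) mod C) ((l w + j) mod C)) < \<Psi>"
      using t(1)[OF f(2)] filler(1)[of j "(b w + j) mod C" "(l w + j) mod C"] f(3) C_pos by (auto simp: frames_per_cell_def)
    then show "f \<in> {..<N * \<Psi>}" using f frame_index_less by (simp add: a_def)
  qed
  show ?thesis unfolding exact_cover_def by (intro exI[of _ "a ` ?K"] conjI allI impI sub cover)
qed

end

section \<open>Accepting computations as tilings\<close>

type_synonym cell = "nat list \<times> bool list \<times> nat \<times> nat list"

text \<open>A cell of a row of the tableau: the symbol of every tape at this position, which heads are here, the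
  state of the machine, and the symbols read by all heads. The last component is the same in the whole
  row, which makes the transition a local rule although the heads are at different positions.\<close>

abbreviation syms :: "cell \<Rightarrow> nat list" where "syms c \<equiv> fst c"
abbreviation heads :: "cell \<Rightarrow> bool list" where "heads c \<equiv> fst (snd c)"
abbreviation qstate :: "cell \<Rightarrow> nat" where "qstate c \<equiv> fst (snd (snd c))"
abbreviation guess :: "cell \<Rightarrow> nat list" where "guess c \<equiv> snd (snd (snd c))"

definition cells :: "tm \<Rightarrow> cell set" where
  "cells M = {s. length s = tm_tapes M \<and> set s \<subseteq> {..<tm_symbols M}} \<times> {h. length h = tm_tapes M} \<times>
     {..<tm_states M} \<times> {a. length a = tm_tapes M \<and> set a \<subseteq> {..<tm_symbols M}}"

text \<open>\<open>tm_trans\<close> may be arbitrary in state 1, where \<open>tm_step\<close> does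
  nothing. Idling there lets all computations fill a tableau of the same height.\<close>

definition next_step :: "tm \<Rightarrow> nat \<Rightarrow> nat list \<Rightarrow> nat \<times> (nat \<times> int) list" where
  "next_step M q a = (if q = 1 then (1, keep a) else tm_trans M q a)"

definition row_ok :: "tm \<Rightarrow> cell \<Rightarrow> cell \<Rightarrow> cell \<Rightarrow> bool" where
  "row_ok M c0 c c1 \<longleftrightarrow> snd (snd c0) = snd (snd c) \<and> snd (snd c1) = snd (snd c) \<and>
     (\<forall>j<tm_tapes M. heads c ! j \<longrightarrow> syms c ! j = guess c ! j)"

definition step_ok :: "tm \<Rightarrow> cell \<Rightarrow> cell \<Rightarrow> cell \<Rightarrow> cell \<Rightarrow> bool" where
  "step_ok M c0 c c1 c' \<longleftrightarrow> (case next_step M (qstate c) (guess c) of (q', acts) \<Rightarrow> qstate c' = q' \<and>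
     (\<forall>j<tm_tapes M. syms c' ! j = (if heads c ! j then fst (acts ! j) else syms c ! j) \<and>
       (heads c' ! j \<longleftrightarrow> heads c ! j \<and> snd (acts ! j) = 0 \<or> heads c0 ! j \<and> snd (acts ! j) = 1 \<or>
         heads c1 ! j \<and> snd (acts ! j) = - 1)))"

text \<open>The kind of a position is the initial symbol of the first tape, or 3 where the certificate is guessed; 4 is
  added at the origin.\<close>

definition init_ok :: "tm \<Rightarrow> nat \<Rightarrow> cell \<Rightarrow> cell \<Rightarrow> bool" where
  "init_ok M \<kappa> c0 c \<longleftrightarrow> qstate c = 0 \<and>
     (\<forall>j<tm_tapes M. (heads c ! j \<longleftrightarrow> 4 \<le> \<kappa>) \<and> (0 < j \<longrightarrow> syms c ! j = 0)) \<and>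
     (if \<kappa> mod 4 = 3 then syms c ! 0 \<le> 2 \<and> (syms c0 ! 0 = 0 \<longrightarrow> syms c ! 0 = 0) else syms c ! 0 = \<kappa> mod 4)"

definition final_ok :: "tm \<Rightarrow> nat \<Rightarrow> cell \<Rightarrow> bool" where
  "final_ok M \<kappa> c \<longleftrightarrow> qstate c = 1 \<and> (4 \<le> \<kappa> \<longrightarrow> syms c ! (tm_tapes M - 1) = 2)"

text \<open>The last row imposes no transition, so the cell above it, which lies in row 0 of the
  torus, is unrestricted there.\<close>

definition tile_ok :: "tm \<Rightarrow> bool \<Rightarrow> bool \<Rightarrow> nat \<Rightarrow> cell \<Rightarrow> cell \<Rightarrow> cell \<Rightarrow> cell \<Rightarrow> bool" where
  "tile_ok M fst_row last_row \<kappa> c0 c c1 c' \<longleftrightarrow> row_ok M c0 c c1 \<and> (fst_row \<longrightarrow> init_ok M \<kappa> c0 c) \<and>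
     (if last_row then final_ok M \<kappa> c else step_ok M c0 c c1 c')"

text \<open>The origin of the tapes is column \<open>ob\<close>. From there on stands
  \<open>enc_bits x\<close>: \<open>True\<close> at even offsets, bit \<open>j div 2\<close> of
  \<open>x\<close> at odd offsets \<open>j\<close>, \<open>False\<close> at the end; then
  \<open>Q\<close> cells for the certificate. The condition is phrased with the connectives and the
  guarded bit access for which programs are available.\<close>

definition kind :: "bool list \<Rightarrow> nat \<Rightarrow> nat \<Rightarrow> nat \<Rightarrow> nat" where
  "kind x ob Q i =
     (if i < ob then 0
      else (if i - ob < 2 * length x + 1 then
              if i - ob < 2 * length x \<and> \<not> (\<not> 2 dvd i - ob \<and> \<not> ((i - ob) div 2 < length x \<and> x ! ((i - ob) div 2)))
              then 2 else 1
            else if i - ob < 2 * length x + 1 + Q then 3 else 0) + (if i = ob then 4 else 0))"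

definition up_cell :: "nat \<Rightarrow> nat \<Rightarrow> nat \<Rightarrow> nat" where
  "up_cell H W p = (p div W + 1) mod H * W + p mod W"

definition right_cell :: "nat \<Rightarrow> nat \<Rightarrow> nat" where
  "right_cell W p = p div W * W + (p mod W + 1) mod W"

definition cell_ok :: "tm \<Rightarrow> (nat \<Rightarrow> cell) \<Rightarrow> nat \<Rightarrow> bool list \<Rightarrow> nat \<Rightarrow> nat \<Rightarrow> nat \<Rightarrow> nat \<Rightarrow> nat \<Rightarrow> bool" where
  "cell_ok M e G x T W Q p u \<longleftrightarrow> tile_ok M (p div W = 0) (p div W = T) (kind x (T + 1) Q (p mod W))
     (e (base_digit G u 0)) (e (base_digit G u 1)) (e (base_digit G u 2)) (e (base_digit G u 3))"

lemma finite_cells: "finite (cells M)"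
proof -
  have "finite {s. length s = k \<and> set s \<subseteq> {..<n}}" for k n :: nat
    using finite_lists_length_eq[of "{..<n}" k] by (simp add: conj_commute)
  moreover have "finite {h :: bool list. length h = k}" for k
    using finite_lists_length_eq[of "UNIV :: bool set" k] by simp
  ultimately show ?thesis unfolding cells_def by (intro finite_cartesian_product) auto
qed

lemma enc_bits_nth:
  "j < 2 * length x + 1 \<Longrightarrow> enc_bits x ! j \<longleftrightarrow> j < 2 * length x \<and> (even j \<or> x ! (j div 2))"
proof (induction x arbitrary: j)
  case Nil
  then show ?case by (simp add: enc_bits_def)
next
  case (Cons b x)
  have e: "enc_bits (b # x) = True # b # enc_bits x" by (simp add: enc_bits_def)
  show ?case
  proof (cases "j < 2")
    case True
    then have "j = 0 \<or> j = 1" by auto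
    then show ?thesis by (auto simp: e)
  next
    case False
    then obtain i where i: "j = Suc (Suc i)" by (metis Suc_1 add_2_eq_Suc le_add_diff_inverse not_less)
    then show ?thesis using Cons.IH[of i] Cons.prems by (simp add: e)
  qed
qed

lemma length_enc_bits: "length (enc_bits x) = 2 * length x + 1"
  by (induction x) (auto simp: enc_bits_def)

lemma mod_succ:
  fixes W :: nat
  shows "i < W \<Longrightarrow> (i + 1) mod W = (if i = W - 1 then 0 else i + 1)"
  by auto

lemma mod_pred:
  fixes W :: nat
  assumes "i < W"
  shows "(i + W - 1) mod W = (if i = 0 then W - 1 else i - 1)"
proof (cases i)
  case (Suc k)
  then have "i + W - 1 = k + W" by simp
  then show ?thesis using Suc assms by simp
qed (use assms in auto)

lemma mod_succ_pred:
  fixes W :: nat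
  assumes "i < W"
  shows "((i + W - 1) mod W + 1) mod W = i" "((i + 1) mod W + W - 1) mod W = i"
proof -
  have W: "W - 1 < W" "0 < W" using assms by auto
  show "((i + W - 1) mod W + 1) mod W = i"
    unfolding mod_pred[OF assms] using mod_succ[of "i - 1" W] mod_succ[OF W(1)] assms by auto
  show "((i + 1) mod W + W - 1) mod W = i"
    unfolding mod_succ[OF assms] using mod_pred[of "i + 1" W] mod_pred[OF W(2)] assms by auto
qed

text \<open>Within \<open>T\<close> steps the heads stay away from the first and the last column.
  Around them the cyclic neighbours are the true ones, and at the seam both sides are false.\<close>

lemma head_wrap:
  fixes h d :: int and W ob i T :: nat
  assumes i: "i < W" and h: "\<bar>h\<bar> \<le> int T" and ob: "T < ob" "ob + T + 1 < W" and d: "d \<in> {- 1, 0, 1}"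
  shows "h + d = int i - int ob \<longleftrightarrow> h = int i - int ob \<and> d = 0 \<or>
    h = int ((i + W - 1) mod W) - int ob \<and> d = 1 \<or> h = int ((i + 1) mod W) - int ob \<and> d = - 1"
  unfolding mod_succ[OF i] mod_pred[OF i] using assms by (auto split: if_splits simp: of_nat_diff)

lemma cell_index:
  fixes W :: nat
  assumes "i < W"
  shows "(t * W + i) div W = t" "(t * W + i) mod W = i"
  using assms by simp_all

lemma cell_index_less:
  fixes W H :: nat
  assumes "t < H" "i < W"
  shows "t * W + i < H * W"
proof -
  have "t * W + i < (t + 1) * W" using assms by simp
  also have "\<dots> \<le> H * W" using assms by (intro mult_le_mono1) simp
  finally show ?thesis .
qed

lemma bij_up_cell: "0 < W \<Longrightarrow> 0 < H \<Longrightarrow> bij_betw (up_cell H W) {..<H * W} {..<H * W}"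
proof -
  assume W: "0 < W" and H: "0 < H"
  let ?dn = "\<lambda>p. (p div W + H - 1) mod H * W + p mod W"
  have p: "p div W < H" "p mod W < W" if "p < H * W" for p
    using that W by (auto simp: less_mult_imp_div_less)
  show ?thesis
  proof (rule bij_betw_byWitness[where f' = ?dn])
    show "\<forall>a\<in>{..<H * W}. ?dn (up_cell H W a) = a"
      using p mod_succ_pred(2)[of _ H] by (auto simp: up_cell_def cell_index)
    show "\<forall>a\<in>{..<H * W}. up_cell H W (?dn a) = a"
      using p mod_succ_pred(1)[of _ H] by (auto simp: up_cell_def cell_index)
  qed (use p W H in \<open>auto simp: up_cell_def intro!: cell_index_less\<close>)
qed

lemma bij_right_cell: "0 < W \<Longrightarrow> bij_betw (right_cell W) {..<H * W} {..<H * W}"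
proof -
  assume W: "0 < W"
  let ?lf = "\<lambda>p. p div W * W + (p mod W + W - 1) mod W"
  have p: "p div W < H" "p mod W < W" if "p < H * W" for p
    using that W by (auto simp: less_mult_imp_div_less)
  show ?thesis
  proof (rule bij_betw_byWitness[where f' = ?lf])
    show "\<forall>a\<in>{..<H * W}. ?lf (right_cell W a) = a"
      using p mod_succ_pred(2)[of _ W] W by (auto simp: right_cell_def cell_index)
    show "\<forall>a\<in>{..<H * W}. right_cell W (?lf a) = a"
      using p mod_succ_pred(1)[of _ W] W by (auto simp: right_cell_def cell_index)
  qed (use p W in \<open>auto simp: right_cell_def intro!: cell_index_less\<close>)
qed

locale tableau =
  fixes M :: tm and e :: "nat \<Rightarrow> cell" and G T W Q :: nat and x :: "bool list" and R :: "bool list set"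
  assumes wf: "wf_tm M" and e: "bij_betw e {..<G} (cells M)"
    and W: "2 * T + 2 * length x + Q + 4 \<le> W"
    and computes: "\<And>y. length y \<le> 2 * length x + 1 + Q \<Longrightarrow> \<exists>t\<le>T. tm_computes_in M y [y \<in> R] t"
begin

abbreviation "k \<equiv> tm_tapes M"
abbreviation "ob \<equiv> T + 1"
abbreviation "ok \<equiv> cell_ok M e G x T W Q"
abbreviation "config y t \<equiv> (tm_step M ^^ t) (tm_init M y)"
abbreviation "lt i \<equiv> (i + W - 1) mod W"
abbreviation "rt i \<equiv> (i + 1) mod W"

lemma k_pos: "1 \<le> k" and states: "2 \<le> tm_states M" and symbols: "3 \<le> tm_symbols M"
  using wf by (auto simp: wf_tm_def)

lemma W_pos: "0 < W" using W by simp

lemma next_step: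
  assumes "q < tm_states M" "length a = k" "set a \<subseteq> {..<tm_symbols M}" "next_step M q a = (q', acts)"
  shows "q' < tm_states M" "length acts = k"
    "\<And>j. j < k \<Longrightarrow> fst (acts ! j) < tm_symbols M \<and> snd (acts ! j) \<in> {- 1, 0, 1}"
proof -
  have "q' < tm_states M \<and> length acts = k \<and> (\<forall>(b, d)\<in>set acts. b < tm_symbols M \<and> d \<in> {- 1, 0, 1})"
  proof (cases "q = 1")
    case True
    then show ?thesis using assms states by (auto simp: next_step_def keep_def)
  next
    case False
    then show ?thesis using wf assms unfolding wf_tm_def next_step_def by fastforce
  qed
  then show "q' < tm_states M" "length acts = k"
    "\<And>j. j < k \<Longrightarrow> fst (acts ! j) < tm_symbols M \<and> snd (acts ! j) \<in> {- 1, 0, 1}"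
    by (auto simp: case_prod_unfold)
qed

lemma tm_step_next:
  "next_step M q (tape_reads ts) = (q', acts) \<Longrightarrow> tm_step M (q, ts) = (q', tape_acts ts acts)"
  by (auto simp: next_step_def tm_step_def tape_acts_keep split: if_splits)

lemma tape_acts_nth:
  assumes "length ts = k" "length acts = k" "j < k"
  shows "tape_acts ts acts ! j = ((fst (ts ! j))(snd (ts ! j) := fst (acts ! j)), snd (ts ! j) + snd (acts ! j))"
  using assms by (simp add: case_prod_unfold)

lemma tape_bound:
  assumes "length ts = k" "\<forall>j<k. (\<forall>z. fst (ts ! j) z < n) \<and> P j" "(tp, h) \<in> set ts"
  shows "tp z < n"
  using assms by (metis fst_conv in_set_conv_nth)

lemma config_wf:
  assumes "config y t = (q, ts)"
  shows "q < tm_states M \<and> length ts = k \<and> (\<forall>j<k. (\<forall>z. fst (ts ! j) z < tm_symbols M) \<and> \<bar>snd (ts ! j)\<bar> \<le> int t)"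
  using assms
proof (induction t arbitrary: q ts)
  case 0
  then show ?case using k_pos states symbols by (auto simp: tm_init_def tape_of_def nth_Cons' less_Suc_eq)
next
  case (Suc t)
  obtain q0 ts0 where c: "config y t = (q0, ts0)" by (metis surj_pair)
  note ih = Suc.IH[OF c]
  obtain q' acts where n: "next_step M q0 (tape_reads ts0) = (q', acts)" by (metis surj_pair)
  have r: "length (tape_reads ts0) = k" "set (tape_reads ts0) \<subseteq> {..<tm_symbols M}"
    using ih by (auto intro: tape_bound)
  note ns = next_step[OF _ r n]
  have "(q, ts) = (q', tape_acts ts0 acts)"
    using Suc.prems c tm_step_next[OF n] by simp
  then have qt: "q = q'" "ts = tape_acts ts0 acts" by auto
  show ?case
  proof (intro conjI allI impI)
    show "q < tm_states M" "length ts = k" using qt ns ih by auto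
    fix j assume j: "j < k"
    have nj: "ts ! j = ((fst (ts0 ! j))(snd (ts0 ! j) := fst (acts ! j)), snd (ts0 ! j) + snd (acts ! j))"
      using tape_acts_nth[OF _ _ j] ih ns qt by simp
    show "fst (ts ! j) z < tm_symbols M" for z using nj ih ns(3)[OF _ j] j by auto
    show "\<bar>snd (ts ! j)\<bar> \<le> int (Suc t)" using nj ih ns(3)[OF _ j] j by fastforce
  qed
qed

definition cell_of :: "tm_config \<Rightarrow> nat \<Rightarrow> cell" where
  "cell_of c i = (map (\<lambda>(tp, h). tp (int i - int ob)) (snd c), map (\<lambda>(tp, h). h = int i - int ob) (snd c),
     fst c, tape_reads (snd c))"

lemma cell_of_cells: "cell_of (config y t) i \<in> cells M"
proof -
  obtain q ts where c: "config y t = (q, ts)" by (metis surj_pair)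
  show ?thesis using config_wf[OF c] unfolding c
    by (auto simp: cell_of_def cells_def intro: tape_bound)
qed

text \<open>In the certificate region only the pattern is prescribed: once blank, always blank. The
  cell before that region holds the last bit of \<open>enc_bits x\<close>, so a certificate of any
  length up to \<open>Q\<close> has this pattern.\<close>

lemma init_cell:
  assumes "i < W" "length w \<le> Q" and y: "y = enc_bits x @ w"
  shows "tape_of y (int i - int ob) \<le> 2"
    and "if kind x ob Q i mod 4 = 3 then ob + 2 * length x + 1 \<le> i \<and>
        (tape_of y (int i - int ob - 1) = 0 \<longrightarrow> tape_of y (int i - int ob) = 0)
      else tape_of y (int i - int ob) = kind x ob Q i mod 4"
    and "4 \<le> kind x ob Q i \<longleftrightarrow> i = ob"
proof -
  show "tape_of y (int i - int ob) \<le> 2" by (simp add: tape_of_def)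
  show "4 \<le> kind x ob Q i \<longleftrightarrow> i = ob" by (auto simp: kind_def)
  show "if kind x ob Q i mod 4 = 3 then ob + 2 * length x + 1 \<le> i \<and>
        (tape_of y (int i - int ob - 1) = 0 \<longrightarrow> tape_of y (int i - int ob) = 0)
      else tape_of y (int i - int ob) = kind x ob Q i mod 4"
  proof (cases "i < ob")
    case True
    then show ?thesis by (simp add: kind_def tape_of_def)
  next
    case False
    define j where "j = i - ob"
    have ij: "int i - int ob = int j" "i = j + ob" using False by (auto simp: j_def)
    show ?thesis
    proof (cases "j < 2 * length x + 1")
      case True
      have b: "enc_bits x ! j \<longleftrightarrow> j < 2 * length x \<and> \<not> (\<not> 2 dvd j \<and> \<not> (j div 2 < length x \<and> x ! (j div 2)))"
        unfolding enc_bits_nth[OF True] by auto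
      have "kind x ob Q i = (if enc_bits x ! j then 2 else 1) + (if i = ob then 4 else 0)"
        using False True unfolding kind_def b by (simp add: j_def)
      moreover have "tape_of y (int j) = (if enc_bits x ! j then 2 else 1)"
        using True by (simp add: tape_of_def y nth_append length_enc_bits)
      ultimately show ?thesis unfolding ij(1) by simp
    next
      case False': False
      show ?thesis
      proof (cases "j < 2 * length x + 1 + Q")
        case True
        have "kind x ob Q i = 3" using False False' True by (simp add: kind_def j_def)
        moreover have "tape_of y (int j - 1) = 0 \<longrightarrow> tape_of y (int j) = 0"
          using False' by (auto simp: tape_of_def)
        ultimately show ?thesis using ij False' by simp
      next
        case F3: False
        then have "kind x ob Q i = 0" using False False' by (simp add: kind_def j_def)
        moreover have "tape_of y (int j) = 0" using F3 assms(2) by (simp add: tape_of_def y length_enc_bits)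
        ultimately show ?thesis using ij by simp
      qed
    qed
  qed
qed

lemma config_halted:
  assumes "tm_computes_in M y out t" "t \<le> t'"
  shows "fst (config y t') = 1 \<and> fst (last (snd (config y t'))) = tape_of out"
proof -
  have h: "fst (config y t) = 1" "fst (last (snd (config y t))) = tape_of out"
    using assms(1) by (auto simp: tm_computes_in_def case_prod_unfold)
  have "config y (t + d) = config y t" for d
  proof (induction d)
    case (Suc d)
    have "config y (t + Suc d) = tm_step M (config y t)" using Suc by simp
    also have "\<dots> = config y t" using h by (simp add: tm_step_def case_prod_unfold)
    finally show ?case .
  qed simp
  from this[of "t' - t"] show ?thesis using assms(2) h by simp
qed

lemma step_cell_of:
  assumes c: "config y t = (q, ts)" and t: "t < T" and i: "i < W" and j: "j < k"
    and n: "next_step M q (tape_reads ts) = (q', acts)"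
  shows "fst (config y (Suc t)) = q'"
    and "syms (cell_of (config y (Suc t)) i) ! j =
      (if heads (cell_of (config y t) i) ! j then fst (acts ! j) else syms (cell_of (config y t) i) ! j)"
    and "heads (cell_of (config y (Suc t)) i) ! j \<longleftrightarrow> heads (cell_of (config y t) i) ! j \<and> snd (acts ! j) = 0 \<or>
      heads (cell_of (config y t) (lt i)) ! j \<and> snd (acts ! j) = 1 \<or>
      heads (cell_of (config y t) (rt i)) ! j \<and> snd (acts ! j) = - 1"
proof -
  note w = config_wf[OF c]
  have r: "length (tape_reads ts) = k" "set (tape_reads ts) \<subseteq> {..<tm_symbols M}"
    using w by (auto intro: tape_bound)
  note ns = next_step[OF _ r n]
  have c': "config y (Suc t) = (q', tape_acts ts acts)" using c tm_step_next[OF n] by simp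
  have len: "length ts = k" "length acts = k" using w ns by auto
  note nj = tape_acts_nth[OF len j]
  show "fst (config y (Suc t)) = q'" using c' by simp
  have g: "syms (cell_of (q0, us) i') ! j = fst (us ! j) (int i' - int ob)"
    "heads (cell_of (q0, us) i') ! j \<longleftrightarrow> snd (us ! j) = int i' - int ob" if "length us = k" for q0 us i'
    using that j by (simp_all add: cell_of_def case_prod_unfold)
  have lu: "length (tape_acts ts acts) = k" using len by simp
  show "syms (cell_of (config y (Suc t)) i) ! j =
      (if heads (cell_of (config y t) i) ! j then fst (acts ! j) else syms (cell_of (config y t) i) ! j)"
    unfolding c c' g[OF lu] g[OF len(1)] nj by auto
  have hw: "\<bar>snd (ts ! j)\<bar> \<le> int T" using w j t by fastforce
  show "heads (cell_of (config y (Suc t)) i) ! j \<longleftrightarrow> heads (cell_of (config y t) i) ! j \<and> snd (acts ! j) = 0 \<or>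
      heads (cell_of (config y t) (lt i)) ! j \<and> snd (acts ! j) = 1 \<or>
      heads (cell_of (config y t) (rt i)) ! j \<and> snd (acts ! j) = - 1"
    unfolding c c' g[OF lu] g[OF len(1)] nj snd_conv
    using head_wrap[OF i hw, of ob "snd (acts ! j)"] ns(3)[OF _ j] w W by auto
qed

lemma tile_of_run:
  assumes w: "length w \<le> Q" and R: "enc_bits x @ w \<in> R" and t: "t \<le> T" and i: "i < W"
  defines "c \<equiv> \<lambda>t. cell_of (config (enc_bits x @ w) t)"
  shows "tile_ok M (t = 0) (t = T) (kind x ob Q i) (c t (lt i)) (c t i) (c t (rt i)) (c (Suc t) i)"
proof -
  let ?y = "enc_bits x @ w"
  obtain q ts where cf: "config ?y t = (q, ts)" by (metis surj_pair)
  note wf = config_wf[OF cf]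
  have "row_ok M (c t (lt i)) (c t i) (c t (rt i))"
    using wf by (auto simp: row_ok_def c_def cell_of_def cf case_prod_unfold)
  moreover have "init_ok M (kind x ob Q i) (c 0 (lt i)) (c 0 i)"
  proof -
    have i0: "config ?y 0 = (0, (tape_of ?y, 0) # replicate (k - 1) (tape_of [], 0))" by (simp add: tm_init_def)
    note ic = init_cell[OF i w refl]
    have k0: "syms (c 0 i') ! 0 = tape_of ?y (int i' - int ob)" for i'
      unfolding c_def i0 by (simp add: cell_of_def)
    have pred: "tape_of ?y (int i - int ob - 1) = tape_of ?y (int (lt i) - int ob)" if "ob + 2 * length x + 1 \<le> i"
    proof -
      have "int i - int ob - 1 = int (lt i) - int ob" unfolding mod_pred[OF i] using that by (simp add: of_nat_diff)
      then show ?thesis by (simp only:)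
    qed
    have "if kind x ob Q i mod 4 = 3 then syms (c 0 i) ! 0 \<le> 2 \<and> (syms (c 0 (lt i)) ! 0 = 0 \<longrightarrow> syms (c 0 i) ! 0 = 0)
        else syms (c 0 i) ! 0 = kind x ob Q i mod 4"
    proof (cases "kind x ob Q i mod 4 = 3")
      case True
      have "ob + 2 * length x + 1 \<le> i \<and> (tape_of ?y (int i - int ob - 1) = 0 \<longrightarrow> tape_of ?y (int i - int ob) = 0)"
        using ic(2) unfolding if_P[OF True] .
      then show ?thesis unfolding if_P[OF True] k0 using ic(1) pred by metis
    next
      case False
      show ?thesis using ic(2) unfolding if_not_P[OF False] k0 .
    qed
    moreover have "heads (c 0 i) ! j \<longleftrightarrow> 4 \<le> kind x ob Q i" if "j < k" for j
      unfolding c_def i0 ic(3) using that by (cases j) (auto simp: cell_of_def)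
    moreover have "syms (c 0 i) ! j = 0" if "j < k" "0 < j" for j
      unfolding c_def i0 using that by (cases j) (auto simp: cell_of_def tape_of_def)
    moreover have "qstate (c 0 i) = 0" unfolding c_def i0 by (simp add: cell_of_def)
    ultimately show ?thesis unfolding init_ok_def by blast
  qed
  moreover have "final_ok M (kind x ob Q i) (c T i)"
  proof -
    have "length ?y \<le> 2 * length x + 1 + Q" using w by (simp add: length_enc_bits)
    then obtain t' where "t' \<le> T" "tm_computes_in M ?y [?y \<in> R] t'" using computes by blast
    then have h: "fst (config ?y T) = 1" "fst (last (snd (config ?y T))) = tape_of [True]"
      using config_halted R by auto
    obtain q ts where cf: "config ?y T = (q, ts)" by (metis surj_pair)
    note wf = config_wf[OF cf]
    have "ts \<noteq> []" using wf k_pos by auto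
    then have "last ts = ts ! (k - 1)" using wf by (simp add: last_conv_nth)
    then have "fst (ts ! (k - 1)) = tape_of [True]" using h(2) cf by simp
    then have "syms (c T ob) ! (k - 1) = 2"
      using wf k_pos by (simp add: c_def cf cell_of_def case_prod_unfold tape_of_def)
    then show ?thesis using h(1) init_cell(3)[OF i w refl] by (auto simp: final_ok_def c_def cell_of_def)
  qed
  moreover have "step_ok M (c t (lt i)) (c t i) (c t (rt i)) (c (Suc t) i)" if "t < T"
  proof -
    obtain q' acts where n: "next_step M q (tape_reads ts) = (q', acts)" by (metis surj_pair)
    have e: "qstate (c t i) = q" "guess (c t i) = tape_reads ts" by (simp_all add: c_def cf cell_of_def)
    have "qstate (c (Suc t) i) = fst (config ?y (Suc t))" by (simp only: c_def cell_of_def fst_conv snd_conv)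
    also have "\<dots> = q'" by (rule step_cell_of(1)[OF cf that i _ n, of 0]) (use k_pos in simp)
    finally show ?thesis
      unfolding step_ok_def e n prod.case unfolding c_def
      using step_cell_of(2,3)[OF cf that i _ n] by blast
  qed
  ultimately show ?thesis using t unfolding tile_ok_def by auto
qed

lemma accepting_imp_tiling:
  assumes w: "length w \<le> Q" and R: "enc_bits x @ w \<in> R"
  shows "\<exists>\<tau>. tiling ((T + 1) * W) (up_cell (T + 1) W) (right_cell W) G ok \<tau>"
proof -
  define c where "c t = cell_of (config (enc_bits x @ w) t)" for t
  define en where "en c = the_inv_into {..<G} e c" for c
  have en: "en (c t i) < G" "e (en (c t i)) = c t i" for t i
  proof -
    have "c t i \<in> cells M" unfolding c_def by (rule cell_of_cells)
    then show "e (en (c t i)) = c t i" "en (c t i) < G"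
      unfolding en_def using e bij_betw_the_inv_into[OF e]
      by (auto simp: f_the_inv_into_f_bij_betw dest: bij_betwE)
  qed
  \<comment> \<open>Base \<open>G\<close> digits 0 to 3 are the codes of the left, own, right and
    upper cell, in the order in which \<open>cell_ok\<close> decodes them.\<close>
  define \<tau> where "\<tau> p = (let t = p div W; i = p mod W in
    en (c t (lt i)) + G * en (c t i) + G ^ 2 * en (c t (rt i)) + G ^ 3 * en (c ((t + 1) mod (T + 1)) i))" for p
  have G: "0 < G" using en(1)[of 0 0] by simp
  have quad: "base_digit G (a0 + G * a1 + G ^ 2 * a2 + G ^ 3 * a3) 0 = a0"
    "base_digit G (a0 + G * a1 + G ^ 2 * a2 + G ^ 3 * a3) 1 = a1"
    "base_digit G (a0 + G * a1 + G ^ 2 * a2 + G ^ 3 * a3) 2 = a2"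
    "base_digit G (a0 + G * a1 + G ^ 2 * a2 + G ^ 3 * a3) 3 = a3"
    "a0 + G * a1 + G ^ 2 * a2 + G ^ 3 * a3 < G ^ 4"
    if "a0 < G" "a1 < G" "a2 < G" "a3 < G" for a0 a1 a2 a3
  proof -
    let ?u = "a0 + G * a1 + G ^ 2 * a2 + G ^ 3 * a3"
    have e: "?u = a0 + G * (a1 + G * (a2 + G * a3))" by (simp add: algebra_simps power2_eq_square power3_eq_cube)
    have d1: "?u div G = a1 + G * (a2 + G * a3)" unfolding e using that(1) G by simp
    have d2: "?u div G ^ 2 = a2 + G * a3"
    proof -
      have "?u div G ^ 2 = ?u div G div G" by (simp only: power2_eq_square div_mult2_eq)
      also have "\<dots> = a2 + G * a3" unfolding d1 using that(2) G by simp
      finally show ?thesis .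
    qed
    have d3: "?u div G ^ 3 = a3"
    proof -
      have "?u div G ^ 3 = ?u div G ^ 2 div G" by (simp only: power3_eq_cube power2_eq_square div_mult2_eq)
      also have "\<dots> = a3" unfolding d2 using that(3) G by simp
      finally show ?thesis .
    qed
    show "base_digit G ?u 0 = a0" unfolding base_digit_def e using that(1) by simp
    show "base_digit G ?u 1 = a1" unfolding base_digit_def using d1 that(2) by simp
    show "base_digit G ?u 2 = a2" unfolding base_digit_def d2 using that(3) by simp
    show "base_digit G ?u 3 = a3" unfolding base_digit_def d3 using that(4) by simp
    have "?u < G ^ 3 * (a3 + 1)"
    proof -
      have "a0 + G * (a1 + G * a2) < G * (G * G)"
      proof -
        have "a1 + G * a2 < G * (a2 + 1)" using that(2) by simp
        also have "\<dots> \<le> G * G" using that(3) by (intro mult_le_mono2) simp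
        finally have "a1 + G * a2 + 1 \<le> G * G" by simp
        then have "G * (a1 + G * a2 + 1) \<le> G * (G * G)" by (rule mult_le_mono2)
        then show ?thesis using that(1) by simp
      qed
      then show ?thesis by (simp add: algebra_simps power2_eq_square power3_eq_cube)
    qed
    also have "\<dots> \<le> G ^ 3 * G" using that(4) by (intro mult_le_mono2) simp
    finally show "?u < G ^ 4" by (simp add: power_eq_if)
  qed
  have tau: "\<tau> (t * W + i) < G ^ 4" "base_digit G (\<tau> (t * W + i)) 0 = en (c t (lt i))"
    "base_digit G (\<tau> (t * W + i)) 1 = en (c t i)" "base_digit G (\<tau> (t * W + i)) 2 = en (c t (rt i))"
    "base_digit G (\<tau> (t * W + i)) 3 = en (c ((t + 1) mod (T + 1)) i)" if "i < W" for t i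
    unfolding \<tau>_def Let_def cell_index[OF that] using quad en(1) by auto
  have "tiling ((T + 1) * W) (up_cell (T + 1) W) (right_cell W) G ok \<tau>"
    unfolding tiling_def
  proof (intro allI impI)
    fix p assume p: "p < (T + 1) * W"
    define t i where "t = p div W" and "i = p mod W"
    have ti: "t \<le> T" "i < W" "p = t * W + i"
      using p W_pos by (auto simp: t_def i_def less_mult_imp_div_less less_Suc_eq_le[symmetric] simp flip: Suc_eq_plus1)
    have uc: "up_cell (T + 1) W p = (t + 1) mod (T + 1) * W + i" by (simp add: up_cell_def t_def i_def)
    have rc: "right_cell W p = t * W + rt i" by (simp add: right_cell_def t_def i_def)
    have rtl: "rt i < W" using W_pos by simp
    have "tile_ok M (t = 0) (t = T) (kind x ob Q i) (c t (lt i)) (c t i) (c t (rt i)) (c (Suc t) i)"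
      unfolding c_def by (rule tile_of_run[OF w R ti(1,2)])
    \<comment> \<open>In row \<open>T\<close> the upper neighbour on the torus is in row 0 rather
      than in a further configuration, which is harmless because the last row has no transition
      condition.\<close>
    then have "tile_ok M (t = 0) (t = T) (kind x ob Q i) (c t (lt i)) (c t i) (c t (rt i)) (c ((t + 1) mod (T + 1)) i)"
      using ti(1) by (cases "t = T") (auto simp: tile_ok_def)
    then have "ok p (\<tau> p)"
      unfolding cell_ok_def ti(3) cell_index[OF ti(2)] tau[OF ti(2)] en(2) .
    then show "\<tau> p < G ^ 4 \<and> ok p (\<tau> p) \<and>
       base_digit G (\<tau> p) 3 = base_digit G (\<tau> (up_cell (T + 1) W p)) 1 \<and>
       base_digit G (\<tau> p) 1 + G * base_digit G (\<tau> p) 2 =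
       base_digit G (\<tau> (right_cell W p)) 0 + G * base_digit G (\<tau> (right_cell W p)) 1"
      unfolding uc rc tau[OF ti(2)] tau[OF rtl] mod_succ_pred(2)[OF ti(2)]
      using tau[OF ti(2), of t] ti(3) by simp
  qed
  then show ?thesis by blast
qed

lemma tiling_imp_accepting:
  assumes \<tau>: "tiling ((T + 1) * W) (up_cell (T + 1) W) (right_cell W) G ok \<tau>"
  shows "\<exists>w. length w \<le> Q \<and> enc_bits x @ w \<in> R"
proof -
  have "(\<tau> 0) < G ^ 4" using \<tau> W_pos by (simp add: tiling_def)
  then have G: "0 < G" by (cases G) auto
  have dl: "base_digit G u n < G" for u n using G by (simp add: base_digit_def)
  define c where "c t i = e (base_digit G (\<tau> (t * W + i)) 1)" for t i
  have cells: "c t i \<in> cells M" for t i using bij_betwE[OF e] dl by (auto simp: c_def)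
  have tile: "tile_ok M (t = 0) (t = T) (kind x ob Q i) (c t (lt i)) (c t i) (c t (rt i)) (c ((t + 1) mod (T + 1)) i)"
    if t: "t \<le> T" and i: "i < W" for t i
  proof -
    have W1: "lt i < W" "rt i < W" using W_pos by auto
    have hor: "base_digit G (\<tau> (t * W + i')) 1 = base_digit G (\<tau> (t * W + rt i')) 0 \<and>
        base_digit G (\<tau> (t * W + i')) 2 = base_digit G (\<tau> (t * W + rt i')) 1" if i': "i' < W" for i'
    proof -
      have p: "t * W + i' < (T + 1) * W" using t i' by (intro cell_index_less) auto
      have "base_digit G (\<tau> (t * W + i')) 1 + G * base_digit G (\<tau> (t * W + i')) 2 =
        base_digit G (\<tau> (t * W + rt i')) 0 + G * base_digit G (\<tau> (t * W + rt i')) 1"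
        using \<tau>[unfolded tiling_def, rule_format, OF p] unfolding right_cell_def cell_index[OF i'] by blast
      then have "base_digit G (\<tau> (t * W + i')) 2 * G + base_digit G (\<tau> (t * W + i')) 1 =
        base_digit G (\<tau> (t * W + rt i')) 1 * G + base_digit G (\<tau> (t * W + rt i')) 0" by (simp only: add.commute mult.commute)
      then show ?thesis unfolding mult_add_eq_iff[OF dl dl] by blast
    qed
    have p: "t * W + i < (T + 1) * W" using t i by (intro cell_index_less) auto
    have "ok (t * W + i) (\<tau> (t * W + i))" "base_digit G (\<tau> (t * W + i)) 3 = base_digit G (\<tau> ((t + 1) mod (T + 1) * W + i)) 1"
      using \<tau>[unfolded tiling_def, rule_format, OF p] unfolding up_cell_def cell_index[OF i] by blast+
    moreover have "base_digit G (\<tau> (t * W + i)) 0 = base_digit G (\<tau> (t * W + lt i)) 1"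
      using hor[OF W1(1)] mod_succ_pred(1)[OF i] by simp
    moreover have "base_digit G (\<tau> (t * W + i)) 2 = base_digit G (\<tau> (t * W + rt i)) 1"
      using hor[OF i] by simp
    ultimately show ?thesis unfolding cell_ok_def cell_index[OF i] c_def by simp
  qed
  have row: "row_ok M (c t (lt i)) (c t i) (c t (rt i))" if "t \<le> T" "i < W" for t i
    using tile[OF that] by (simp add: tile_ok_def)
  have const: "snd (snd (c t i)) = snd (snd (c t 0))" if t: "t \<le> T" and i: "i < W" for t i
    using i
  proof (induction i)
    case (Suc i)
    have "rt i = Suc i" using Suc.prems by simp
    then show ?case using row[OF t, of i] Suc by (simp add: row_ok_def)
  qed simp
  define g0 where "g0 = ob + 2 * length x + 1"
  have init: "init_ok M (kind x ob Q i) (c 0 (lt i)) (c 0 i)" if "i < W" for i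
    using tile[of 0 i] that by (simp add: tile_ok_def)
  have step: "step_ok M (c t (lt i)) (c t i) (c t (rt i)) (c (Suc t) i)" if "t < T" "i < W" for t i
    using tile[of t i] that by (simp add: tile_ok_def)
  have final: "final_ok M (kind x ob Q i) (c T i)" if "i < W" for i
    using tile[of T i] that by (simp add: tile_ok_def)
  define s where "s l = syms (c 0 (g0 + l)) ! 0" for l
  \<comment> \<open>The first blank of the guessed region, or \<open>Q\<close> if there is none. The
    blank-after-blank rule makes all later cells of the region blank, so row 0 contains a word of
    length \<open>L\<close>.\<close>
  define L where "L = (LEAST l. l = Q \<or> s l = 0)"
  have LQ: "L \<le> Q" unfolding L_def by (rule Least_le) simp
  have L0: "L = Q \<or> s L = 0" unfolding L_def by (rule LeastI[of _ Q]) simp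
  have Lmin: "s l \<noteq> 0" if "l < L" for l
    using not_less_Least[OF that[unfolded L_def]] by blast
  have kg: "kind x ob Q (g0 + l) = 3" if "l < Q" for l
    using that by (simp add: kind_def g0_def)
  have sg: "s l \<le> 2" if "l < Q" for l
    using init[of "g0 + l"] kg[OF that] that W by (simp add: init_ok_def s_def g0_def)
  have s0: "s l = 0" if "L \<le> l" "l < Q" for l
    using that
  proof (induction l rule: dec_induct)
    case base
    then show ?case using L0 by auto
  next
    case (step l)
    have "g0 + Suc l < W" using step.prems W by (simp add: g0_def)
    moreover from this have "lt (g0 + Suc l) = g0 + l" using mod_pred[of "g0 + Suc l" W] by simp
    ultimately show ?case using init[of "g0 + Suc l"] kg[OF step.prems] step by (simp add: init_ok_def s_def)
  qed
  define w where "w = map (\<lambda>l. s l = 2) [0..<L]"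
  define y where "y = enc_bits x @ w"
  have w: "length w \<le> Q" using LQ by (simp add: w_def)
  have ly: "length y = 2 * length x + 1 + L" by (simp add: y_def w_def length_enc_bits)
  have row0: "syms (c 0 i) ! 0 = tape_of y (int i - int ob)" if i: "i < W" for i
  proof (cases "kind x ob Q i mod 4 = 3")
    case True
    then have gi: "g0 \<le> i" using init_cell(2)[OF i w y_def] by (simp add: g0_def)
    then obtain l where l: "i = g0 + l" using le_Suc_ex by blast
    have lQ: "l < Q"
    proof (rule ccontr)
      assume "\<not> l < Q"
      then have "kind x ob Q i = 0" using l by (simp add: kind_def g0_def)
      then show False using True by simp
    qed
    have z: "int i - int ob = int (2 * length x + 1 + l)" by (simp add: l g0_def)
    have tn: "tape_of y (int j) = (if j < length y then if y ! j then 2 else 1 else 0)" for j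
      by (simp add: tape_of_def)
    show ?thesis
    proof (cases "l < L")
      case True
      have "s l = 1 \<or> s l = 2" using sg[OF lQ] Lmin[OF True] by linarith
      moreover have "y ! (2 * length x + 1 + l) = (s l = 2)"
        using True by (simp add: y_def w_def nth_append length_enc_bits)
      ultimately show ?thesis unfolding z tn using True ly by (auto simp: s_def l)
    next
      case False
      then show ?thesis unfolding z tn using s0[of l] lQ ly by (simp add: s_def l)
    qed
  next
    case False
    then show ?thesis using init[OF i] init_cell(2)[OF i w y_def] by (simp add: init_ok_def)
  qed
  \<comment> \<open>The guessed head symbols are determined by the rest of the row: each head lies
    in some column \<open>i'\<close> of the row, there \<open>row_ok\<close> compares its guess with
    the symbol, and the guess is constant along the row.\<close>
  have fill: "c t i = cell_of (config y t) i"
    if t: "t \<le> T" and i: "i < W" and eq: "\<And>i j. i < W \<Longrightarrow> j < k \<Longrightarrow> syms (c t i) ! j = syms (cell_of (config y t) i) ! j \<and>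
      heads (c t i) ! j = heads (cell_of (config y t) i) ! j \<and> qstate (c t i) = fst (config y t)" for t i
  proof -
    obtain q ts where cf: "config y t = (q, ts)" by (metis surj_pair)
    note wf = config_wf[OF cf]
    have lens: "length (syms (c t i)) = k" "length (heads (c t i)) = k" "length (guess (c t i)) = k"
      using cells[of t i] by (auto simp: cells_def)
    have "guess (c t i) ! j = tape_reads ts ! j" if j: "j < k" for j
    proof -
      define i' where "i' = nat (snd (ts ! j) + int ob)"
      have "\<bar>snd (ts ! j)\<bar> \<le> int t" using wf j by blast
      then have i': "int i' = snd (ts ! j) + int ob" "i' < W" using t W by (auto simp: i'_def)
      have "heads (c t i') ! j" using eq[OF i'(2) j] i'(1) wf j by (simp add: cf cell_of_def case_prod_unfold)
      then have "syms (c t i') ! j = guess (c t i') ! j" using row[OF t i'(2)] j by (simp add: row_ok_def)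
      moreover have "guess (c t i') = guess (c t i)" using const[OF t i'(2)] const[OF t i] by simp
      ultimately show ?thesis using eq[OF i'(2) j] i'(1) wf j by (simp add: cf cell_of_def case_prod_unfold)
    qed
    then have "guess (c t i) = tape_reads ts" using lens wf by (intro nth_equalityI) auto
    moreover have "syms (c t i) = syms (cell_of (config y t) i)" "heads (c t i) = heads (cell_of (config y t) i)"
      using lens wf eq[OF i] by (auto simp: cf cell_of_def intro!: nth_equalityI)
    moreover have "qstate (c t i) = q" using eq[OF i, of 0] k_pos cf by simp
    ultimately show ?thesis by (simp add: prod_eq_iff cell_of_def cf)
  qed
  have inv: "\<forall>i<W. c t i = cell_of (config y t) i" if "t \<le> T" for t
    using that
  proof (induction t)
    case 0
    have i0: "config y 0 = (0, (tape_of y, 0) # replicate (k - 1) (tape_of [], 0))" by (simp add: tm_init_def)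
    have "syms (c 0 i) ! j = syms (cell_of (config y 0) i) ! j \<and> heads (c 0 i) ! j = heads (cell_of (config y 0) i) ! j \<and>
      qstate (c 0 i) = fst (config y 0)" if i: "i < W" and j: "j < k" for i j
    proof (intro conjI)
      show "syms (c 0 i) ! j = syms (cell_of (config y 0) i) ! j"
        unfolding i0 using row0[OF i] init[OF i] j by (cases j) (auto simp: cell_of_def init_ok_def tape_of_def)
      show "heads (c 0 i) ! j = heads (cell_of (config y 0) i) ! j"
        unfolding i0 using init_cell(3)[OF i w y_def] init[OF i] j by (cases j) (auto simp: cell_of_def init_ok_def)
      show "qstate (c 0 i) = fst (config y 0)" unfolding i0 using init[OF i] by (simp add: init_ok_def)
    qed
    then show ?case using fill[of 0] by blast
  next
    case (Suc t)
    then have t: "t < T" and IH: "\<And>i. i < W \<Longrightarrow> c t i = cell_of (config y t) i" by auto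
    obtain q ts where cf: "config y t = (q, ts)" by (metis surj_pair)
    obtain q' acts where n: "next_step M q (tape_reads ts) = (q', acts)" by (metis surj_pair)
    have qg: "qstate (cell_of (config y t) i) = q" "guess (cell_of (config y t) i) = tape_reads ts" for i
      by (simp_all add: cf cell_of_def)
    have "syms (c (Suc t) i) ! j = syms (cell_of (config y (Suc t)) i) ! j \<and>
        heads (c (Suc t) i) ! j = heads (cell_of (config y (Suc t)) i) ! j \<and>
        qstate (c (Suc t) i) = fst (config y (Suc t))" if i: "i < W" and j: "j < k" for i j
    proof -
      have lr: "lt i < W" "rt i < W" using W_pos by auto
      have st: "qstate (c (Suc t) i) = q' \<and> (\<forall>j<k. syms (c (Suc t) i) ! j =
          (if heads (cell_of (config y t) i) ! j then fst (acts ! j) else syms (cell_of (config y t) i) ! j) \<and>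
          (heads (c (Suc t) i) ! j \<longleftrightarrow> heads (cell_of (config y t) i) ! j \<and> snd (acts ! j) = 0 \<or>
            heads (cell_of (config y t) (lt i)) ! j \<and> snd (acts ! j) = 1 \<or>
            heads (cell_of (config y t) (rt i)) ! j \<and> snd (acts ! j) = - 1))"
        using step[OF t i] unfolding IH[OF i] IH[OF lr(1)] IH[OF lr(2)] step_ok_def qg n prod.case .
      show ?thesis
        unfolding step_cell_of[OF cf t i j n] using st j by (intro conjI) (simp_all only: simp_thms)
    qed
    then show ?case using fill[OF Suc.prems] by blast
  qed
  have obW: "ob < W" using W by simp
  have "syms (c T ob) ! (k - 1) = 2"
    using final[OF obW] init_cell(3)[OF obW w y_def] by (simp add: final_ok_def)
  then have last2: "syms (cell_of (config y T) ob) ! (k - 1) = 2" using inv[of T] obW by simp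
  obtain q ts where cf: "config y T = (q, ts)" by (metis surj_pair)
  note wf = config_wf[OF cf]
  have "ts \<noteq> []" using wf k_pos by auto
  then have lst: "last ts = ts ! (k - 1)" using wf by (simp add: last_conv_nth)
  have "length y \<le> 2 * length x + 1 + Q" using w by (simp add: y_def length_enc_bits)
  then obtain t' where "t' \<le> T" "tm_computes_in M y [y \<in> R] t'" using computes by blast
  then have "fst (last ts) = tape_of [y \<in> R]" using config_halted[of y _ t' T] cf by simp
  then have "tape_of [y \<in> R] 0 = 2" using last2 lst wf k_pos by (simp add: cf cell_of_def case_prod_unfold)
  then have "y \<in> R" by (simp add: tape_of_def split: if_splits)
  then show ?thesis using w y_def by blast
qed

end

section \<open>The reduction\<close>

text \<open>Up to \<open>pi / 3\<close> the derivative of \<open>sin t - t / 2\<close> is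
  nonnegative, and \<open>pi > 2\<close>; from there on the sine is at least 1/2, while
  \<open>x / pi\<close> is at most 1/2. This bound yields group distances of at least
  \<open>2 / m\<close>.\<close>

lemma sin_lower_bound:
  assumes "0 \<le> x" "x \<le> pi / 2"
  shows "x / pi \<le> sin x"
proof (cases "x \<le> pi / 3")
  case True
  have "(\<lambda>t. sin t - t / 2) 0 \<le> (\<lambda>t. sin t - t / 2) x"
  proof (rule DERIV_nonneg_imp_nondecreasing[OF assms(1)])
    fix t assume t: "0 \<le> t" "t \<le> x"
    have "cos (pi / 3) \<le> cos t" using t True by (intro cos_monotone_0_pi_le) auto
    then have "0 \<le> cos t - 1 / 2" by (simp add: cos_60)
    moreover have "DERIV (\<lambda>t. sin t - t / 2) t :> cos t - 1 / 2" by (auto intro!: derivative_eq_intros)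
    ultimately show "\<exists>y. DERIV (\<lambda>t. sin t - t / 2) t :> y \<and> 0 \<le> y" by blast
  qed
  then have "x / 2 \<le> sin x" by simp
  moreover have "x / pi \<le> x / 2" using assms(1) pi_gt3 by (intro divide_left_mono) auto
  ultimately show ?thesis by linarith
next
  case False
  have "sin (pi / 6) \<le> sin x" using False assms by (intro sin_monotone_2pi_le) auto
  moreover have "x / pi \<le> 1 / 2" using assms by (simp add: field_simps)
  ultimately show ?thesis using sin_30 by linarith
qed

lemma norm_polar_diff: "norm (polar 1 a - polar 1 b) = 2 * \<bar>sin ((a - b) / 2)\<bar>"
proof -
  have "(norm (polar 1 a - polar 1 b))\<^sup>2 = (cos a - cos b)\<^sup>2 + (sin a - sin b)\<^sup>2"
    unfolding power2_norm_eq_inner by (simp add: inner_vec_def sum_2 polar_def power2_eq_square)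
  also have "\<dots> = (cos a)\<^sup>2 + (sin a)\<^sup>2 + ((cos b)\<^sup>2 + (sin b)\<^sup>2) - 2 * (cos a * cos b + sin a * sin b)"
    by (simp add: power2_diff algebra_simps)
  also have "\<dots> = 2 - 2 * cos (a - b)" by (simp add: cos_diff)
  also have "\<dots> = (2 * \<bar>sin ((a - b) / 2)\<bar>)\<^sup>2"
  proof -
    have "2 * ((a - b) / 2) = a - b" by (simp only: times_divide_eq_right nonzero_mult_div_cancel_left zero_neq_numeral simp_thms)
    then have "cos (a - b) = 1 - 2 * sin ((a - b) / 2) ^ 2" using cos_double_sin[of "(a - b) / 2"] by (simp only:)
    then show ?thesis by (simp add: power_mult_distrib)
  qed
  finally show ?thesis by (rule power2_eq_imp_eq) auto
qed

lemma norm_polar: "norm (polar 1 a) = 1"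
  by (simp add: norm_eq_sqrt_inner inner_vec_def sum_2 polar_def flip: power2_eq_square)

text \<open>The chord between groups with index difference \<open>d\<close> is
  \<open>2 * sin (pi * d / m)\<close>. The sine does not change when \<open>d\<close> is replaced by
  \<open>m - d\<close>, and one of the two angles is at most \<open>pi / 2\<close>.\<close>

lemma equally_spaced_dist:
  assumes "g < m" "h < m" "g \<noteq> h"
  shows "2 * (1 / real m) \<le> norm (polar 1 (real (2 * g + 1) / real m * pi) - polar 1 (real (2 * h + 1) / real m * pi))"
proof -
  define d where "d = nat \<bar>int g - int h\<bar>"
  have d: "1 \<le> d" "d < m" using assms by (auto simp: d_def)
  have m: "real m > 0" using assms by simp
  have e: "(real (2 * g + 1) / real m * pi - real (2 * h + 1) / real m * pi) / 2 = (real g - real h) * pi / real m"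
    using m by (simp add: field_simps)
  have "\<bar>sin ((real g - real h) * pi / real m)\<bar> = \<bar>sin (real d * pi / real m)\<bar>"
  proof (cases "h \<le> g")
    case True
    then show ?thesis by (simp add: d_def of_nat_diff nat_diff_distrib)
  next
    case False
    then have "real g - real h = - real d" by (simp add: d_def)
    then show ?thesis unfolding \<open>real g - real h = - real d\<close> by simp
  qed
  moreover have "1 / real m \<le> sin (real d * pi / real m)"
  proof (cases "2 * d \<le> m")
    case True
    then have "real d * pi / real m \<le> pi / 2" using m by (simp add: field_simps)
    then have "real d * pi / real m / pi \<le> sin (real d * pi / real m)" by (intro sin_lower_bound) auto
    moreover have "1 / real m \<le> real d / real m" using d(1) by (intro divide_right_mono) auto
    ultimately show ?thesis by simp
  next
    case False
    have s: "sin (real d * pi / real m) = sin (real (m - d) * pi / real m)"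
    proof -
      have "real (m - d) * pi / real m = pi - real d * pi / real m" using d m by (simp add: of_nat_diff field_simps)
      then show ?thesis by simp
    qed
    have "real (m - d) * pi / real m \<le> pi / 2" using m d False by (simp add: field_simps of_nat_diff)
    then have "real (m - d) * pi / real m / pi \<le> sin (real (m - d) * pi / real m)" by (intro sin_lower_bound) auto
    moreover have "1 / real m \<le> real (m - d) / real m" using d by (intro divide_right_mono) auto
    ultimately show ?thesis unfolding s by simp
  qed
  ultimately show ?thesis unfolding norm_polar_diff e by linarith
qed

section \<open>Instances with groups of given square sizes\<close>

definition group_list :: "(nat \<Rightarrow> nat) \<Rightarrow> nat \<Rightarrow> nat list" where
  "group_list b m = concat (map (\<lambda>g. replicate (b g ^ 2) g) [0..<m])"

text \<open>Every group is at an odd multiple of \<open>\<pi> / m\<close>; for \<open>m\<close> a power of two the fractions are in lowest terms.\<close>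

definition description :: "(nat \<Rightarrow> nat) \<Rightarrow> nat \<Rightarrow> nat \<Rightarrow> nat \<Rightarrow> flamecast_description" where
  "description b m F B =
     (map (\<lambda>g. (1, Fract (int (2 * g + 1)) (int m))) (group_list b m), replicate F (0, 0), [B, B, 1], 1 / 2)"

lemma card_group_list:
  assumes "g < m"
  shows "card {i. i < length (group_list b m) \<and> group_list b m ! i = g} = b g ^ 2"
proof -
  have "length (filter (\<lambda>h. h = g) (concat (map (\<lambda>g. replicate (b g ^ 2) g) xs))) = (if g \<in> set xs then b g ^ 2 else 0)"
    if "distinct xs" for xs
    using that by (induction xs) (auto simp: filter_empty_conv)
  from this[of "[0..<m]"] show ?thesis
    using assms by (simp add: group_list_def length_filter_conv_card)
qed

lemma group_list_less: "i < length (group_list b m) \<Longrightarrow> group_list b m ! i < m"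
  using nth_mem[of i "group_list b m"] by (auto simp: group_list_def)

lemma length_group_list: "length (group_list b m) = (\<Sum>g<m. b g ^ 2)"
  by (simp add: group_list_def length_concat o_def sum_list_distinct_conv_sum_set atLeast0LessThan interv_sum_list_conv_sum_set_nat)

lemma description:
  fixes F :: nat
  assumes m: "2 \<le> m" and b: "\<And>g. g < m \<Longrightarrow> m < b g" and B: "1 \<le> B"
  defines "I \<equiv> described_instance (description b m F B)"
  shows "flamecast_instance I" "group_equally_spaced_circular I m" "num_layers I = 1"
    and "log (real (card (sources I))) (real m - 1 + cos (pi / real m)) \<le> alpha I"
    and "has_layout_of_cost I (\<Sum>g<m. real (b g)) \<longleftrightarrow>
      (\<exists>\<beta>. (\<forall>g<m. \<beta> g < F) \<and> (\<forall>t<F. (\<Sum>g | g < m \<and> \<beta> g = t. b g ^ 2) \<le> B))"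
proof -
  let ?gs = "group_list b m"
  let ?P = "\<lambda>g. polar 1 (real (2 * g + 1) / real m * pi)"
  have I: "sources I = {..<length ?gs}" "sinks I = {..<F}" "capacities I = [B, B, 1]" "alpha I = 1 / 2"
    by (simp_all add: I_def description_def of_rat_divide)
  have sp: "source_pos I i = ?P (?gs ! i)" if "i < length ?gs" for i
    using that m by (simp add: I_def description_def point_of_def of_rat_rat)
  have tp: "sink_pos I t = 0" if "t < F" for t
    using that by (simp add: I_def description_def point_of_def polar_def vec_eq_iff forall_2)
  have cg: "card {i \<in> sources I. ?gs ! i = g} = b g ^ 2" if "g < m" for g
    using card_group_list[OF that, of b] by (simp add: I)
  show "flamecast_instance I" using B by (simp add: flamecast_instance_def I)
  show "num_layers I = 1" by (simp add: num_layers_def I)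
  have onto: "(\<lambda>i. ?gs ! i) ` sources I = {..<m}"
  proof
    show "(\<lambda>i. ?gs ! i) ` sources I \<subseteq> {..<m}" using group_list_less by (auto simp: I)
    show "{..<m} \<subseteq> (\<lambda>i. ?gs ! i) ` sources I"
    proof
      fix g assume "g \<in> {..<m}"
      then have g: "g < m" by simp
      have "{i \<in> sources I. ?gs ! i = g} \<noteq> {}"
      proof
        assume em: "{i \<in> sources I. ?gs ! i = g} = {}"
        have "b g ^ 2 = 0" unfolding cg[OF g, symmetric] em by simp
        then show False using b[OF g] by simp
      qed
      then show "g \<in> (\<lambda>i. ?gs ! i) ` sources I" by blast
    qed
  qed
  have "?P g = 0 + polar 1 (pi / real m + 2 * pi * real g / real m)" for g
    by (simp add: field_simps add_divide_distrib)
  then have "\<forall>s\<in>sources I. source_pos I s = 0 + polar 1 (pi / real m + 2 * pi * real (?gs ! s) / real m)"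
    using sp by (simp add: I)
  moreover have "circular I 0 1" unfolding circular_def using sp tp by (simp add: I norm_polar)
  ultimately show "group_equally_spaced_circular I m"
    unfolding group_equally_spaced_circular_def using onto
    by (intro exI[of _ 0] exI[of _ 1] exI[of _ "pi / real m"] exI[of _ "\<lambda>i. ?gs ! i"]) auto
  \<comment> \<open>Every group has more than \<open>m^2\<close> sources. Hence
    \<open>log_n (m - 1 + cos (pi / m)) \<le> log_n m \<le> 1 / 2\<close>, which is the condition on
    \<alpha>.\<close>
  have n: "m ^ 2 \<le> length ?gs"
  proof -
    have "m ^ 2 \<le> b 0 ^ 2" using b[of 0] m by (intro power_mono) auto
    also have "\<dots> \<le> (\<Sum>g<m. b g ^ 2)" using m by (intro member_le_sum) auto
    finally show ?thesis by (simp add: length_group_list)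
  qed
  show "log (real (card (sources I))) (real m - 1 + cos (pi / real m)) \<le> alpha I"
  proof -
    let ?n = "real (length ?gs)"
    have "1 < m ^ 2" using m by (intro one_less_power) auto
    then have n1: "1 < ?n" using n by linarith
    have "0 \<le> pi / real m" by simp
    moreover have "pi / real m \<le> pi / 2" by (rule divide_left_mono) (use m in auto)
    ultimately have "0 \<le> cos (pi / real m)" by (intro cos_ge_zero) linarith+
    then have pos: "0 < real m - 1 + cos (pi / real m)" using m by linarith
    have "log ?n (real m - 1 + cos (pi / real m)) \<le> log ?n (real m)"
      using n1 pos m cos_le_one[of "pi / real m"] by (subst log_le_cancel_iff) auto
    also have "\<dots> = log ?n (real m ^ 2) / 2" using m by (simp add: log_nat_power)
    also have "log ?n (real m ^ 2) \<le> log ?n ?n"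
      using n1 n m by (subst log_le_cancel_iff) (auto simp flip: of_nat_power)
    also have "log ?n ?n = 1" using n1 by (intro log_eq_one) linarith+
    finally show ?thesis by (simp add: I)
  qed
  have "square_groups I (\<lambda>i. ?gs ! i) ?P b m F B (1 / real m)"
  proof
    show "finite (sources I)" by (simp add: I)
    show "sinks I = {..<F}" "capacities I = [B, B, 1]" "alpha I = 1 / 2" by (rule I)+
    show "sink_pos I t = 0" if "t < F" for t using that by (rule tp)
    show "source_pos I s = ?P (?gs ! s)" "?gs ! s < m" if "s \<in> sources I" for s
      using that sp group_list_less by (simp_all add: I)
    show "card {s \<in> sources I. ?gs ! s = g} = b g ^ 2" if "g < m" for g using that by (rule cg)
    show "norm (?P g) = 1" for g by (rule norm_polar)
    show "1 < real (b g) * (1 / real m)" if "g < m" for g using b[OF that] m by (simp add: field_simps)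
    show "2 * (1 / real m) \<le> norm (?P g - ?P h)" if "g < m" "h < m" "g \<noteq> h" for g h
      using that by (rule equally_spaced_dist)
    show "0 < 1 / real m" using m by simp
  qed
  then interpret square_groups I "\<lambda>i. ?gs ! i" ?P b m F B "1 / real m" .
  show "has_layout_of_cost I (\<Sum>g<m. real (b g)) \<longleftrightarrow>
      (\<exists>\<beta>. (\<forall>g<m. \<beta> g < F) \<and> (\<forall>t<F. (\<Sum>g | g < m \<and> \<beta> g = t. b g ^ 2) \<le> B))"
  proof
    assume "\<exists>\<beta>. (\<forall>g<m. \<beta> g < F) \<and> (\<forall>t<F. (\<Sum>g | g < m \<and> \<beta> g = t. b g ^ 2) \<le> B)"
    then obtain \<beta> where "\<forall>g<m. \<beta> g < F" "\<forall>t<F. (\<Sum>g | g < m \<and> \<beta> g = t. b g ^ 2) \<le> B" by (elim exE conjE)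
    then show "has_layout_of_cost I (\<Sum>g<m. real (b g))" by (intro packing_imp_layout[of \<beta>]) simp_all
  qed (rule layout_imp_packing)
qed

lemma enc_rat_Fract:
  assumes "coprime a c" "0 < c"
  shows "enc_rat (Fract (int a) (int c)) = False # enc_nat a @ False # enc_nat c"
  using assms by (simp add: enc_rat_def quotient_of_Fract enc_int_def normalize_stable)

lemma enc_rat_of_nat: "enc_rat (of_nat a) = False # enc_nat a @ enc_int 1"
  using enc_rat_Fract[of a 1] by (simp add: of_nat_rat enc_int_def)

text \<open>For \<open>Z \<ge> 1\<close> exactly one power of two lies between \<open>Z\<close> and
  \<open>2 * Z - 1\<close>, so the sum is the least power of two that is at least \<open>Z\<close>,
  in a form that translates into a program.\<close>

definition pow2_above :: "nat \<Rightarrow> nat" where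
  "pow2_above Z = (\<Sum>y<2 * Z. if is_pow2 y \<and> Z \<le> y then y else 0)"

lemma pow2_above:
  assumes "1 \<le> Z"
  shows "is_pow2 (pow2_above Z)" "Z \<le> pow2_above Z"
proof -
  define k where "k = (LEAST k. Z \<le> 2 ^ k)"
  have "Z \<le> 2 ^ Z" using less_exp[of Z] by simp
  then have k: "Z \<le> 2 ^ k" unfolding k_def by (rule LeastI)
  have k2: "2 ^ k < 2 * Z"
  proof (cases k)
    case (Suc j)
    then have "\<not> Z \<le> 2 ^ j" using not_less_Least[of j "\<lambda>k. Z \<le> 2 ^ k"] by (simp add: k_def)
    then show ?thesis using Suc by simp
  qed (use assms in auto)
  have "y = 2 ^ k" if y: "is_pow2 y" "Z \<le> y" "y < 2 * Z" for y
  proof -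
    obtain j where j: "y = 2 ^ j" using y(1) by (auto simp: is_pow2_def)
    have False if "a < b" "Z \<le> 2 ^ a" "2 ^ b < 2 * Z" for a b :: nat
    proof -
      have "(2 :: nat) ^ Suc a \<le> 2 ^ b" using that(1) by (intro power_increasing) auto
      then show False using that by simp
    qed
    note less = this
    have "\<not> j < k" using less[of j k] y(2) k2 by (auto simp: j)
    moreover have "\<not> k < j" using less[of k j] y(3) k by (auto simp: j)
    ultimately show ?thesis using j by simp
  qed
  moreover have "is_pow2 (2 ^ k)" by (auto simp: is_pow2_def)
  ultimately have "is_pow2 y \<and> Z \<le> y \<longleftrightarrow> y = 2 ^ k" if "y < 2 * Z" for y
    using that k by blast
  then have "pow2_above Z = (\<Sum>y<2 * Z. if y = 2 ^ k then 2 ^ k else 0)"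
    unfolding pow2_above_def by (intro sum.cong) simp_all
  also have "\<dots> = 2 ^ k" using k2 by simp
  finally have "pow2_above Z = 2 ^ k" .
  then show "is_pow2 (pow2_above Z)" "Z \<le> pow2_above Z" using k by (auto simp: is_pow2_def)
qed

lemma numf_pow2_above:
  assumes F: "numf D F" and fin: "finite D"
  shows "numf D (\<lambda>x v. pow2_above (F x v))"
  unfolding pow2_above_def
proof (rule numf_sum[OF numf_mult[OF numf_const F] _ _ fin])
  show "numf (insert e D) (\<lambda>x v. if is_pow2 (v e) \<and> F x v \<le> v e then v e else 0)" for e
    using fin by (intro numf_if boolf_conj boolf_is_pow2 boolf_le numf_const numf_var numf_weaken[OF F]
        insertI1 subset_insertI finite.insertI)
  fix x j and v v' :: "nat \<Rightarrow> nat" assume "\<And>i. i \<in> D \<Longrightarrow> v i = v' i"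
  then have "F x v = F x v'" by (rule numf_depends[OF F])
  then show "(if is_pow2 j \<and> F x v \<le> j then j else 0) = (if is_pow2 j \<and> F x v' \<le> j then j else 0)" by simp
qed

lemma numf_bounded:
  assumes "numf D A" "\<And>x v. A x v < R" "\<And>c. c < R \<Longrightarrow> numf D (H c)"
  shows "numf D (\<lambda>x v. H (A x v) x v)"
  using numf_table[of R D H A] assms by simp

lemma numf_bool_cases:
  assumes "boolf D P" "numf D (H True)" "numf D (H False)"
  shows "numf D (\<lambda>x v. H (P x v) x v)"
proof -
  have "numf D (\<lambda>x v. if P x v then H True x v else H False x v)" using assms by (rule numf_if)
  moreover have "(\<lambda>x v. if P x v then H True x v else H False x v) = (\<lambda>x v. H (P x v) x v)"
    by (intro ext) auto
  ultimately show ?thesis by simp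
qed

lemma numf_sum_const: "(\<And>l. numf D (H l)) \<Longrightarrow> numf D (\<lambda>x v. \<Sum>l<(c :: nat). H l x v)"
  by (induction c) (simp_all add: numf_const numf_add)

section \<open>The reduction function and its program\<close>

locale np_reduction =
  fixes M :: tm and pM q :: "nat poly" and R L :: "bool list set"
  assumes wf: "wf_tm M" and M: "\<And>y. \<exists>t\<le>poly pM (length y). tm_computes_in M y [y \<in> R] t"
    and L: "\<And>x. x \<in> L \<longleftrightarrow> (\<exists>w. length w \<le> poly q (length x) \<and> enc_bits x @ w \<in> R)"
begin

definition "G = card (cells M)"
definition "e = (SOME e. bij_betw e {..<G} (cells M))"
definition "Q x = poly q (length x)" for x :: "bool list"
text \<open>The longest input of the verifier, \<open>enc_bits x\<close> followed by a certificate
  of length \<open>Q x\<close>, has length \<open>2 * length x + 1 + Q x\<close>; by monotonicity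
  \<open>T x\<close> bounds the time for all shorter inputs as well.\<close>

definition "T x = poly pM (2 * length x + 1 + Q x)" for x :: "bool list"
definition "W x = 2 * T x + 2 * length x + Q x + 4" for x :: "bool list"
definition "N x = (T x + 1) * W x" for x :: "bool list"
definition "F x = N x * frames_per_cell G" for x :: "bool list"
definition "ids x = N x * colours G" for x :: "bool list"
definition "S x = frame (up_cell (T x + 1) (W x)) (right_cell (W x)) G (cell_ok M e G x (T x) (W x) (Q x))" for x :: "bool list"
definition "X x = goal_weight (ids x) 5" for x :: "bool list"
definition "m x = pow2_above (6 * F x)" for x :: "bool list"
text \<open>The least \<open>M\<close> allowed in \<open>squares_packing\<close> for padding items
  of size \<open>m x + 1\<close>.\<close>

definition "big x = X x ^ 2 + m x * (m x + 1) ^ 2 + 2 * X x + 2" for x :: "bool list"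
text \<open>A frame of 5 elements yields 6 items. The remaining groups, up to the power of two
  \<open>m x\<close>, have size \<open>m x + 1\<close>, the smallest integer above
  \<open>m x\<close>, as the geometric argument demands \<open>b > m\<close>.\<close>

definition "sz x g = (if g < 6 * F x then big x + weight (ids x) 5 (S x) (g div 6) (g mod 6) else m x + 1)" for x :: "bool list" and g :: nat
definition "B x = 6 * big x ^ 2 + 2 * big x * X x + 2 * big x - 1" for x :: "bool list"
definition "K x = (\<Sum>g<m x. sz x g)" for x :: "bool list"
definition "input x = (description (sz x) (m x) (F x) (B x), of_nat (K x) :: rat)" for x :: "bool list"

lemma e: "bij_betw e {..<G} (cells M)"
proof -
  have "\<exists>e. bij_betw e {..<G} (cells M)"
    using ex_bij_betw_nat_finite[OF finite_cells, of M] by (simp add: G_def atLeast0LessThan)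
  then show ?thesis unfolding e_def by (rule someI_ex)
qed

lemma G_pos: "0 < G"
proof -
  have "(replicate (tm_tapes M) 0, replicate (tm_tapes M) False, 0, replicate (tm_tapes M) 0) \<in> cells M"
    using wf by (auto simp: cells_def wf_tm_def)
  then show ?thesis unfolding G_def using finite_cells card_gt_0_iff by blast
qed

lemma W_pos: "0 < W x" by (simp add: W_def)

lemma F_pos: "0 < F x"
  using W_pos[of x] G_pos by (simp add: F_def N_def frames_per_cell_def)

lemma m: "is_pow2 (m x)" "6 * F x \<le> m x" "2 \<le> m x"
  using pow2_above[of "6 * F x"] F_pos[of x] by (auto simp: m_def)

lemma m_less_sz: "m x < sz x g"
proof -
  have "m x * 1 \<le> m x * (m x + 1) ^ 2" by (intro mult_le_mono2) simp
  then have "m x < big x" unfolding big_def by linarith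
  then show ?thesis by (simp add: sz_def)
qed

lemma in_L_iff: "x \<in> L \<longleftrightarrow> has_layout_of_cost (described_instance (fst (input x))) (real_of_rat (snd (input x)))"
proof -
  interpret tb: tableau M e G "T x" "W x" "Q x" x R
  proof
    fix y :: "bool list" assume y: "length y \<le> 2 * length x + 1 + Q x"
    obtain t where t: "t \<le> poly pM (length y)" "tm_computes_in M y [y \<in> R] t" using M by blast
    moreover have "poly pM (length y) \<le> T x" unfolding T_def by (rule poly_mono_nat[OF y])
    ultimately show "\<exists>t\<le>T x. tm_computes_in M y [y \<in> R] t" by (meson le_trans)
  qed (use wf e in \<open>auto simp: W_def\<close>)
  interpret tr: torus "N x" G "up_cell (T x + 1) (W x)" "right_cell (W x)" "cell_ok M e G x (T x) (W x) (Q x)"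
    unfolding N_def
    by (rule torus.intro[OF bij_up_cell[OF W_pos] bij_right_cell[OF W_pos] G_pos]) simp
  interpret mt: matching "F x" "ids x" 5 "S x"
    unfolding F_def ids_def S_def
    by unfold_locales (use tr.frame_less tr.frame_occurs F_pos[of x] in \<open>auto simp: F_def\<close>)
  have six: "(5 :: nat) + 1 = 6" by simp
  have "x \<in> L \<longleftrightarrow> (\<exists>w. length w \<le> Q x \<and> enc_bits x @ w \<in> R)" by (simp add: L Q_def)
  also have "\<dots> \<longleftrightarrow> (\<exists>\<tau>. tiling (N x) (up_cell (T x + 1) (W x)) (right_cell (W x)) G (cell_ok M e G x (T x) (W x) (Q x)) \<tau>)"
    unfolding N_def using tb.accepting_imp_tiling tb.tiling_imp_accepting by blast
  also have "\<dots> \<longleftrightarrow> exact_cover (F x) (ids x) 5 (S x)"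
    unfolding F_def ids_def S_def using tr.cover_imp_tiling tr.tiling_imp_cover by blast
  also have "\<dots> \<longleftrightarrow> (\<exists>\<beta>. (\<forall>g<m x. \<beta> g < F x) \<and> (\<forall>t<F x. (\<Sum>g | g < m x \<and> \<beta> g = t. sz x g ^ 2) \<le> B x))"
    unfolding sz_def B_def
    using mt.squares_packing[of "m x" "m x + 1" "big x", unfolded six, OF m(2), folded X_def, symmetric] by (simp add: big_def)
  also have "\<dots> \<longleftrightarrow> has_layout_of_cost (described_instance (description (sz x) (m x) (F x) (B x))) (\<Sum>g<m x. real (sz x g))"
    using description(5)[where B = "B x" and F = "F x", OF m(3) m_less_sz] by (simp add: B_def big_def)
  also have "(\<Sum>g<m x. real (sz x g)) = real (K x)" by (simp only: K_def of_nat_sum)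
  also have "\<dots> = real_of_rat (of_nat (K x))" by (rule of_rat_of_nat_eq[symmetric])
  finally show ?thesis by (simp add: input_def)
qed

lemma numf_Q: "numf D (\<lambda>x v. Q x)"
  unfolding Q_def by (intro numf_poly numf_length)

lemma numf_T: "numf D (\<lambda>x v. T x)"
  unfolding T_def by (intro numf_poly numf_add numf_mult numf_const numf_length numf_Q)

lemma numf_W: "numf D (\<lambda>x v. W x)"
  unfolding W_def by (intro numf_add numf_mult numf_const numf_length numf_Q numf_T)

lemma numf_N: "numf D (\<lambda>x v. N x)"
  unfolding N_def by (intro numf_add numf_mult numf_const numf_T numf_W)

lemma numf_F: "numf D (\<lambda>x v. F x)"
  unfolding F_def by (intro numf_mult numf_const numf_N)

lemma numf_ids: "numf D (\<lambda>x v. ids x)"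
  unfolding ids_def by (intro numf_mult numf_const numf_N)

lemma numf_X: "numf D (\<lambda>x v. X x)"
  unfolding X_def goal_weight_def target_def radix_def
  by (intro numf_sum_const numf_add numf_mult numf_if numf_power numf_const numf_ids)

lemma numf_m: "finite D \<Longrightarrow> numf D (\<lambda>x v. m x)"
  unfolding m_def by (intro numf_pow2_above numf_mult numf_const numf_F)

lemma numf_big: "finite D \<Longrightarrow> numf D (\<lambda>x v. big x)"
  unfolding big_def by (intro numf_add numf_mult numf_power numf_const numf_X numf_m)

lemma numf_B: "finite D \<Longrightarrow> numf D (\<lambda>x v. B x)"
  unfolding B_def by (intro numf_minus numf_add numf_mult numf_power numf_const numf_X numf_big)

lemma numf_kind:
  assumes "numf D A" "finite D"
  shows "numf D (\<lambda>x v. kind x (T x + 1) (Q x) (A x v))"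
  unfolding kind_def using assms
  by (intro numf_if numf_add numf_mult numf_minus numf_div boolf_conj boolf_not boolf_less boolf_eq boolf_dvd
      numf_bit numf_const numf_length numf_T numf_Q)

lemma kind_less: "kind x ob Q' i < 8"
  by (simp add: kind_def)

text \<open>The two row flags, the kind (below 8) and the tile (below
  \<open>frames_per_cell G\<close>) range over finite sets fixed by the verifier. So
  \<open>tile_ok\<close>, with the machine and the arbitrary enumeration \<open>e\<close> in it, is
  tabulated; only its arguments are computed.\<close>

lemma boolf_cell_ok:
  assumes A: "numf D A" and U: "numf D U" "\<And>x v. U x v < frames_per_cell G" and fin: "finite D"
  shows "boolf D (\<lambda>x v. cell_ok M e G x (T x) (W x) (Q x) (A x v) (U x v))"
proof -
  define h :: "bool \<Rightarrow> bool \<Rightarrow> nat \<Rightarrow> nat \<Rightarrow> nat" where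
    "h z l \<kappa> u = of_bool (tile_ok M z l \<kappa> (e (base_digit G u 0)) (e (base_digit G u 1))
      (e (base_digit G u 2)) (e (base_digit G u 3)))" for z l \<kappa> u
  have Z: "boolf D (\<lambda>x v. A x v div W x = 0)" and Z': "boolf D (\<lambda>x v. A x v div W x = T x)"
    by (intro boolf_eq numf_div A fin numf_W numf_T numf_const)+
  have k: "numf D (\<lambda>x v. kind x (T x + 1) (Q x) (A x v mod W x))"
    by (intro numf_kind numf_mod A fin numf_W)
  have "numf D (\<lambda>x v. h (A x v div W x = 0) l \<kappa> u)" for l \<kappa> u
    by (rule numf_bool_cases[OF Z, where H = "\<lambda>b x v. h b l \<kappa> u"]) (rule numf_const)+
  then have "numf D (\<lambda>x v. h (A x v div W x = 0) (A x v div W x = T x) \<kappa> u)" for \<kappa> u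
    by (intro numf_bool_cases[OF Z', where H = "\<lambda>b x v. h (A x v div W x = 0) b \<kappa> u"])
  then have "numf D (\<lambda>x v. h (A x v div W x = 0) (A x v div W x = T x) (kind x (T x + 1) (Q x) (A x v mod W x)) u)" for u
    by (intro numf_bounded[OF k kind_less, where H = "\<lambda>c x v. h (A x v div W x = 0) (A x v div W x = T x) c u"])
  then have "numf D (\<lambda>x v. h (A x v div W x = 0) (A x v div W x = T x) (kind x (T x + 1) (Q x) (A x v mod W x)) (U x v))"
    by (intro numf_bounded[OF U, where H = "\<lambda>c x v. h (A x v div W x = 0) (A x v div W x = T x) (kind x (T x + 1) (Q x) (A x v mod W x)) c"])
  then show ?thesis unfolding h_def cell_ok_def .
qed

lemma numf_S:
  assumes A: "numf D A" and fin: "finite D"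
  shows "numf D (\<lambda>x v. S x (A x v) s)"
proof -
  have p: "numf D (\<lambda>x v. A x v div frames_per_cell G)" and u: "numf D (\<lambda>x v. A x v mod frames_per_cell G)"
    by (intro numf_div numf_mod A fin numf_const)+
  have ul: "y mod frames_per_cell G < frames_per_cell G" for y
    using G_pos by (simp add: frames_per_cell_def)
  show ?thesis
    unfolding S_def frame_def cell_frame_def up_cell_def right_cell_def base_digit_def
    by (intro numf_if boolf_less boolf_cell_ok numf_add numf_mult numf_minus numf_div numf_mod p u ul A fin
        numf_const numf_W numf_T)
qed

lemma boolf_fresh:
  assumes A: "numf D A" and fin: "finite D"
  shows "boolf D (\<lambda>x v. fresh (S x) (A x v) s)"
  unfolding fresh_def
proof (rule boolf_all[OF A _ _ fin])
  show "boolf (insert e' D) (\<lambda>x v. \<not> S x (v e') s = S x (A x v) s)" for e'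
    using fin by (intro boolf_not boolf_eq numf_S numf_var numf_weaken[OF A] insertI1 subset_insertI finite.insertI)
  fix x j and v v' :: "nat \<Rightarrow> nat" assume "\<And>i. i \<in> D \<Longrightarrow> v i = v' i"
  then have "A x v = A x v'" by (rule numf_depends[OF A])
  then show "(S x j s \<noteq> S x (A x v) s) = (S x j s \<noteq> S x (A x v') s)" by simp
qed

lemma numf_weight:
  assumes A: "numf D A" and fin: "finite D"
  shows "numf D (\<lambda>x v. weight (ids x) 5 (S x) (A x v) k)"
  unfolding weight_def digit_def flag_def radix_def
  by (intro numf_sum_const numf_if boolf_fresh numf_S numf_add numf_mult numf_minus numf_power numf_const numf_ids A fin)

lemma numf_sz:
  assumes A: "numf D A" and fin: "finite D"
  shows "numf D (\<lambda>x v. sz x (A x v))"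
proof -
  have d: "numf D (\<lambda>x v. A x v div 6)" and k: "numf D (\<lambda>x v. A x v mod 6)"
    by (intro numf_div numf_mod A fin numf_const)+
  have "numf D (\<lambda>x v. weight (ids x) 5 (S x) (A x v div 6) (A x v mod 6))"
    by (rule numf_bounded[OF k, where H = "\<lambda>c x v. weight (ids x) 5 (S x) (A x v div 6) c" and R = 6])
      (auto intro: numf_weight d fin)
  then show ?thesis unfolding sz_def
    by (intro numf_if boolf_less numf_add numf_mult numf_const numf_F numf_big numf_m A fin)
qed

lemma numf_K: "finite D \<Longrightarrow> numf D (\<lambda>x v. K x)"
  unfolding K_def by (intro numf_sum numf_m numf_sz numf_var insertI1 finite.insertI) auto

lemma concat_replicate: "concat (map f (replicate n a)) = concat (map (\<lambda>j. f a) [0..<n])"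
  by (induction n) (simp_all add: replicate_append_same[symmetric])

lemma concat_map_concat: "concat (map f (concat xss)) = concat (map (\<lambda>xs. concat (map f xs)) xss)"
  by (induction xss) auto

text \<open>Writes the code of the instance as nested loops over the sources of every group. The
  angles can be emitted without computing a gcd, as \<open>2 * g + 1\<close> is odd and
  \<open>m x\<close> is a power of two.\<close>

lemma enc_input_eq:
  "enc_input (input x) =
     concat (map (\<lambda>g. concat (map (\<lambda>j. [True] @ enc_rat 1 @ [False] @ enc_nat (2 * g + 1) @ [False] @ enc_nat (m x))
        [0..<sz x g ^ 2])) [0..<m x]) @ [False] @
     concat (map (\<lambda>j. [True] @ enc_point (0, 0)) [0..<F x]) @ [False] @
     [True] @ enc_nat (B x) @ [True] @ enc_nat (B x) @ [True] @ enc_nat 1 @ [False] @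
     enc_rat (1 / 2) @ [False] @ enc_nat (K x) @ enc_int 1"
proof -
  have "coprime (2 * g + 1) (m x)" for g
  proof -
    obtain k where "m x = 2 ^ k" using m(1) by (auto simp: is_pow2_def)
    then show ?thesis by (simp add: coprime_commute)
  qed
  then have pt: "enc_point (1, Fract (int (2 * g + 1)) (int (m x))) =
      enc_rat 1 @ [False] @ enc_nat (2 * g + 1) @ [False] @ enc_nat (m x)" for g
    using enc_rat_Fract[of "2 * g + 1" "m x"] m(3)[of x] by (simp add: enc_point_def)
  have "concat (map (\<lambda>p. True # enc_point p) (map (\<lambda>g. (1, Fract (int (2 * g + 1)) (int (m x)))) (group_list (sz x) (m x)))) =
      concat (map (\<lambda>g. concat (map (\<lambda>j. True # enc_point (1, Fract (int (2 * g + 1)) (int (m x)))) [0..<sz x g ^ 2])) [0..<m x])"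
    unfolding group_list_def map_map o_def concat_map_concat concat_replicate ..
  then show ?thesis
    unfolding input_def description_def enc_input.simps enc_list_def concat_replicate pt
    by (simp add: enc_rat_of_nat)
qed

lemma polytime_reduction: "polytime (\<lambda>x. enc_input (input x))"
proof (rule polytime_wordf)
  show "wordf {} (\<lambda>x v. enc_input (input x))"
    unfolding enc_input_eq
    by (intro wordf_append wordf_concat wordf_const wordf_enc_nat numf_power numf_add numf_mult numf_const numf_var
        numf_sz numf_m numf_F numf_B numf_K insertI1 finite.insertI finite.emptyI) auto
qed

end

theorem theorem20:
  "NP_hard_on enc_input
     {(X, K). \<exists>m \<ge> 2. flamecast_instance (described_instance X) \<and>
        group_equally_spaced_circular (described_instance X) m \<and>
        num_layers (described_instance X) = 1 \<and>
        alpha (described_instance X) \<ge>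
          log (real (card (sources (described_instance X)))) (real m - 1 + cos (pi / real m))}
     (\<lambda>(X, K). has_layout_of_cost (described_instance X) (real_of_rat K))"
  (is "NP_hard_on enc_input ?D ?P")
  unfolding NP_hard_on_def
proof
  fix L assume "L \<in> class_NP"
  then obtain R q where "R \<in> class_P"
    and L: "\<And>x. x \<in> L \<longleftrightarrow> (\<exists>w. length w \<le> poly q (length x) \<and> enc_bits x @ w \<in> R)"
    unfolding class_NP_def by blast
  then obtain M pM where "wf_tm M" "\<And>y. \<exists>t\<le>poly pM (length y). tm_computes_in M y [y \<in> R] t"
    unfolding class_P_def polytime_def by blast
  then interpret np_reduction M pM q R L using L by unfold_locales auto
  have dom: "input x \<in> ?D" for x
    using description(1-4)[where B = "B x" and F = "F x", OF m(3) m_less_sz] m(3)[of x]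
    by (auto simp: input_def B_def big_def)
  have iff: "x \<in> L \<longleftrightarrow> ?P (input x)" for x
    using in_L_iff[of x] by (simp add: case_prod_unfold)
  show "\<exists>f. polytime f \<and> (\<forall>x. \<exists>i\<in>?D. f x = enc_input i \<and> (x \<in> L \<longleftrightarrow> ?P i))"
  proof (intro exI conjI allI)
    show "polytime (\<lambda>x. enc_input (input x))" by (rule polytime_reduction)
    show "\<exists>i\<in>?D. enc_input (input x) = enc_input i \<and> (x \<in> L \<longleftrightarrow> ?P i)" for x
      by (intro bexI[of _ "input x"] conjI refl iff dom)
  qed
qed

end
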